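(* Let $\Bbbk$ be a field with $\mathrm{char}(\Bbbk)=0$. Let $A=\Bbbk[x_1,x_2,x_3]$ be a quadratic polynomial Poisson algebra in three variables. If $A$ has nontrivial (i.e. not identically zero) Poisson bracket, then the $d$th Veronese algebra $A^{(d)}$ is Poisson cancellative for every $d\ge1$.
   Context: A Poisson algebra is a commutative $\Bbbk$-algebra with a $\Bbbk$-bilinear bracket $\{-,-\}$ that is a Lie bracket and a biderivation; isomorphisms preserve products and brackets. A Poisson bracket on $A=\Bbbk[x_1,\dots,x_n]$ is quadratic if $\{x_i,x_j\}\in A_2$ for all $i,j$, where $A=\bigoplus_{m\ge0}A_m$ is the standard grading. The $d$th Veronese subalgebra is the Poisson subalgebra $A^{(d)}=\bigoplus_{m\ge0}A_{dm}$. For a Poisson algebra $A$, $A[t]$ denotes the polynomial extension with the bracket extending that of $A$ and with $t$ Poisson central. $A$ is Poisson cancellative if for every Poisson algebra $B$, a Poisson isomorphism $A[t]\cong B[s]$ implies $A\cong B$ as Poisson algebras. *)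

theory Defs
  imports
    "HOL-Library.Poly_Mapping"
    "HOL-Library.Numeral_Type"
    "HOL-Algebra.UnivPoly"
    "HOL-Algebra.QuotRing"
    "HOL-Algebra.Algebraic_Closure_Type"
begin

section \<open>Poisson algebras\<close>

record ('k, 'a) poisson = "('k, 'a) module" +
  bracket :: "'a \<Rightarrow> 'a \<Rightarrow> 'a"

locale poisson_algebra = algebra K A for K and A :: "('k, 'a, 'm) poisson_scheme" (structure) +
  assumes bracket_closed:
      "\<lbrakk>x \<in> carrier A; y \<in> carrier A\<rbrakk> \<Longrightarrow> bracket A x y \<in> carrier A"
    and bracket_add_left:
      "\<lbrakk>x \<in> carrier A; y \<in> carrier A; z \<in> carrier A\<rbrakk> \<Longrightarrow>
        bracket A (x \<oplus> y) z = bracket A x z \<oplus> bracket A y z"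
    and bracket_add_right:
      "\<lbrakk>x \<in> carrier A; y \<in> carrier A; z \<in> carrier A\<rbrakk> \<Longrightarrow>
        bracket A x (y \<oplus> z) = bracket A x y \<oplus> bracket A x z"
    and bracket_smult_left:
      "\<lbrakk>c \<in> carrier K; x \<in> carrier A; y \<in> carrier A\<rbrakk> \<Longrightarrow>
        bracket A (c \<odot> x) y = c \<odot> bracket A x y"
    and bracket_smult_right:
      "\<lbrakk>c \<in> carrier K; x \<in> carrier A; y \<in> carrier A\<rbrakk> \<Longrightarrow>
        bracket A x (c \<odot> y) = c \<odot> bracket A x y"
    and bracket_alternating:
      "x \<in> carrier A \<Longrightarrow> bracket A x x = \<zero>"
    and bracket_jacobi:
      "\<lbrakk>x \<in> carrier A; y \<in> carrier A; z \<in> carrier A\<rbrakk> \<Longrightarrow>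
        bracket A x (bracket A y z) \<oplus> bracket A y (bracket A z x)
          \<oplus> bracket A z (bracket A x y) = \<zero>"
    and bracket_mult_left:
      "\<lbrakk>x \<in> carrier A; y \<in> carrier A; z \<in> carrier A\<rbrakk> \<Longrightarrow>
        bracket A (x \<otimes> y) z = x \<otimes> bracket A y z \<oplus> bracket A x z \<otimes> y"
    and bracket_mult_right:
      "\<lbrakk>x \<in> carrier A; y \<in> carrier A; z \<in> carrier A\<rbrakk> \<Longrightarrow>
        bracket A x (y \<otimes> z) = y \<otimes> bracket A x z \<oplus> bracket A x y \<otimes> z"

definition poisson_iso ::
    "('k, 'c) ring_scheme \<Rightarrow> ('k, 'a, 'm) poisson_scheme \<Rightarrow> ('k, 'b, 'n) poisson_scheme \<Rightarrow> ('a \<Rightarrow> 'b) set"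
  where "poisson_iso K A B =
    {h \<in> ring_iso A B.
      (\<forall>c\<in>carrier K. \<forall>x\<in>carrier A. h (c \<odot>\<^bsub>A\<^esub> x) = c \<odot>\<^bsub>B\<^esub> h x) \<and>
      (\<forall>x\<in>carrier A. \<forall>y\<in>carrier A. h (bracket A x y) = bracket B (h x) (h y))}"

definition poisson_isomorphic ::
    "('k, 'c) ring_scheme \<Rightarrow> ('k, 'a, 'm) poisson_scheme \<Rightarrow> ('k, 'b, 'n) poisson_scheme \<Rightarrow> bool"
  where "poisson_isomorphic K A B \<longleftrightarrow> poisson_iso K A B \<noteq> {}"

text \<open>
  The polynomial extension \<open>A[t]\<close>: the underlying ring is \<open>UP A\<close>, whose elements are coefficient
  sequences.  Scalars are those of the base field, not the elements of \<open>A\<close> as in \<open>UP A\<close>.  Since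
  \<open>t\<close> is Poisson central, the biderivation property forces
  \<open>{a t^i, b t^j} = {a, b} t^(i + j)\<close>, which gives the formula for the bracket.
\<close>

definition poly_extension :: "('k, 'a, 'm) poisson_scheme \<Rightarrow> ('k, nat \<Rightarrow> 'a) poisson"
  where "poly_extension A = \<lparr>
    carrier = carrier (UP A),
    monoid.mult = monoid.mult (UP A),
    one = monoid.one (UP A),
    ring.zero = ring.zero (UP A),
    add = add (UP A),
    module.smult = (\<lambda>c p n. c \<odot>\<^bsub>A\<^esub> p n),
    bracket = (\<lambda>p q n. \<Oplus>\<^bsub>A\<^esub>i\<in>{..n}. bracket A (p i) (q (n - i)))\<rparr>"

text \<open>
  HOL cannot quantify over types inside a definition, so the type carrying the competing algebra
  \<open>B\<close> is a parameter.  A statement with \<open>'b\<close> a free type variable ranges over all Poisson algebras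
  \<open>B\<close>.
\<close>

definition poisson_cancellative ::
    "'b itself \<Rightarrow> ('k, 'c) ring_scheme \<Rightarrow> ('k, 'a, 'm) poisson_scheme \<Rightarrow> bool"
  where "poisson_cancellative (T :: 'b itself) K A \<longleftrightarrow>
    (\<forall>B :: ('k, 'b) poisson. poisson_algebra K B \<longrightarrow>
      poisson_isomorphic K (poly_extension A) (poly_extension B) \<longrightarrow>
      poisson_isomorphic K A B)"


section \<open>Polynomial Poisson algebras\<close>

text \<open>Finitely supported maps from exponent vectors to coefficients, with convolution product.\<close>

type_synonym ('v, 'k) mpoly = "('v \<Rightarrow>\<^sub>0 nat) \<Rightarrow>\<^sub>0 'k"

definition indet :: "'v \<Rightarrow> ('v, 'k::field) mpoly"
  where "indet i = Poly_Mapping.single (Poly_Mapping.single i 1) 1"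

definition homogeneous :: "nat \<Rightarrow> ('v::finite, 'k::field) mpoly set"
  where "homogeneous m =
    {p. \<forall>e\<in>Poly_Mapping.keys p. (\<Sum>i\<in>UNIV. Poly_Mapping.lookup e i) = m}"

definition polynomial_poisson ::
    "(('v, 'k::field) mpoly \<Rightarrow> ('v, 'k) mpoly \<Rightarrow> ('v, 'k) mpoly) \<Rightarrow> ('k, ('v, 'k) mpoly) poisson"
  where "polynomial_poisson br = \<lparr>
    carrier = UNIV,
    monoid.mult = (*),
    one = 1,
    ring.zero = 0,
    add = (+),
    module.smult = (\<lambda>c p. Poly_Mapping.single 0 c * p),
    bracket = br\<rparr>"

definition quadratic ::
    "(('v::finite, 'k::field) mpoly \<Rightarrow> ('v, 'k) mpoly \<Rightarrow> ('v, 'k) mpoly) \<Rightarrow> bool"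
  where "quadratic br \<longleftrightarrow> (\<forall>i j. br (indet i) (indet j) \<in> homogeneous 2)"

definition veronese ::
    "nat \<Rightarrow> ('k, ('v::finite, 'k::field) mpoly) poisson \<Rightarrow> ('k, ('v, 'k) mpoly) poisson"
  where "veronese d A =
    A\<lparr>carrier := {\<Sum>m\<le>N. f m | N f. \<forall>m. f m \<in> homogeneous (d * m)}\<rparr>"

end

theory Submission
  imports Defs "HOL-Computational_Algebra.Polynomial" "HOL-Analysis.Cartesian_Space"
begin

text \<open>
  Let \<open>R = A\<^sup>(\<^sup>d\<^sup>)\<close> and let \<open>R[t] \<cong> B[s]\<close>. Transported to \<open>M = R[t]\<close>, the
  derivation \<open>D = d/ds\<close> is locally nilpotent, respects the bracket, has the central element \<open>s\<close> as a
  slice (\<open>D s = 1\<close>), and its kernel is a copy of \<open>B\<close>. Evaluation at \<open>s = 0\<close> is a Poisson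
  homomorphism \<open>\<pi>\<close> from \<open>M\<close> onto this kernel, with kernel \<open>s M\<close>. It remains to find a Poisson
  isomorphism from \<open>R\<close> to the kernel of \<open>D\<close>.

  Everything is decided on the Poisson centre. The centre of \<open>M\<close> is \<open>Z[t]\<close>, where \<open>Z\<close> is the centre of
  \<open>R\<close>; it contains \<open>s\<close> and is stable under \<open>D\<close>. Because the bracket is not zero, its \<open>3 \<times> 3\<close>
  matrix of structure polynomials has rank two, so the gradients of any two elements of \<open>Z\<close> are parallel
  (\<open>gradients_parallel\<close>): \<open>Z\<close> is a graded algebra of transcendence degree at most one.

  Suppose first that no coefficient of \<open>D z\<close>, for \<open>z\<close> in \<open>Z\<close>, has a constant term. Then \<open>D\<close> preserves
  \<open>Z\<^sub>+[t]\<close>. If \<open>D f\<close> were nonzero for a homogeneous \<open>f\<close> in \<open>Z\<^sub>+\<close>, then the last nonzero iterate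
  \<open>q = D\<^sup>k f\<close> would lie in \<open>Z\<^sub>+[t]\<close>. Homogeneous elements of \<open>Z\<^sub>+\<close> have proportional powers, so
  \<open>f\<close> divides a power of \<open>q\<close>; but kernels of locally nilpotent derivations contain all factors of their nonzero
  elements, whence \<open>D f = 0\<close> after all (\<open>D_center_zero\<close>). Thus \<open>D\<close> vanishes on \<open>Z\<close>, which forces
  \<open>s\<close> to be linear in \<open>t\<close> with a constant leading coefficient, and \<open>\<pi>\<close> restricts to an isomorphism on
  \<open>R\<close> (\<open>kernel_iso_if_D_center_zero\<close>).

  The constant term of a derivation of \<open>R\<close> at the origin depends only on linear parts
  (\<open>point_derivation_linear_part\<close>). So otherwise \<open>d = 1\<close>, and the component of degree \<open>-1\<close> of
  a coefficient of \<open>D\<close> is, up to a scalar, a constant-coefficient Poisson derivation \<open>\<delta>\<close> of \<open>A\<close> with \<open>\<delta> f = 1\<close> for a central linear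
  form \<open>f\<close>. Then \<open>A\<close> is a polynomial ring in \<open>f\<close> over the kernel of \<open>\<delta>\<close>, the centre of
  \<open>A[t]\<close> is the plane \<open>k[f, t]\<close>, and \<open>B\<close> is recovered from \<open>A\<close> once \<open>s\<close> is known to be one of
  two generators of \<open>k[f, t]\<close>; this is cancellation for the affine line. On the plane \<open>D\<close> has divergence zero: for
  \<open>c\<close> in the kernel, \<open>D\<close> multiplies the Jacobian of \<open>c\<close> and \<open>s\<close> by minus the divergence, while a locally
  nilpotent derivation has no eigenfunction with a nonzero eigenvalue, even a variable one (\<open>divergence_zero\<close>).
  Hence \<open>D\<close> is the Hamiltonian derivation of some \<open>p\<close>, and \<open>k[f, t] = k[p, s]\<close>. The substitution that
  moves \<open>f\<close> to \<open>p\<close> and fixes the kernel of \<open>\<delta>\<close>, followed by \<open>\<pi>\<close>, is the isomorphism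
  (\<open>kernel_iso_\<pi>\<theta>\<close>).
\<close>

alias lookup = Poly_Mapping.lookup
alias single = Poly_Mapping.single
alias keys = Poly_Mapping.keys
alias coeff = Polynomial.coeff
alias degree = Polynomial.degree
alias monom = Polynomial.monom

section \<open>Locally nilpotent derivations\<close>

text \<open>
  The algebra is a subset \<open>M\<close> of the ambient ring, not a type. The same elements can then be viewed in a Veronese
  subalgebra, in its Poisson centre, or in the kernel of another derivation. The map \<open>K\<close> embeds the scalars.
\<close>

locale derivation_on =
  fixes K :: "'k::field_char_0 \<Rightarrow> 'm::idom" and M :: "'m set" and D :: "'m \<Rightarrow> 'm"
  assumes K_add: "K (a + b) = K a + K b"
    and K_mult: "K (a * b) = K a * K b"
    and K_one: "K 1 = 1"
    and K_closed: "K a \<in> M"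
    and add_closed: "\<lbrakk>x \<in> M; y \<in> M\<rbrakk> \<Longrightarrow> x + y \<in> M"
    and mult_closed: "\<lbrakk>x \<in> M; y \<in> M\<rbrakk> \<Longrightarrow> x * y \<in> M"
    and D_closed: "x \<in> M \<Longrightarrow> D x \<in> M"
    and D_add: "\<lbrakk>x \<in> M; y \<in> M\<rbrakk> \<Longrightarrow> D (x + y) = D x + D y"
    and D_mult: "\<lbrakk>x \<in> M; y \<in> M\<rbrakk> \<Longrightarrow> D (x * y) = D x * y + x * D y"
    and D_K: "D (K a) = 0"
begin

lemma K_zero: "K 0 = 0"
  using K_add[of 0 0] by (metis add_cancel_right_left)

lemma K_minus: "K (- a) = - K a"
  using K_add[of a "- a"] by (simp add: K_zero eq_neg_iff_add_eq_0 add.commute)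

lemma K_of_nat: "K (of_nat n) = of_nat n"
  by (induction n) (simp_all add: K_zero K_add K_one)

lemma K_eq_zero_iff: "K a = 0 \<longleftrightarrow> a = 0"
proof
  assume "K a = 0"
  then have "K (a * inverse a) = 0" by (simp add: K_mult)
  then show "a = 0" by (cases "a = 0") (simp_all add: K_one)
qed (simp add: K_zero)

lemma of_nat_eq_zero_iff: "(of_nat n :: 'm) = 0 \<longleftrightarrow> n = 0"
  by (metis K_of_nat K_eq_zero_iff of_nat_eq_0_iff)

lemma zero_closed: "0 \<in> M"
  using K_closed[of 0] by (simp add: K_zero)

lemma one_closed: "1 \<in> M"
  using K_closed[of 1] by (simp add: K_one)

lemma uminus_closed: "x \<in> M \<Longrightarrow> - x \<in> M"
  using mult_closed[OF K_closed[of "-1"], of x] by (simp add: K_minus K_one)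

lemma diff_closed: "\<lbrakk>x \<in> M; y \<in> M\<rbrakk> \<Longrightarrow> x - y \<in> M"
  using add_closed[of x "- y"] uminus_closed by simp

lemma power_closed: "x \<in> M \<Longrightarrow> x ^ n \<in> M"
  by (induction n) (auto intro: one_closed mult_closed)

lemma sum_closed: "(\<And>i. i \<in> I \<Longrightarrow> f i \<in> M) \<Longrightarrow> sum f I \<in> M"
  by (induction I rule: infinite_finite_induct) (auto intro: zero_closed add_closed)

lemma D_zero: "D 0 = 0"
  using D_K[of 0] by (simp add: K_zero)

lemma D_one: "D 1 = 0"
  using D_K[of 1] by (simp add: K_one)

lemma D_smult: "x \<in> M \<Longrightarrow> D (K a * x) = K a * D x"
  by (simp add: D_mult K_closed D_K)

lemma D_uminus: "x \<in> M \<Longrightarrow> D (- x) = - D x"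
  using D_smult[of x "-1"] by (simp add: K_minus K_one)

lemma D_diff: "\<lbrakk>x \<in> M; y \<in> M\<rbrakk> \<Longrightarrow> D (x - y) = D x - D y"
  using D_add[of x "- y"] by (simp add: uminus_closed D_uminus)

lemma D_sum: "(\<And>i. i \<in> I \<Longrightarrow> f i \<in> M) \<Longrightarrow> D (sum f I) = (\<Sum>i\<in>I. D (f i))"
  by (induction I rule: infinite_finite_induct) (simp_all add: D_zero D_add sum_closed)

lemma D_power: "x \<in> M \<Longrightarrow> D (x ^ n) = of_nat n * x ^ (n - 1) * D x"
proof (induction n)
  case (Suc n)
  then show ?case
    by (cases n) (simp_all add: D_mult power_closed mult_closed algebra_simps)
qed (simp add: D_one)

lemma funpow_closed: "x \<in> M \<Longrightarrow> (D ^^ n) x \<in> M"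
  by (induction n) (auto intro: D_closed)

lemma funpow_zero: "(D ^^ n) 0 = 0"
  by (induction n) (simp_all add: D_zero)

lemma funpow_zero_mono: "(D ^^ n) x = 0 \<Longrightarrow> n \<le> m \<Longrightarrow> (D ^^ m) x = 0"
  using funpow_zero by (metis add.commute funpow_add comp_apply le_iff_add)

lemma Leibniz:
  assumes "x \<in> M" "y \<in> M"
  shows "(D ^^ n) (x * y) = (\<Sum>i\<le>n. of_nat (n choose i) * (D ^^ i) x * (D ^^ (n - i)) y)"
proof (induction n)
  case (Suc n)
  let ?f = "\<lambda>i j. (D ^^ i) x * (D ^^ j) y"
  have "(D ^^ Suc n) (x * y) = (\<Sum>i\<le>n. D (of_nat (n choose i) * ?f i (n - i)))"
    using assms by (simp add: Suc.IH D_sum mult_closed funpow_closed K_closed mult.assoc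
        flip: K_of_nat)
  also have "\<dots> = (\<Sum>i\<le>n. of_nat (n choose i) * (?f (Suc i) (n - i) + ?f i (Suc n - i)))"
    using assms by (intro sum.cong refl)
      (simp add: D_smult D_mult mult_closed funpow_closed mult.assoc Suc_diff_le flip: K_of_nat)
  also have "\<dots> = (\<Sum>i\<le>n. of_nat (n choose i) * ?f (Suc i) (n - i)) +
      (\<Sum>i\<le>n. of_nat (n choose i) * ?f i (Suc n - i))"
    by (simp add: distrib_left sum.distrib)
  also have "(\<Sum>i\<le>n. of_nat (n choose i) * ?f i (Suc n - i)) =
      (\<Sum>i\<le>Suc n. of_nat (n choose i) * ?f i (Suc n - i))"
    by (simp add: binomial_eq_0)
  also have "\<dots> = ?f 0 (Suc n) + (\<Sum>i\<le>n. of_nat (n choose Suc i) * ?f (Suc i) (n - i))"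
    by (subst sum.atMost_Suc_shift) simp
  also have "(\<Sum>i\<le>n. of_nat (n choose i) * ?f (Suc i) (n - i)) + \<dots> =
     ?f 0 (Suc n) + (\<Sum>i\<le>n. of_nat (Suc n choose Suc i) * ?f (Suc i) (n - i))"
    by (simp add: sum.distrib algebra_simps)
  also have "\<dots> = (\<Sum>i\<le>Suc n. of_nat (Suc n choose i) * ?f i (Suc n - i))"
    by (subst sum.atMost_Suc_shift) simp
  finally show ?case by (simp add: mult.assoc)
qed simp

end

locale locally_nilpotent_derivation = derivation_on +
  assumes nilpotent: "x \<in> M \<Longrightarrow> \<exists>n. (D ^^ n) x = 0"
begin

lemma last_nonzero:
  assumes "x \<in> M" "x \<noteq> 0"
  obtains n where "(D ^^ n) x \<noteq> 0" "(D ^^ Suc n) x = 0"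
proof -
  define n where "n = (LEAST n. (D ^^ n) x = 0)"
  have n: "(D ^^ n) x = 0"
    unfolding n_def using nilpotent[OF assms(1)] by (rule LeastI_ex)
  then obtain m where m: "n = Suc m"
    using assms(2) by (cases n) auto
  have "(D ^^ m) x \<noteq> 0"
    using not_less_Least[of m "\<lambda>n. (D ^^ n) x = 0"] m by (simp flip: n_def)
  then show thesis using n that by (simp add: m)
qed

text \<open>
  In the Leibniz expansion only the term \<open>i = m\<close> survives, and its binomial coefficient is nonzero in characteristic
  zero. The nilpotency index thus behaves like a degree: it is additive on products.
\<close>

lemma last_nonzero_mult:
  assumes "x \<in> M" "y \<in> M" "(D ^^ m) x \<noteq> 0" "(D ^^ Suc m) x = 0"
    "(D ^^ n) y \<noteq> 0" "(D ^^ Suc n) y = 0"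
  shows "(D ^^ (m + n)) (x * y) \<noteq> 0"
proof -
  have "(\<Sum>i\<le>m+n. of_nat ((m+n) choose i) * (D ^^ i) x * (D ^^ (m + n - i)) y) =
    (\<Sum>i\<in>{m}. of_nat ((m+n) choose i) * (D ^^ i) x * (D ^^ (m + n - i)) y)"
  proof (intro sum.mono_neutral_right ballI)
    fix i assume "i \<in> {..m+n} - {m}"
    then have "i \<ge> Suc m \<or> m + n - i \<ge> Suc n" by auto
    then have "(D ^^ i) x = 0 \<or> (D ^^ (m + n - i)) y = 0"
      using assms(4,6) funpow_zero_mono by blast
    then show "of_nat ((m+n) choose i) * (D ^^ i) x * (D ^^ (m + n - i)) y = 0"
      by auto
  qed auto
  then show ?thesis
    using assms by (simp add: Leibniz of_nat_eq_zero_iff)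
qed

text \<open>
  A product of index zero can only have factors of index zero.
\<close>

lemma kernel_factorially_closed:
  assumes "x \<in> M" "y \<in> M" "D (x * y) = 0" "x * y \<noteq> 0"
  shows "D x = 0"
proof -
  obtain m where m: "(D ^^ m) x \<noteq> 0" "(D ^^ Suc m) x = 0"
    using last_nonzero assms by (metis mult_zero_left)
  obtain n where n: "(D ^^ n) y \<noteq> 0" "(D ^^ Suc n) y = 0"
    using last_nonzero assms by (metis mult_zero_right)
  have "m + n = 0"
    using last_nonzero_mult[OF assms(1,2) m n] funpow_zero_mono[of 1 "x * y" "m + n"] assms(3)
    by (cases "m + n") auto
  then show ?thesis using m by simp
qed

text \<open>
  \<open>D\<close> lowers the nilpotency index of \<open>x\<close> by one, whereas multiplication by \<open>g\<close> cannot lower it.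
\<close>

lemma derivative_multiple_imp_zero:
  assumes "x \<in> M" "g \<in> M" "D x = x * g"
  shows "D x = 0"
proof (rule ccontr)
  assume nz: "D x \<noteq> 0"
  then have "x \<noteq> 0" "g \<noteq> 0" using assms by auto
  obtain m where m: "(D ^^ m) x \<noteq> 0" "(D ^^ Suc m) x = 0"
    using last_nonzero assms \<open>x \<noteq> 0\<close> by metis
  obtain n where n: "(D ^^ n) g \<noteq> 0" "(D ^^ Suc n) g = 0"
    using last_nonzero assms \<open>g \<noteq> 0\<close> by metis
  have "(D ^^ Suc (m + n)) x = (D ^^ (m + n)) (x * g)"
    by (simp add: funpow_swap1 assms(3))
  then show False
    using last_nonzero_mult[OF assms(1,2) m n] funpow_zero_mono[OF m(2), of "Suc (m + n)"]
    by simp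
qed

text \<open>
  The sum is the truncated Dixmier map \<open>exp (- \<sigma> D)\<close>. Its derivative telescopes, so that the full sum is the
  projection onto the kernel of \<open>D\<close> that sends the slice \<open>\<sigma>\<close> to zero.
\<close>

lemma slice_projection_in_kernel:
  assumes "\<sigma> \<in> M" "D \<sigma> = 1" "w \<in> M"
  shows "D (\<Sum>j<Suc n. K ((- 1) ^ j / fact j) * (\<sigma> ^ j * (D ^^ j) w)) =
    K ((- 1) ^ n / fact n) * \<sigma> ^ n * (D ^^ Suc n) w"
proof (induction n)
  case 0
  then show ?case using assms by (simp add: D_smult K_one)
next
  case (Suc n)
  have "D (\<Sum>j<Suc (Suc n). K ((- 1) ^ j / fact j) * (\<sigma> ^ j * (D ^^ j) w)) =
     D (\<Sum>j<Suc n. K ((- 1) ^ j / fact j) * (\<sigma> ^ j * (D ^^ j) w)) +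
     D (K ((- 1) ^ Suc n / fact (Suc n)) * (\<sigma> ^ Suc n * (D ^^ Suc n) w))"
    by (subst sum.lessThan_Suc)
      (intro D_add sum_closed mult_closed K_closed power_closed funpow_closed assms)
  also have "D (\<Sum>j<Suc n. K ((- 1) ^ j / fact j) * (\<sigma> ^ j * (D ^^ j) w)) =
    K ((- 1) ^ n / fact n) * \<sigma> ^ n * (D ^^ Suc n) w"
    by (rule Suc.IH)
  also have "D (K ((- 1) ^ Suc n / fact (Suc n)) * (\<sigma> ^ Suc n * (D ^^ Suc n) w)) =
     K ((- 1) ^ Suc n / fact (Suc n)) * K (of_nat (Suc n)) * \<sigma> ^ n * (D ^^ Suc n) w +
     K ((- 1) ^ Suc n / fact (Suc n)) * \<sigma> ^ Suc n * (D ^^ Suc (Suc n)) w"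
    using assms
    by (simp only: D_smult D_mult mult_closed power_closed funpow_closed D_power K_of_nat)
      (simp add: algebra_simps)
  also have "K ((- 1) ^ Suc n / fact (Suc n)) * K (of_nat (Suc n)) = - K ((- 1) ^ n / fact n)"
    by (simp add: divide_simps flip: K_mult K_minus del: of_nat_Suc)
  finally show ?case by simp
qed

text \<open>
  A slice generates the algebra over the kernel: solving the Dixmier projection of \<open>w\<close> for \<open>w\<close> itself expresses
  \<open>w\<close> through an element of the kernel and through \<open>\<sigma>\<^sup>j D\<^sup>j w\<close> with \<open>j \<ge> 1\<close>, which have a
  smaller nilpotency index. An induction rule serves better than an expansion in powers of \<open>\<sigma>\<close>, because the
  properties of interest are all closed under sums and under multiplication by \<open>\<sigma>\<close>.
\<close>

lemma slice_induct:
  assumes \<sigma>: "\<sigma> \<in> M" "D \<sigma> = 1"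
    and ker: "\<And>x. \<lbrakk>x \<in> M; D x = 0\<rbrakk> \<Longrightarrow> Q x"
    and add: "\<And>x y. \<lbrakk>x \<in> M; y \<in> M; Q x; Q y\<rbrakk> \<Longrightarrow> Q (x + y)"
    and slice: "\<And>c x. \<lbrakk>x \<in> M; Q x\<rbrakk> \<Longrightarrow> Q (K c * (\<sigma> * x))"
    and w: "w \<in> M"
  shows "Q w"
proof -
  have smult: "Q (K c * (\<sigma> ^ j * x))" if "x \<in> M" "Q x" "j > 0" for c j x
    using \<open>j > 0\<close>
  proof (induction j arbitrary: c)
    case (Suc j)
    show ?case
    proof (cases "j = 0")
      case True
      then show ?thesis using slice[OF that(1,2)] by simp
    next
      case False
      then have "Q (K 1 * (\<sigma> ^ j * x))" using Suc.IH by blast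
      then show ?thesis using slice[of "\<sigma> ^ j * x" c] \<sigma> that
        by (simp add: K_one mult_closed power_closed mult.assoc)
    qed
  qed auto
  have Qsum: "Q (sum f I)" if "finite I" "\<And>i. i \<in> I \<Longrightarrow> f i \<in> M \<and> Q (f i)" for f and I :: "nat set"
    using that
  proof (induction I rule: finite_induct)
    case empty
    then show ?case using ker[OF zero_closed D_zero] by simp
  next
    case (insert i I)
    then show ?case using add[of "f i" "sum f I"] by (auto intro: sum_closed)
  qed
  show ?thesis
  proof -
    have "\<forall>w\<in>M. (D ^^ n) w = 0 \<longrightarrow> Q w" for n
    proof (induction n)
      case 0
      then show ?case using ker[OF zero_closed D_zero] by simp
    next
      case (Suc n)
      show ?case
      proof (intro ballI impI)
        fix w assume w: "w \<in> M" "(D ^^ Suc n) w = 0"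
        let ?g = "\<lambda>j. K ((- 1) ^ j / fact j) * (\<sigma> ^ j * (D ^^ j) w)"
        let ?h = "\<lambda>j. K (- ((- 1) ^ j / fact j)) * (\<sigma> ^ j * (D ^^ j) w)"
        have gM: "?g j \<in> M" "?h j \<in> M" for j
          by (intro mult_closed K_closed power_closed funpow_closed \<sigma> w)+
        have "D (\<Sum>j<Suc n. ?g j) = 0"
          using slice_projection_in_kernel[OF \<sigma> w(1), of n] w(2) by simp
        then have a: "Q (\<Sum>j<Suc n. ?g j)" "(\<Sum>j<Suc n. ?g j) \<in> M"
          using ker[OF sum_closed[of "{..<Suc n}" ?g]] sum_closed[of "{..<Suc n}" ?g] gM by blast+
        have "Q (?h j) \<and> ?h j \<in> M" if "j \<in> {1..<Suc n}" for j
        proof -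
          have "(D ^^ n) ((D ^^ j) w) = (D ^^ (n + j)) w"
            by (simp add: funpow_add)
          also have "\<dots> = 0" using that by (intro funpow_zero_mono[OF w(2)]) auto
          finally have "Q ((D ^^ j) w)" using Suc.IH w funpow_closed by blast
          then show ?thesis using smult[of "(D ^^ j) w" j] that w gM by (auto simp: funpow_closed)
        qed
        then have b: "Q (\<Sum>j\<in>{1..<Suc n}. ?h j)" "(\<Sum>j\<in>{1..<Suc n}. ?h j) \<in> M"
          using sum_closed[of "{1..<Suc n}" ?h] Qsum[of "{1..<Suc n}" ?h] gM by blast+
        have "w = (\<Sum>j<Suc n. ?g j) + (\<Sum>j\<in>{1..<Suc n}. ?h j)"
        proof -
          have "(\<Sum>j<Suc n. ?g j) = ?g 0 + (\<Sum>j\<in>{1..<Suc n}. ?g j)"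
            by (subst lessThan_atLeast0, subst sum.atLeast_Suc_lessThan) (auto simp: K_one)
          moreover have "(\<Sum>j\<in>{1..<Suc n}. ?h j) = - (\<Sum>j\<in>{1..<Suc n}. ?g j)"
            by (simp add: K_minus sum_negf)
          ultimately show ?thesis by (simp add: K_one)
        qed
        then show "Q w" using add[OF a(2) b(2) a(1) b(1)] by simp
      qed
    qed
    then show ?thesis using w nilpotent by blast
  qed
qed

end

lemma (in locally_nilpotent_derivation) restrict:
  assumes "W \<subseteq> M" "\<And>a. K a \<in> W" "\<And>x y. \<lbrakk>x \<in> W; y \<in> W\<rbrakk> \<Longrightarrow> x + y \<in> W"
    "\<And>x y. \<lbrakk>x \<in> W; y \<in> W\<rbrakk> \<Longrightarrow> x * y \<in> W" "\<And>x. x \<in> W \<Longrightarrow> D x \<in> W"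
  shows "locally_nilpotent_derivation K W D"
  using assms
  by unfold_locales (auto simp: K_add K_mult K_one D_K subset_eq intro: D_add D_mult nilpotent)

text \<open>
  Integration with respect to the slice. An antiderivative of \<open>\<sigma>\<^sup>j w\<close> is needed for all \<open>j\<close> at once, because
  the step of \<open>slice_induct\<close> from \<open>x\<close> to \<open>\<sigma> x\<close> raises the exponent.
\<close>

lemma (in locally_nilpotent_derivation) surjective_if_slice:
  assumes \<sigma>: "\<sigma> \<in> M" "D \<sigma> = 1" and "w \<in> M"
  shows "\<exists>y\<in>M. D y = w"
proof -
  have "\<forall>j. \<exists>y\<in>M. D y = \<sigma> ^ j * w"
    using \<sigma> _ _ _ \<open>w \<in> M\<close>
  proof (rule slice_induct)
    fix x assume x: "x \<in> M" "D x = 0"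
    show "\<forall>j. \<exists>y\<in>M. D y = \<sigma> ^ j * x"
    proof
      fix j
      have "D (K (1 / of_nat (Suc j)) * (\<sigma> ^ Suc j * x)) = K (1 / of_nat (Suc j)) * K (of_nat (Suc j)) * \<sigma> ^ j * x"
        using \<sigma> x by (simp only: D_smult D_mult D_power power_closed mult_closed K_of_nat) simp
      also have "\<dots> = \<sigma> ^ j * x"
        by (simp add: K_one del: of_nat_Suc flip: K_mult)
      finally show "\<exists>y\<in>M. D y = \<sigma> ^ j * x"
        using \<sigma> x by (blast intro: K_closed power_closed mult_closed)
    qed
  next
    fix x y assume "\<forall>j. \<exists>z\<in>M. D z = \<sigma> ^ j * x" "\<forall>j. \<exists>z\<in>M. D z = \<sigma> ^ j * y"
    then show "\<forall>j. \<exists>z\<in>M. D z = \<sigma> ^ j * (x + y)"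
      by (metis D_add add_closed distrib_left)
  next
    fix c x assume *: "\<forall>j. \<exists>z\<in>M. D z = \<sigma> ^ j * x"
    show "\<forall>j. \<exists>z\<in>M. D z = \<sigma> ^ j * (K c * (\<sigma> * x))"
    proof
      fix j
      obtain z where "z \<in> M" "D z = \<sigma> ^ Suc j * x" using * by blast
      then have "D (K c * z) = K c * (\<sigma> ^ Suc j * x)" "K c * z \<in> M"
        by (simp_all add: D_smult mult_closed K_closed)
      moreover have "K c * (\<sigma> ^ Suc j * x) = \<sigma> ^ j * (K c * (\<sigma> * x))"
        by (simp only: power_Suc mult_ac)
      ultimately show "\<exists>z\<in>M. D z = \<sigma> ^ j * (K c * (\<sigma> * x))" by metis
    qed
  qed
  from this[rule_format, of 0] show ?thesis by simp
qed

section \<open>Polynomials: grading and partial derivatives\<close>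

abbreviation const :: "'k \<Rightarrow> ('v, 'k::field) mpoly"
  where "const \<equiv> single 0"

definition tdeg :: "('v::finite \<Rightarrow>\<^sub>0 nat) \<Rightarrow> nat"
  where "tdeg e = (\<Sum>i\<in>UNIV. lookup e i)"

lemma tdeg_zero: "tdeg 0 = 0"
  by (simp add: tdeg_def)

lemma tdeg_add: "tdeg (e + e') = tdeg e + tdeg e'"
  by (simp add: tdeg_def lookup_add sum.distrib)

lemma tdeg_eq_zero_iff: "tdeg e = 0 \<longleftrightarrow> e = 0"
proof
  assume "tdeg e = 0"
  then show "e = 0" by (intro poly_mapping_eqI) (simp add: tdeg_def)
qed (simp add: tdeg_zero)

lemma tdeg_single: "tdeg (single i n) = n"
  by (simp add: tdeg_def lookup_single when_def)

lemma exponent_eq_add_single: "lookup e i > 0 \<Longrightarrow> e = (e - single i 1) + single i (1::nat)"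
  by (rule poly_mapping_eqI) (auto simp: lookup_add lookup_minus lookup_single when_def)

lemma tdeg_minus_single: "lookup e i > 0 \<Longrightarrow> tdeg e = Suc (tdeg (e - single i 1))"
  by (metis exponent_eq_add_single Suc_eq_plus1 tdeg_add tdeg_single)

lemma nonzero_exponent:
  assumes "(e :: 'v \<Rightarrow>\<^sub>0 nat) \<noteq> 0"
  obtains i where "lookup e i > 0"
  using assms poly_mapping_eqI[of e 0] by auto

lemma homogeneous_iff: "p \<in> homogeneous m \<longleftrightarrow> (\<forall>e\<in>keys p. tdeg e = m)"
  by (simp add: homogeneous_def tdeg_def)

lemma sum_single_lookup: "p = (\<Sum>e\<in>keys p. single e (lookup p e))"
  by (rule poly_mapping_eqI) (simp add: lookup_sum lookup_single when_def in_keys_iff)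

lemma mpoly_additive_induct:
  assumes "\<And>e c. Q (single e c)" "\<And>p q. Q p \<Longrightarrow> Q q \<Longrightarrow> Q (p + q)"
  shows "Q (p :: 'a::zero \<Rightarrow>\<^sub>0 'b::comm_monoid_add)"
proof -
  have "Q (\<Sum>e\<in>I. single e (f e))" if "finite I" for I and f :: "'a \<Rightarrow> 'b"
    using that
  proof (induction I rule: finite_induct)
    case empty
    then show ?case using assms(1)[of 0 0] by simp
  qed (auto intro: assms)
  from this[of "keys p" "lookup p"] show ?thesis
    by (simp flip: sum_single_lookup)
qed

lemma mpoly_induct [case_names const mult_indet add]:
  fixes p :: "('v::finite, 'k::field) mpoly"
  assumes "\<And>c. Q (const c)" "\<And>p i. Q p \<Longrightarrow> Q (p * indet i)" "\<And>p q. Q p \<Longrightarrow> Q q \<Longrightarrow> Q (p + q)"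
  shows "Q p"
proof (induction p rule: mpoly_additive_induct)
  case (1 e c)
  show ?case
  proof (induction "tdeg e" arbitrary: e)
    case 0
    then have "e = 0" by (simp add: tdeg_eq_zero_iff)
    then show ?case using assms(1) by simp
  next
    case (Suc n)
    then have "e \<noteq> 0" by (auto simp: tdeg_zero)
    then obtain i where i: "lookup e i > 0"
      by (rule nonzero_exponent)
    then have "n = tdeg (e - single i 1)"
      using Suc.hyps(2) tdeg_minus_single by (metis Suc_inject)
    then have "Q (single (e - single i 1) c * indet i)"
      by (intro assms(2) Suc.hyps(1))
    then show ?case
      by (subst exponent_eq_add_single[OF i]) (simp add: indet_def mult_single)
  qed
qed (rule assms(3))

lemma const_mult_single: "const c * single e a = single e (c * a)"
  by (simp add: mult_single)

lemma lookup_const_mult: "lookup (const c * p) e = c * lookup p e"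
  by (induction p rule: mpoly_additive_induct)
    (simp_all add: const_mult_single lookup_single when_def distrib_left lookup_add)

lemma const_add: "const (a + b) = const a + const b"
  by (rule single_add)

lemma const_mult: "const (a * b) = const a * const b"
  by (simp add: mult_single)

lemma lookup_mult_zero:
  "lookup (p * q) 0 = lookup p 0 * lookup (q :: ('v::finite, 'k::field) mpoly) 0"
proof (induction p rule: mpoly_additive_induct)
  case (1 e c)
  show ?case
  proof (induction q rule: mpoly_additive_induct)
    case (1 e' c')
    have "e + e' = 0 \<longleftrightarrow> e = 0 \<and> e' = 0"
      by (metis tdeg_add tdeg_eq_zero_iff add_eq_0_iff_both_eq_0)
    then show ?case by (auto simp: mult_single lookup_single when_def)
  qed (simp add: distrib_left lookup_add)
qed (simp add: distrib_right lookup_add)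

definition linear_extension :: "(('v \<Rightarrow>\<^sub>0 nat) \<Rightarrow> ('v, 'k) mpoly) \<Rightarrow> ('v, 'k) mpoly \<Rightarrow> ('v, 'k::field) mpoly"
  where "linear_extension \<phi> p = (\<Sum>e\<in>keys p. const (lookup p e) * \<phi> e)"

lemma linear_extension_superset:
  assumes "finite S" "keys p \<subseteq> S"
  shows "linear_extension \<phi> p = (\<Sum>e\<in>S. const (lookup p e) * \<phi> e)"
  unfolding linear_extension_def using assms
  by (intro sum.mono_neutral_left) (auto simp: in_keys_iff)

lemma linear_extension_single: "linear_extension \<phi> (single e c) = const c * \<phi> e"
  by (simp add: linear_extension_def)

lemma linear_extension_add:
  "linear_extension \<phi> (p + q) = linear_extension \<phi> p + linear_extension \<phi> q"
proof -
  have "finite (keys p \<union> keys q)" by simp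
  from linear_extension_superset[OF this, of _ \<phi>] show ?thesis
    using keys_add[of p q] by (simp add: lookup_add const_add distrib_right sum.distrib)
qed

definition hpart :: "nat \<Rightarrow> ('v::finite, 'k::field) mpoly \<Rightarrow> ('v, 'k) mpoly"
  where "hpart m = linear_extension (\<lambda>e. if tdeg e = m then single e 1 else 0)"

lemma hpart_add: "hpart m (p + q) = hpart m p + hpart m q"
  by (simp add: hpart_def linear_extension_add)

lemma hpart_single: "hpart m (single e c) = (if tdeg e = m then single e c else 0)"
  by (simp add: hpart_def linear_extension_single const_mult_single)

lemma lookup_hpart: "lookup (hpart m p) e = (if tdeg e = m then lookup p e else 0)"
  by (induction p rule: mpoly_additive_induct)
    (auto simp: hpart_single hpart_add lookup_add lookup_single when_def)

lemma hpart_homogeneous: "hpart m p \<in> homogeneous m"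
  by (auto simp: homogeneous_iff in_keys_iff lookup_hpart split: if_splits)

lemma hpart_of_homogeneous: "p \<in> homogeneous n \<Longrightarrow> hpart m p = (if m = n then p else 0)"
  by (rule poly_mapping_eqI) (auto simp: lookup_hpart homogeneous_iff in_keys_iff)

lemma hpart_zero [simp]: "hpart m 0 = 0"
  by (rule poly_mapping_eqI) (simp add: lookup_hpart)

lemma hpart_sum: "hpart m (sum f I) = (\<Sum>i\<in>I. hpart m (f i))"
  by (induction I rule: infinite_finite_induct) (simp_all add: hpart_add)

lemma sum_hpart:
  assumes "\<forall>e\<in>keys p. tdeg e \<le> N"
  shows "p = (\<Sum>m\<le>N. hpart m p)"
  using assms by (intro poly_mapping_eqI) (auto simp: lookup_sum lookup_hpart in_keys_iff)

lemma tdeg_bound: obtains N where "\<forall>e\<in>keys p. tdeg e \<le> N"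
  using finite_nat_set_iff_bounded_le[of "tdeg ` keys p"] by auto

lemma homogeneous_zero [simp]: "0 \<in> homogeneous m"
  by (simp add: homogeneous_iff)

lemma homogeneous_add: "p \<in> homogeneous m \<Longrightarrow> q \<in> homogeneous m \<Longrightarrow> p + q \<in> homogeneous m"
  using keys_add[of p q] by (auto simp: homogeneous_iff)

lemma homogeneous_sum: "(\<And>i. i \<in> I \<Longrightarrow> f i \<in> homogeneous m) \<Longrightarrow> sum f I \<in> homogeneous m"
  by (induction I rule: infinite_finite_induct) (auto intro: homogeneous_add)

lemma homogeneous_mult:
  "p \<in> homogeneous m \<Longrightarrow> q \<in> homogeneous n \<Longrightarrow> p * q \<in> homogeneous (m + n)"
  using keys_mult[of p q] by (fastforce simp: homogeneous_iff tdeg_add)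

lemma homogeneous_const: "const c \<in> homogeneous 0"
  by (simp add: homogeneous_iff tdeg_zero)

lemma homogeneous_single: "single e c \<in> homogeneous (tdeg e)"
  by (simp add: homogeneous_iff)

lemma homogeneous_indet: "indet i \<in> homogeneous 1"
  by (simp add: homogeneous_iff indet_def tdeg_single)

lemma homogeneous_power: "p \<in> homogeneous m \<Longrightarrow> p ^ n \<in> homogeneous (n * m)"
  using homogeneous_const[of 1] by (induction n) (auto intro: homogeneous_mult)

lemma homogeneous_zeroD:
  assumes "p \<in> homogeneous 0" shows "p = const (lookup p 0)"
  using assms by (intro poly_mapping_eqI)
    (auto simp: homogeneous_iff lookup_single when_def in_keys_iff tdeg_eq_zero_iff)

lemma hpart_zero_eq: "hpart 0 p = const (lookup p 0)"
  using homogeneous_zeroD[OF hpart_homogeneous, of p] by (simp add: lookup_hpart tdeg_zero)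

lemma hpart_mult_homogeneous:
  assumes "Q \<in> homogeneous m"
  shows "hpart n (Q * h) = (if n < m then 0 else Q * hpart (n - m) h)"
proof (induction h rule: mpoly_additive_induct)
  case (1 e c)
  show ?case
    using hpart_of_homogeneous[OF homogeneous_mult[OF assms homogeneous_single[of e c]], of n]
    by (auto simp: hpart_single)
qed (auto simp: distrib_left hpart_add)

lemma hpart_diff: "hpart m (p - q) = hpart m p - hpart m q"
  by (metis add_diff_cancel diff_add_cancel hpart_add)

definition pd :: "'v \<Rightarrow> ('v::finite, 'k::field) mpoly \<Rightarrow> ('v, 'k) mpoly"
  where "pd i = linear_extension (\<lambda>e. single (e - single i 1) (of_nat (lookup e i)))"

lemma pd_add: "pd i (p + q) = pd i p + pd i q"
  by (simp add: pd_def linear_extension_add)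

lemma pd_single: "pd i (single e c) = single (e - single i 1) (c * of_nat (lookup e i))"
  by (simp add: pd_def linear_extension_single const_mult_single)

lemma pd_const [simp]: "pd i (const c) = 0"
  by (simp add: pd_single)

lemma pd_zero [simp]: "pd i 0 = 0"
  using pd_const[of i 0] by (simp del: pd_const)

lemma pd_one [simp]: "pd i 1 = 0"
  using pd_const[of i 1] by (simp del: pd_const)

lemma pd_sum: "pd i (sum f I) = (\<Sum>j\<in>I. pd i (f j))"
  by (induction I rule: infinite_finite_induct) (simp_all add: pd_add)

lemma pd_indet: "pd i (indet j) = (if i = j then 1 else 0)"
  by (auto simp: indet_def pd_single lookup_single when_def)

lemma pd_single_mult_single:
  fixes e e' :: "'v::finite \<Rightarrow>\<^sub>0 nat" and c c' :: "'k::field"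
  shows "pd i (single e c * single e' c') =
   pd i (single e c) * single e' c' + single e c * pd i (single e' c')"
proof -
  have 1: "e + e' - single i 1 = (e - single i 1) + e'" if "lookup e i > 0" for e e' :: "'v \<Rightarrow>\<^sub>0 nat"
    using that
    by (intro poly_mapping_eqI) (auto simp: lookup_add lookup_minus lookup_single when_def)
  have 2: "single (e + e' - single i 1) (c * c' * of_nat (lookup e i)) =
    pd i (single e c) * single e' c'"
    using 1[of e e'] by (cases "lookup e i = 0") (simp_all add: pd_single mult_single mult_ac add.commute)
  have 3: "single (e + e' - single i 1) (c * c' * of_nat (lookup e' i)) =
    single e c * pd i (single e' c')"
    using 1[of e' e] by (cases "lookup e' i = 0") (simp_all add: pd_single mult_single mult_ac add.commute)
  show ?thesis
    by (simp only: mult_single pd_single[of i "e + e'"] lookup_add of_nat_add distrib_left single_add 2 3)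
qed

lemma pd_mult: "pd i (p * q) = pd i p * q + p * pd i q"
proof (induction p rule: mpoly_additive_induct)
  case (1 e c)
  show ?case
    by (induction q rule: mpoly_additive_induct)
      (simp_all add: pd_single_mult_single pd_add distrib_left algebra_simps)
qed (simp add: distrib_right pd_add algebra_simps)

lemma lookup_pd: "lookup (pd i p) e = of_nat (lookup e i + 1) * lookup p (e + single i 1)"
proof (induction p rule: mpoly_additive_induct)
  case (1 e' c)
  show ?case
  proof (cases "lookup e' i = 0")
    case True
    then have "e' \<noteq> e + single i 1" by (auto simp: lookup_add)
    then show ?thesis using True by (simp add: pd_single lookup_single when_def)
  next
    case False
    then have "e' - single i 1 = e \<longleftrightarrow> e' = e + single i 1"
      using exponent_eq_add_single[of e' i] by (metis add_diff_cancel_right' neq0_conv)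
    then show ?thesis using False by (auto simp: pd_single lookup_single when_def lookup_add)
  qed
qed (simp add: pd_add lookup_add distrib_left)

lemma pd_homogeneous: "p \<in> homogeneous m \<Longrightarrow> pd i p \<in> homogeneous (m - 1)"
  unfolding homogeneous_iff
proof
  fix e assume "\<forall>e\<in>keys p. tdeg e = m" "e \<in> keys (pd i p)"
  then have "tdeg (e + single i 1) = m"
    by (auto simp: in_keys_iff lookup_pd)
  then show "tdeg e = m - 1" by (simp add: tdeg_add tdeg_single)
qed

lemma pd_eq_zero_imp_const:
  fixes p :: "('v::finite, 'k::field_char_0) mpoly"
  assumes "\<And>i. pd i p = 0"
  shows "p = const (lookup p 0)"
proof (rule poly_mapping_eqI)
  fix e
  show "lookup p e = lookup (const (lookup p 0)) e"
  proof (cases "e = 0")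
    case False
    then obtain i where "lookup e i > 0"
      by (rule nonzero_exponent)
    then have "lookup p e = 0"
      using lookup_pd[of i p "e - single i 1"] assms[of i]
        exponent_eq_add_single[of e i] by (metis Suc_eq_plus1 lookup_zero mult_eq_0_iff of_nat_neq_0)
    then show ?thesis using False by (simp add: lookup_single when_def)
  qed simp
qed

lemma derivation_chain_rule:
  fixes \<Delta> :: "('v::finite, 'k::field) mpoly \<Rightarrow> ('v, 'k) mpoly"
  assumes "\<And>p q. \<Delta> (p + q) = \<Delta> p + \<Delta> q" "\<And>p q. \<Delta> (p * q) = \<Delta> p * q + p * \<Delta> q"
    "\<And>c. \<Delta> (const c) = 0"
  shows "\<Delta> p = (\<Sum>i\<in>UNIV. pd i p * \<Delta> (indet i))"
proof (induction p rule: mpoly_induct)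
  case (const c)
  then show ?case by (simp add: assms)
next
  case (mult_indet p j)
  have "pd i (p * indet j) * \<Delta> (indet i) =
      pd i p * \<Delta> (indet i) * indet j + (if i = j then p * \<Delta> (indet i) else 0)" for i
    by (simp add: pd_mult pd_indet algebra_simps)
  then have "(\<Sum>i\<in>UNIV. pd i (p * indet j) * \<Delta> (indet i)) =
    (\<Sum>i\<in>UNIV. pd i p * \<Delta> (indet i)) * indet j + p * \<Delta> (indet j)"
    by (simp add: sum.distrib sum_distrib_right)
  then show ?case by (simp add: assms mult_indet)
next
  case (add p q)
  then show ?case by (simp add: assms pd_add distrib_right sum.distrib)
qed

lemma Euler_homogeneous:
  assumes "p \<in> homogeneous m"
  shows "(\<Sum>i\<in>UNIV. indet i * pd i p) = of_nat m * p"
proof -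
  have *: "(\<Sum>i\<in>UNIV. indet i * pd i (single e c)) = of_nat (tdeg e) * single e c" for e and c :: 'b
  proof -
    have "indet i * pd i (single e c) = const (of_nat (lookup e i)) * single e c" for i
    proof (cases "lookup e i = 0")
      case False
      then have "single i 1 + (e - single i 1) = e"
        using exponent_eq_add_single[of e i] by (simp add: add.commute)
      then show ?thesis
        by (simp only: indet_def pd_single mult_single add_0 add_0_right mult_1 mult.commute)
    qed (simp add: pd_single)
    then show ?thesis
      by (simp add: tdeg_def flip: sum_distrib_right)
  qed
  have "(\<Sum>i\<in>UNIV. indet i * pd i p) = (\<Sum>e\<in>keys p. of_nat (tdeg e) * single e (lookup p e))"
  proof -
    have "(\<Sum>i\<in>UNIV. indet i * pd i p) =
        (\<Sum>i\<in>UNIV. \<Sum>e\<in>keys p. indet i * pd i (single e (lookup p e)))"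
      by (intro sum.cong refl, subst sum_single_lookup[of p]) (simp add: pd_sum sum_distrib_left)
    also have "\<dots> = (\<Sum>e\<in>keys p. \<Sum>i\<in>UNIV. indet i * pd i (single e (lookup p e)))"
      by (rule sum.swap)
    finally show ?thesis by (simp only: *)
  qed
  also have "\<dots> = (\<Sum>e\<in>keys p. of_nat m * single e (lookup p e))"
    using assms by (intro sum.cong) (auto simp: homogeneous_iff)
  also have "\<dots> = of_nat m * p"
    by (simp flip: sum_distrib_left sum_single_lookup)
  finally show ?thesis .
qed

lemma degree_lowering_nilpotent:
  fixes T :: "('v::finite, 'k::field) mpoly \<Rightarrow> ('v, 'k) mpoly"
  assumes add: "\<And>p q. T (p + q) = T p + T q"
    and low: "\<And>p m. p \<in> homogeneous m \<Longrightarrow> T p \<in> homogeneous (m - 1)"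
    and const: "\<And>c. T (const c) = 0"
  shows "\<exists>n. (T ^^ n) p = 0"
proof -
  have z: "(T ^^ n) 0 = 0" for n
    using const[of 0] by (induction n) auto
  have h: "(T ^^ Suc m) p = 0" if "p \<in> homogeneous m" for m p
    using that
  proof (induction m arbitrary: p)
    case 0
    then show ?case using const homogeneous_zeroD[of p] by simp metis
  next
    case (Suc m)
    then show ?case using low[of p "Suc m"] by (simp add: funpow_swap1)
  qed
  have m: "(T ^^ n) p = 0" if "(T ^^ k) p = 0" "k \<le> n" for n k p
    using that z by (metis add.commute comp_apply funpow_add le_iff_add)
  have a: "(T ^^ n) (p + q) = (T ^^ n) p + (T ^^ n) q" for n p q
    by (induction n) (simp_all add: add)
  have s: "(T ^^ n) (sum f I) = (\<Sum>i\<in>I. (T ^^ n) (f i))" for n f and I :: "nat set"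
    by (induction I rule: infinite_finite_induct) (simp_all add: a z)
  obtain N where N: "\<forall>e\<in>keys p. tdeg e \<le> N" by (rule tdeg_bound)
  have "(T ^^ Suc N) p = (\<Sum>m\<le>N. (T ^^ Suc N) (hpart m p))"
    by (subst sum_hpart[OF N]) (rule s)
  also have "\<dots> = 0"
    by (intro sum.neutral ballI m[OF h[OF hpart_homogeneous]]) auto
  finally show ?thesis by blast
qed

lemma pd_locally_nilpotent:
  "locally_nilpotent_derivation const UNIV
     (pd i :: ('v::{finite,linorder}, 'k::field_char_0) mpoly \<Rightarrow> ('v, 'k) mpoly)"
  by unfold_locales
    (auto simp: const_add const_mult pd_add pd_mult
      intro!: degree_lowering_nilpotent pd_homogeneous)

text \<open>
  The unit element lies in the kernel of every partial derivative, and these kernels are factorially closed.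
\<close>

lemma mpoly_unit_const:
  fixes p q :: "('v::{finite,linorder}, 'k::field_char_0) mpoly"
  assumes "p * q = 1"
  obtains c where "p = const c" "c \<noteq> 0"
proof -
  have "pd i p = 0" for i
    using locally_nilpotent_derivation.kernel_factorially_closed[OF pd_locally_nilpotent, of p q i]
      assms by simp
  then have "p = const (lookup p 0)" by (rule pd_eq_zero_imp_const)
  moreover have "p \<noteq> 0" using assms by auto
  ultimately show thesis using that[of "lookup p 0"] by (metis single_zero)
qed

text \<open>
  The hypothesis says that the gradient of \<open>P / Q\<close> vanishes. Consequently a relation \<open>Q P' = P Q'\<close> may be
  differentiated inside \<open>P'\<close> and \<open>Q'\<close>. Starting from \<open>P' = P\<close> and \<open>Q' = Q\<close>, one arrives at a nonzero
  constant \<open>Q'\<close>, and \<open>P'\<close> is then a constant too.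
\<close>

lemma proportional_if_Wronskian_zero:
  fixes P Q :: "('v::{finite,linorder}, 'k::field_char_0) mpoly"
  assumes W: "\<And>i. Q * pd i P = P * pd i Q" and Q: "Q \<in> homogeneous m" and P: "P \<in> homogeneous m"
    and "Q \<noteq> 0"
  shows "\<exists>c. P = const c * Q"
proof -
  have "\<exists>c. P = const c * Q"
    if "P' \<in> homogeneous n" "Q' \<in> homogeneous n" "Q * P' = P * Q'" "Q' \<noteq> 0" for n P' Q'
    using that
  proof (induction n arbitrary: P' Q')
    case 0
    then obtain a b where ab: "P' = const a" "Q' = const b" "b \<noteq> 0"
      by (metis homogeneous_zeroD single_zero)
    have "P = const (inverse b * b) * P" using ab by simp
    also have "\<dots> = const (inverse b) * (P * Q')"
      using ab by (simp only: const_mult mult_ac)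
    also have "\<dots> = const (inverse b) * (Q * P')"
      by (simp only: 0)
    also have "\<dots> = const (inverse b * a) * Q"
      using ab by (simp only: const_mult mult_ac)
    finally show ?case by blast
  next
    case (Suc n)
    have "\<exists>i. pd i Q' \<noteq> 0"
    proof (rule ccontr)
      assume "\<not> ?thesis"
      then have "of_nat (Suc n) * Q' = 0" using Euler_homogeneous[OF Suc.prems(2)] by simp
      then show False using Suc.prems(4) by (metis mult_eq_0_iff of_nat_neq_0)
    qed
    then obtain i where i: "pd i Q' \<noteq> 0" by blast
    have "Q * (pd i Q * P' + Q * pd i P') = Q * (pd i P * Q' + P * pd i Q')"
      using Suc.prems(3) pd_mult[of i Q P'] pd_mult[of i P Q'] by simp
    moreover have "Q * (pd i Q * P') = P * pd i Q * Q'"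
      using Suc.prems(3) by (simp add: mult_ac)
    moreover have "Q * (pd i P * Q') = P * pd i Q * Q'"
      using W[of i] by (simp flip: mult.assoc)
    ultimately have "Q * (Q * pd i P') = Q * (P * pd i Q')"
      by (simp add: distrib_left)
    then have "Q * pd i P' = P * pd i Q'" using \<open>Q \<noteq> 0\<close> by simp
    then show ?case using Suc.IH[of "pd i P'" "pd i Q'"] i Suc.prems(1,2) pd_homogeneous
      by (metis diff_Suc_1)
  qed
  from this[OF P Q _ \<open>Q \<noteq> 0\<close>] show ?thesis by (simp add: mult.commute)
qed

section \<open>Veronese subalgebras and derivations at the origin\<close>

definition veronese_set :: "nat \<Rightarrow> ('v::finite, 'k::field) mpoly set"
  where "veronese_set d = {p. \<forall>e\<in>keys p. d dvd tdeg e}"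

lemma veronese_set_const: "const c \<in> veronese_set d"
  by (simp add: veronese_set_def tdeg_zero)

lemma veronese_set_add: "p \<in> veronese_set d \<Longrightarrow> q \<in> veronese_set d \<Longrightarrow> p + q \<in> veronese_set d"
  using keys_add[of p q] by (auto simp: veronese_set_def)

lemma veronese_set_mult: "p \<in> veronese_set d \<Longrightarrow> q \<in> veronese_set d \<Longrightarrow> p * q \<in> veronese_set d"
  using keys_mult[of p q] by (fastforce simp: veronese_set_def tdeg_add)

lemma veronese_set_single: "single e c \<in> veronese_set d \<longleftrightarrow> d dvd tdeg e \<or> c = 0"
  by (auto simp: veronese_set_def)

lemma veronese_set_1: "veronese_set 1 = UNIV"
  by (auto simp: veronese_set_def)

lemma veronese_set_sum: "(\<And>i. i \<in> I \<Longrightarrow> f i \<in> veronese_set d) \<Longrightarrow> sum f I \<in> veronese_set d"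
  using veronese_set_const[of 0 d]
  by (induction I rule: infinite_finite_induct) (auto intro: veronese_set_add)

lemma veronese_set_homogeneous: "p \<in> homogeneous m \<Longrightarrow> d dvd m \<Longrightarrow> p \<in> veronese_set d"
  by (auto simp: veronese_set_def homogeneous_iff)

lemma veronese_set_hpart: "p \<in> veronese_set d \<Longrightarrow> hpart m p \<in> veronese_set d"
  by (auto simp: veronese_set_def in_keys_iff lookup_hpart split: if_splits)

lemma veronese_set_hpart_zero: "p \<in> veronese_set d \<Longrightarrow> \<not> d dvd m \<Longrightarrow> hpart m p = 0"
  by (rule poly_mapping_eqI) (auto simp: veronese_set_def in_keys_iff lookup_hpart)

lemma lookup_single_mult:
  assumes "tdeg e' = tdeg e"
  shows "lookup (single e' 1 * h :: ('v::finite, 'k::field) mpoly) e = (if e = e' then lookup h 0 else 0)"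
proof (induction h rule: mpoly_additive_induct)
  case (1 e'' c)
  have "e' + e'' = e \<longleftrightarrow> e = e' \<and> e'' = 0"
    using assms by (metis add.right_neutral add_left_cancel tdeg_add tdeg_eq_zero_iff)
  then show ?case by (simp add: mult_single lookup_single when_def)
qed (auto simp: distrib_left lookup_add)

text \<open>
  A monomial of degree at least two satisfies a quadratic relation with other monomials of its degree: if it contains two
  variables, then \<open>g\<^sup>2 = g\<^sub>1 g\<^sub>2\<close> after exchanging one variable for the other, and for a pure power
  \<open>g g\<^sub>2 = g\<^sub>3\<^sup>2\<close>. Differentiate the relation and compare coefficients at \<open>g\<close> in the first case, at
  \<open>g\<^sub>2\<close> in the second: only the constant term of \<open>\<Delta> g\<close> contributes.
\<close>

lemma point_derivation_monomial:
  fixes \<Delta> :: "(3, 'k::field_char_0) mpoly \<Rightarrow> (3, 'k) mpoly"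
  assumes "derivation_on const (veronese_set d) \<Delta>"
    and e: "tdeg e \<ge> 2" "d dvd tdeg e"
  shows "lookup (\<Delta> (single e 1)) 0 = 0"
proof -
  interpret derivation_on const "veronese_set d" \<Delta> by fact
  have "e \<noteq> 0" using e by (auto simp: tdeg_zero)
  then obtain i where i: "lookup e i > 0" by (rule nonzero_exponent)
  show ?thesis
  proof (cases "\<exists>j. j \<noteq> i \<and> lookup e j > 0")
    case True
    then obtain j where j: "j \<noteq> i" "lookup e j > 0" by blast
    \<comment> \<open>Exchanging \<open>x\<^sub>i\<close> and \<open>x\<^sub>j\<close> once, in either direction, keeps the degree.\<close>
    define e1 e2 where "e1 = (e - single i 1) + single j 1" and "e2 = (e - single j 1) + single i 1"
    have t: "tdeg e1 = tdeg e" "tdeg e2 = tdeg e"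
      using tdeg_minus_single[OF i] tdeg_minus_single[OF j(2)]
      by (simp_all add: e1_def e2_def tdeg_add tdeg_single)
    have "lookup e1 i \<noteq> lookup e i" "lookup e2 i \<noteq> lookup e i"
      using i j by (simp_all add: e1_def e2_def lookup_add lookup_minus lookup_single when_def)
    then have ne: "e1 \<noteq> e" "e2 \<noteq> e" by auto
    have "e1 + e2 = e + e"
      unfolding e1_def e2_def using i j
      by (intro poly_mapping_eqI) (auto simp: lookup_add lookup_minus lookup_single when_def)
    then have "single e 1 * single e 1 = single e1 1 * single e2 (1 :: 'k)"
      by (simp add: mult_single)
    then have "\<Delta> (single e 1) * single e 1 + single e 1 * \<Delta> (single e 1) =
        \<Delta> (single e1 1) * single e2 1 + single e1 1 * \<Delta> (single e2 1)"
      using D_mult[of "single e 1" "single e 1"] D_mult[of "single e1 1" "single e2 1"] t e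
      by (simp add: veronese_set_single)
    then have "lookup (single e 1 * \<Delta> (single e 1) + single e 1 * \<Delta> (single e 1)) e =
      lookup (single e2 1 * \<Delta> (single e1 1) + single e1 1 * \<Delta> (single e2 1)) e"
      by (simp add: mult.commute)
    then have "lookup (\<Delta> (single e 1)) 0 + lookup (\<Delta> (single e 1)) 0 = 0"
      using ne t by (simp only: lookup_add lookup_single_mult) simp
    then show ?thesis by (simp flip: mult_2)
  next
    case False
    then have e_eq: "e = single i (tdeg e)"
      by (intro poly_mapping_eqI) (auto simp: lookup_single when_def tdeg_def
          sum.remove[OF finite UNIV_I, of _ i] intro!: sum.neutral[symmetric])
    obtain j :: 3 where j: "j \<noteq> i" by (metis zero_neq_one)
    define m where "m = tdeg e"
    \<comment> \<open>Here \<open>g = x\<^sub>i\<^sup>m\<close> with \<open>m \<ge> 2\<close>, so \<open>x\<^sub>i\<^sup>m\<^sup>-\<^sup>2 x\<^sub>j\<^sup>2\<close> exists.\<close>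
    define e2 e3 where "e2 = single i (m - 2) + single j (2::nat)"
      and "e3 = single i (m - 1) + single j (1::nat)"
    have t: "tdeg e2 = tdeg e" "tdeg e3 = tdeg e"
      using e by (simp_all add: m_def e2_def e3_def tdeg_add tdeg_single)
    have "lookup e2 j = 2" "lookup e3 j = 1" "lookup e j = 0"
      using j by (simp_all add: e2_def e3_def lookup_add lookup_single when_def)
        (subst e_eq, simp add: lookup_single when_def)
    then have ne: "e2 \<noteq> e" "e2 \<noteq> e3" by auto
    have "single i m + e2 = e3 + e3"
      unfolding e2_def e3_def m_def using e j
      by (intro poly_mapping_eqI) (auto simp: lookup_add lookup_single when_def)
    then have "single e 1 * single e2 1 = single e3 1 * single e3 (1 :: 'k)"
      using e_eq by (simp add: mult_single m_def)
    then have "\<Delta> (single e 1) * single e2 1 + single e 1 * \<Delta> (single e2 1) =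
        \<Delta> (single e3 1) * single e3 1 + single e3 1 * \<Delta> (single e3 1)"
      using D_mult[of "single e 1" "single e2 1"] D_mult[of "single e3 1" "single e3 1"] t e
      by (simp add: veronese_set_single)
    then have "lookup (single e2 1 * \<Delta> (single e 1) + single e 1 * \<Delta> (single e2 1)) e2 =
      lookup (single e3 1 * \<Delta> (single e3 1) + single e3 1 * \<Delta> (single e3 1)) e2"
      by (simp add: mult.commute)
    then show ?thesis
      using ne t by (simp only: lookup_add lookup_single_mult) simp
  qed
qed

lemma point_derivation_linear_part:
  fixes \<Delta> :: "(3, 'k::field_char_0) mpoly \<Rightarrow> (3, 'k) mpoly"
  assumes "derivation_on const (veronese_set d) \<Delta>" "p \<in> veronese_set d" "hpart 1 p = 0"
  shows "lookup (\<Delta> p) 0 = 0"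
proof -
  interpret derivation_on const "veronese_set d" \<Delta> by fact
  have mem: "single e c \<in> veronese_set d" if "e \<in> keys p" for e c
    using assms that by (auto simp: veronese_set_def)
  have "\<Delta> p = (\<Sum>e\<in>keys p. \<Delta> (single e (lookup p e)))"
    using D_sum[of "keys p" "\<lambda>e. single e (lookup p e)"] mem sum_single_lookup[of p] by metis
  also have "\<dots> = (\<Sum>e\<in>keys p. const (lookup p e) * \<Delta> (single e 1))"
  proof (intro sum.cong refl)
    fix e assume "e \<in> keys p"
    then show "\<Delta> (single e (lookup p e)) = const (lookup p e) * \<Delta> (single e 1)"
      using D_smult[OF mem[of e 1], of "lookup p e"] by (simp add: const_mult_single)
  qed
  finally have "lookup (\<Delta> p) 0 = (\<Sum>e\<in>keys p. lookup p e * lookup (\<Delta> (single e 1)) 0)"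
    by (simp add: lookup_sum lookup_const_mult)
  also have "\<dots> = 0"
  proof (intro sum.neutral ballI)
    fix e assume e: "e \<in> keys p"
    have "tdeg e \<noteq> 1"
      using e assms(3) lookup_hpart[of 1 p e] by (auto simp: in_keys_iff)
    then consider "e = 0" | "tdeg e \<ge> 2"
      using tdeg_eq_zero_iff[of e] by linarith
    then show "lookup p e * lookup (\<Delta> (single e 1)) 0 = 0"
    proof cases
      case 1
      then show ?thesis using D_one by simp
    next
      case 2
      then show ?thesis
        using point_derivation_monomial[OF assms(1)] mem[OF e, of 1] by (simp add: veronese_set_single)
    qed
  qed
  finally show ?thesis .
qed

section \<open>Quadratic brackets in three variables\<close>

lemma parallel_if_proportional:
  fixes a :: "'a::idom"
  assumes "a \<noteq> 0" "p * a = r * b" "q * a = r * c" "p' * a = r' * b" "q' * a = r' * c"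
  shows "p * q' = q * p'"
proof -
  have "a * a * (p * q') = (p * a) * (q' * a)" by (simp only: mult_ac)
  also have "\<dots> = (r * c) * (r' * b)" using assms by (simp only: mult_ac)
  also have "\<dots> = (q * a) * (p' * a)" using assms by simp
  also have "\<dots> = a * a * (q * p')" by (simp only: mult_ac)
  finally show ?thesis using \<open>a \<noteq> 0\<close> by simp
qed

locale quadratic_bracket =
  fixes br :: "(3, 'k::field_char_0) mpoly \<Rightarrow> (3, 'k) mpoly \<Rightarrow> (3, 'k) mpoly"
  assumes br_add_left: "br (x + y) z = br x z + br y z"
    and br_add_right: "br x (y + z) = br x y + br x z"
    and br_mult_left: "br (x * y) z = x * br y z + br x z * y"
    and br_mult_right: "br x (y * z) = y * br x z + br x y * z"
    and br_const_left: "br (const c) z = 0"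
    and br_const_right: "br x (const c) = 0"
    and br_self: "br x x = 0"
    and br_indet: "br (indet i) (indet j) \<in> homogeneous 2"
    and br_nontrivial: "\<exists>p q. br p q \<noteq> 0"
begin

lemma br_zero_left [simp]: "br 0 z = 0"
  using br_const_left[of 0] by simp

lemma br_zero_right [simp]: "br z 0 = 0"
  using br_const_right[of _ 0] by simp

lemma br_skew: "br y x = - br x y"
proof -
  have "br y x + br x y = 0"
    using br_self[of "x + y"] br_self[of x] br_self[of y]
    by (simp add: br_add_left br_add_right add.commute)
  then show ?thesis by (simp only: eq_neg_iff_add_eq_0)
qed

lemma br_sum_left: "br (sum f I) z = (\<Sum>i\<in>I. br (f i) z)"
  by (induction I rule: infinite_finite_induct) (simp_all add: br_add_left)

lemma br_sum_right: "br z (sum f I) = (\<Sum>i\<in>I. br z (f i))"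
  by (induction I rule: infinite_finite_induct) (simp_all add: br_add_right)

lemma br_chain_right: "br p q = (\<Sum>j\<in>UNIV. pd j q * br p (indet j))"
  by (rule derivation_chain_rule) (simp_all add: br_add_right br_mult_right br_const_right add.commute)

lemma br_chain_left: "br p q = (\<Sum>i\<in>UNIV. pd i p * br (indet i) q)"
  by (rule derivation_chain_rule[of "\<lambda>p. br p q"]) (simp_all add: br_add_left br_mult_left br_const_left add.commute)

lemma br_homogeneous:
  assumes "p \<in> homogeneous a" "q \<in> homogeneous b"
  shows "br p q \<in> homogeneous (a + b)"
proof (cases "a = 0 \<or> b = 0")
  case True
  then have "br p q = 0"
    using assms homogeneous_zeroD[of p] homogeneous_zeroD[of q] br_const_left br_const_right by metis
  then show ?thesis by simp
next
  case False
  have inner: "br (indet i) q = (\<Sum>j\<in>UNIV. pd j q * br (indet i) (indet j))" for i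
    by (rule br_chain_right)
  have deg: "a - 1 + (b - 1 + 2) = a + b" using False by arith
  have "pd i p * (pd j q * br (indet i) (indet j)) \<in> homogeneous (a + b)" for i j
    using homogeneous_mult[OF pd_homogeneous[OF assms(1), of i]
        homogeneous_mult[OF pd_homogeneous[OF assms(2), of j] br_indet[of i j]]]
    by (simp only: deg)
  then show ?thesis
    by (auto simp: br_chain_left[of p q] inner sum_distrib_left
        intro!: homogeneous_sum)
qed

definition central :: "(3, 'k) mpoly \<Rightarrow> bool"
  where "central z \<longleftrightarrow> (\<forall>q. br z q = 0)"

lemma centralD: "central z \<Longrightarrow> br z q = 0" "central z \<Longrightarrow> br q z = 0"
  using br_skew[of q z] by (auto simp: central_def)

lemma central_const: "central (const c)"
  by (simp add: central_def br_const_left)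

lemma central_add: "central x \<Longrightarrow> central y \<Longrightarrow> central (x + y)"
  by (simp add: central_def br_add_left)

lemma central_mult: "central x \<Longrightarrow> central y \<Longrightarrow> central (x * y)"
  by (simp add: central_def br_mult_left)

text \<open>
  The gradient of a central element is annihilated by the skew-symmetric matrix of the brackets of the variables. A nonzero
  skew-symmetric \<open>3 \<times> 3\<close> matrix has rank two, so its kernel is a line over the fraction field, spanned by
  \<open>(a, b, c)\<close>.
\<close>

lemma gradients_parallel:
  assumes "central z" "central z'"
  shows "pd i z * pd j z' = pd j z * pd i z'"
proof -
  define a b c where "a = br (indet 2) (indet 3)" and "b = br (indet 3) (indet 1)"
    and "c = br (indet 1) (indet 2)"
  have skew: "br (indet 3) (indet 2) = - a" "br (indet 1) (indet 3) = - b" "br (indet 2) (indet 1) = - c"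
    unfolding a_def b_def c_def by (rule br_skew)+
  have eqs: "pd 3 z * b = pd 2 z * c \<and> pd 1 z * c = pd 3 z * a \<and> pd 2 z * a = pd 1 z * b"
    if "central z" for z
  proof -
    have "pd 1 z * br (indet 1) (indet j) + pd 2 z * br (indet 2) (indet j) + pd 3 z * br (indet 3) (indet j) = 0"
      for j
      using br_chain_left[of z "indet j"] centralD[OF that] by (simp add: sum_3)
    from this[of 1] this[of 2] this[of 3] show ?thesis
      by (simp add: br_self skew flip: a_def b_def c_def)
  qed
  note z = eqs[OF assms(1)] and z' = eqs[OF assms(2)]
  have "a \<noteq> 0 \<or> b \<noteq> 0 \<or> c \<noteq> 0"
  proof (rule ccontr)
    assume "\<not> ?thesis"
    then have 0: "a = 0" "b = 0" "c = 0" by simp_all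
    have "\<forall>i j. br (indet i) (indet j) = 0"
      unfolding forall_3 using skew by (simp add: 0 br_self flip: a_def b_def c_def)
    then have "br (indet i) (indet j) = 0" for i j by blast
    then have "br (indet i) q = 0" for i q
      by (subst br_chain_right) simp
    then have "br p q = 0" for p q
      by (subst br_chain_left) simp
    then show False using br_nontrivial by blast
  qed
  then have *: "pd 1 z * pd 2 z' = pd 2 z * pd 1 z' \<and> pd 1 z * pd 3 z' = pd 3 z * pd 1 z' \<and>
     pd 2 z * pd 3 z' = pd 3 z * pd 2 z'"
  proof (elim disjE)
    assume n: "a \<noteq> 0"
    show ?thesis
      using n z z' parallel_if_proportional[of a "pd 1 z" "pd 1 z" a "pd 2 z" b "pd 1 z'" "pd 1 z'" "pd 2 z'"]
        parallel_if_proportional[of a "pd 1 z" "pd 1 z" a "pd 3 z" c "pd 1 z'" "pd 1 z'" "pd 3 z'"]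
        parallel_if_proportional[of a "pd 2 z" "pd 1 z" b "pd 3 z" c "pd 2 z'" "pd 1 z'" "pd 3 z'"]
      by simp
  next
    assume n: "b \<noteq> 0"
    show ?thesis
      using n z z' parallel_if_proportional[of b "pd 1 z" "pd 2 z" a "pd 2 z" b "pd 1 z'" "pd 2 z'" "pd 2 z'"]
        parallel_if_proportional[of b "pd 1 z" "pd 2 z" a "pd 3 z" c "pd 1 z'" "pd 2 z'" "pd 3 z'"]
        parallel_if_proportional[of b "pd 2 z" "pd 2 z" b "pd 3 z" c "pd 2 z'" "pd 2 z'" "pd 3 z'"]
      by simp
  next
    assume n: "c \<noteq> 0"
    show ?thesis
      using n z z' parallel_if_proportional[of c "pd 1 z" "pd 3 z" a "pd 2 z" b "pd 1 z'" "pd 3 z'" "pd 2 z'"]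
        parallel_if_proportional[of c "pd 1 z" "pd 3 z" a "pd 3 z" c "pd 1 z'" "pd 3 z'" "pd 3 z'"]
        parallel_if_proportional[of c "pd 2 z" "pd 3 z" b "pd 3 z" c "pd 2 z'" "pd 3 z'" "pd 3 z'"]
      by simp
  qed
  then have "\<forall>i j. pd i z * pd j z' = pd j z * pd i z'"
    unfolding forall_3 by simp
  then show ?thesis by blast
qed

text \<open>
  The same fact for arbitrary derivations, by the chain rule. It replaces the statement that two central elements are
  algebraically dependent.
\<close>

lemma derivation_parallel:
  fixes \<Delta> \<Delta>' :: "(3, 'k) mpoly \<Rightarrow> (3, 'k) mpoly"
  assumes "derivation_on const UNIV \<Delta>" "derivation_on const UNIV \<Delta>'" "central z" "central z'"
  shows "\<Delta> z * \<Delta>' z' = \<Delta>' z * \<Delta> z'"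
proof -
  interpret a: derivation_on const UNIV \<Delta> by fact
  interpret b: derivation_on const UNIV \<Delta>' by fact
  have 1: "\<Delta> p = (\<Sum>i\<in>UNIV. pd i p * \<Delta> (indet i))" for p
    by (rule derivation_chain_rule) (auto simp: a.D_add a.D_mult a.D_K)
  have 2: "\<Delta>' p = (\<Sum>i\<in>UNIV. pd i p * \<Delta>' (indet i))" for p
    by (rule derivation_chain_rule) (auto simp: b.D_add b.D_mult b.D_K)
  have "\<Delta> z * \<Delta>' z' = (\<Sum>i\<in>UNIV. \<Sum>j\<in>UNIV. pd i z * \<Delta> (indet i) * (pd j z' * \<Delta>' (indet j)))"
    by (subst 1, subst 2) (rule sum_product)
  also have "\<dots> = (\<Sum>i\<in>UNIV. \<Sum>j\<in>UNIV. pd j z * \<Delta>' (indet j) * (pd i z' * \<Delta> (indet i)))"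
  proof (intro sum.cong refl)
    fix i j :: 3
    show "pd i z * \<Delta> (indet i) * (pd j z' * \<Delta>' (indet j)) = pd j z * \<Delta>' (indet j) * (pd i z' * \<Delta> (indet i))"
    proof -
      have "pd i z * \<Delta> (indet i) * (pd j z' * \<Delta>' (indet j)) =
          (pd i z * pd j z') * (\<Delta> (indet i) * \<Delta>' (indet j))" by (simp only: mult_ac)
      also have "\<dots> = pd j z * \<Delta>' (indet j) * (pd i z' * \<Delta> (indet i))"
        unfolding gradients_parallel[OF assms(3,4), of i j] by (simp only: mult_ac)
      finally show ?thesis .
    qed
  qed
  also have "\<dots> = (\<Sum>j\<in>UNIV. \<Sum>i\<in>UNIV. pd j z * \<Delta>' (indet j) * (pd i z' * \<Delta> (indet i)))"
    by (rule sum.swap)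
  also have "\<dots> = \<Delta>' z * \<Delta> z'"
    by (subst 1[of z'], subst 2[of z]) (rule sum_product[symmetric])
  finally show ?thesis .
qed

lemma central_hpart:
  assumes "central z"
  shows "central (hpart m z)"
proof -
  obtain N where N: "\<forall>e\<in>keys z. tdeg e \<le> N" by (rule tdeg_bound)
  have "br (hpart m z) (indet j) = 0" for j
  proof -
    have "0 = hpart (m + 1) (br (\<Sum>n\<le>N. hpart n z) (indet j))"
      using centralD[OF assms] by (simp flip: sum_hpart[OF N])
    also have "\<dots> = (\<Sum>n\<le>N. hpart (m + 1) (br (hpart n z) (indet j)))"
      by (simp add: br_sum_left hpart_sum)
    also have "\<dots> = (\<Sum>n\<le>N. if n = m then br (hpart n z) (indet j) else 0)"
      by (intro sum.cong refl)
        (simp add: hpart_of_homogeneous[OF br_homogeneous[OF hpart_homogeneous homogeneous_indet]])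
    also have "\<dots> = (if m \<le> N then br (hpart m z) (indet j) else 0)"
      by simp
    finally have "m \<le> N \<Longrightarrow> ?thesis" by simp
    moreover have "hpart m z = 0" if "\<not> m \<le> N"
      using N that by (intro poly_mapping_eqI) (auto simp: lookup_hpart in_keys_iff)
    ultimately show ?thesis by fastforce
  qed
  then show ?thesis
    unfolding central_def by (subst br_chain_right) simp
qed

text \<open>
  By Euler's formula the parallel gradients satisfy \<open>n f \<nabla>z = j z \<nabla>f\<close>, which is the vanishing of the gradient of
  \<open>z\<^sup>n / f\<^sup>j\<close>.
\<close>

lemma central_powers_proportional:
  assumes "central z" "central f" "z \<in> homogeneous j" "f \<in> homogeneous n" "f \<noteq> 0"
  shows "\<exists>c. z ^ n = const c * f ^ j"
proof (rule proportional_if_Wronskian_zero)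
  fix i
  have pow: "pd i (p ^ m) = of_nat m * p ^ (m - 1) * pd i p" for p :: "(3, 'k) mpoly" and m
    using derivation_on.D_power[OF locally_nilpotent_derivation.axioms(1)[OF pd_locally_nilpotent]]
    by blast
  have "of_nat n * f * pd i z = (\<Sum>l\<in>UNIV. indet l * pd l f * pd i z)"
    by (simp add: Euler_homogeneous[OF assms(4)] flip: sum_distrib_right)
  also have "\<dots> = (\<Sum>l\<in>UNIV. indet l * pd l z * pd i f)"
    using gradients_parallel[OF assms(2,1), of _ i]
    by (intro sum.cong refl) (simp add: mult.assoc mult.commute[of "pd i f"])
  also have "\<dots> = of_nat j * z * pd i f"
    by (simp add: Euler_homogeneous[OF assms(3)] flip: sum_distrib_right)
  finally have *: "of_nat n * f * pd i z = of_nat j * z * pd i f" .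
  show "f ^ j * pd i (z ^ n) = z ^ n * pd i (f ^ j)"
  proof (cases "n = 0 \<or> j = 0")
    case True
    then show ?thesis
    proof
      assume "n = 0"
      then have "pd i f = 0" using assms(4) homogeneous_zeroD[of f] pd_const by metis
      then show ?thesis using \<open>n = 0\<close> by (simp add: pow)
    next
      assume "j = 0"
      then have "pd i z = 0" using assms(3) homogeneous_zeroD[of z] pd_const by metis
      then show ?thesis using \<open>j = 0\<close> by (simp add: pow)
    qed
  next
    case False
    then obtain n' j' where "n = Suc n'" "j = Suc j'" by (metis not0_implies_Suc)
    have "f ^ j * pd i (z ^ n) = f ^ j' * z ^ n' * (of_nat n * f * pd i z)"
      unfolding pow using \<open>n = Suc n'\<close> \<open>j = Suc j'\<close> by (simp add: mult_ac del: of_nat_Suc)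
    also have "\<dots> = f ^ j' * z ^ n' * (of_nat j * z * pd i f)"
      by (simp only: *)
    also have "\<dots> = z ^ n * pd i (f ^ j)"
      unfolding pow using \<open>n = Suc n'\<close> \<open>j = Suc j'\<close> by (simp add: mult_ac del: of_nat_Suc)
    finally show ?thesis .
  qed
next
  show "z ^ n \<in> homogeneous (n * j)"
    by (rule homogeneous_power[OF assms(3)])
  show "f ^ j \<in> homogeneous (n * j)"
    using homogeneous_power[OF assms(4), of j] by (simp add: mult.commute)
qed (use assms in simp)

text \<open>
  \<open>{z, x\<^sup>d} = d x\<^sup>d\<^sup>-\<^sup>1 {z, x}\<close> for every variable \<open>x\<close>.
\<close>

lemma central_if_central_in_veronese:
  assumes "d \<ge> 1" "\<And>q. q \<in> veronese_set d \<Longrightarrow> br z q = 0"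
  shows "central z"
proof -
  have pow: "br z (q ^ n) = of_nat n * q ^ (n - 1) * br z q" for q n
  proof (induction n)
    case (Suc n)
    then show ?case
      by (cases n) (simp_all add: br_mult_right algebra_simps)
  next
    case 0
    then show ?case using br_const_right[of z 1] by simp
  qed
  have "br z (indet j) = 0" for j
  proof -
    have "(indet j :: (3, 'k) mpoly) ^ d \<in> veronese_set d"
      using homogeneous_power[OF homogeneous_indet, of j d] by (auto intro: veronese_set_homogeneous)
    then have "of_nat d * indet j ^ (d - 1) * br z (indet j) = 0"
      using assms(2) pow by metis
    moreover have "(indet j :: (3, 'k) mpoly) \<noteq> 0"
      by (simp add: indet_def flip: keys_eq_empty)
    ultimately show ?thesis using assms(1) by simp
  qed
  then show ?thesis
    unfolding central_def by (subst br_chain_right) simp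
qed

lemma br_veronese:
  assumes "p \<in> veronese_set d" "q \<in> veronese_set d"
  shows "br p q \<in> veronese_set d"
proof -
  have s: "br (single e a) (single e' b) \<in> veronese_set d" if "e \<in> keys p" "e' \<in> keys q" for e e' a b
  proof (rule veronese_set_homogeneous)
    show "br (single e a) (single e' b) \<in> homogeneous (tdeg e + tdeg e')"
      by (intro br_homogeneous homogeneous_single)
    show "d dvd tdeg e + tdeg e'"
      using that assms by (simp add: veronese_set_def)
  qed
  have "br p q = (\<Sum>e\<in>keys p. \<Sum>e'\<in>keys q. br (single e (lookup p e)) (single e' (lookup q e')))"
  proof -
    have "br p q = br (\<Sum>e\<in>keys p. single e (lookup p e)) (\<Sum>e'\<in>keys q. single e' (lookup q e'))"
      by (simp flip: sum_single_lookup)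
    then show ?thesis
      by (simp only: br_sum_left) (simp only: br_sum_right)
  qed
  then show ?thesis using s by (auto intro!: veronese_set_sum)
qed

end

section \<open>The polynomial extension of a Veronese subalgebra\<close>

abbreviation pconst :: "'k::field \<Rightarrow> ('v, 'k) mpoly poly"
  where "pconst c \<equiv> [:const c:]"

abbreviation tvar :: "'a::comm_semiring_1 poly"
  where "tvar \<equiv> [:0, 1:]"

lemma monom_eq_const_mult_power: "monom a i = [:a:] * tvar ^ i"
  by (simp add: monom_altdef)

lemma poly_monom_induct:
  assumes "\<And>a i. Q (monom a i)" "\<And>p q. Q p \<Longrightarrow> Q q \<Longrightarrow> Q (p + q)"
  shows "Q (p :: 'a::comm_monoid_add poly)"
proof -
  have "Q (\<Sum>i\<le>n. monom (f i) i)" for n and f :: "nat \<Rightarrow> 'a"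
    by (induction n) (auto intro: assms)
  then show ?thesis using poly_as_sum_of_monoms[of p] by metis
qed

lemma poly_expansion:
  "p = (\<Sum>i\<le>degree p. [:coeff p i:] * tvar ^ i)"
  using poly_as_sum_of_monoms[of p] by (simp only: monom_eq_const_mult_power)

lemma mpoly_poly_unit_const:
  fixes P Q :: "('v::{finite,linorder}, 'k::field_char_0) mpoly poly"
  assumes "P * Q = 1"
  obtains \<kappa> where "P = pconst \<kappa>" "\<kappa> \<noteq> 0"
proof -
  have "P dvd 1" using assms by (metis dvdI)
  then obtain u where u: "P = [:u:]" "u dvd 1" by (auto simp: is_unit_poly_iff)
  then obtain v where "u * v = 1" by (metis dvdE)
  then show thesis using mpoly_unit_const[of u v] u that by metis
qed

lemma const_poly_sum: "[:sum g I:] = (\<Sum>i\<in>I. [:g i:])"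
proof (induction I rule: infinite_finite_induct)
  case (insert i I)
  then show ?case by (simp flip: insert.IH)
qed simp_all

lemma pcompose_monom: "pcompose (monom a i) u = [:a:] * u ^ i"
  by (induction i) (simp_all add: monom_0 monom_Suc pcompose_pCons mult_ac)

definition veronese_poly :: "nat \<Rightarrow> ('v::finite, 'k::field) mpoly poly set"
  where "veronese_poly d = {P. \<forall>i. coeff P i \<in> veronese_set d}"

lemma veronese_poly_const: "[:a:] \<in> veronese_poly d \<longleftrightarrow> a \<in> veronese_set d"
  using veronese_set_const[of 0 d] by (auto simp: veronese_poly_def coeff_pCons split: nat.splits)

lemma veronese_poly_tvar: "tvar \<in> veronese_poly d"
  using veronese_set_const[of 0 d] veronese_set_const[of 1 d]
  by (auto simp: veronese_poly_def coeff_pCons split: nat.splits)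

lemma veronese_poly_add: "P \<in> veronese_poly d \<Longrightarrow> Q \<in> veronese_poly d \<Longrightarrow> P + Q \<in> veronese_poly d"
  by (simp add: veronese_poly_def veronese_set_add)

lemma veronese_poly_mult: "P \<in> veronese_poly d \<Longrightarrow> Q \<in> veronese_poly d \<Longrightarrow> P * Q \<in> veronese_poly d"
  by (auto simp: veronese_poly_def coeff_mult intro!: veronese_set_sum veronese_set_mult)

context quadratic_bracket
begin

definition pbr :: "(3, 'k) mpoly poly \<Rightarrow> (3, 'k) mpoly poly \<Rightarrow> (3, 'k) mpoly poly"
  where "pbr P Q = Abs_poly (\<lambda>n. \<Sum>i\<le>n. br (coeff P i) (coeff Q (n - i)))"

lemma coeff_pbr:
  "coeff (pbr P Q) n = (\<Sum>i\<le>n. br (coeff P i) (coeff Q (n - i)))"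
proof -
  have "(\<Sum>i\<le>n. br (coeff P i) (coeff Q (n - i))) = 0"
    if "n > degree P + degree Q" for n
  proof (intro sum.neutral ballI)
    fix i assume "i \<in> {..n}"
    then have "i > degree P \<or> n - i > degree Q" using that by auto
    then show "br (coeff P i) (coeff Q (n - i)) = 0"
      by (auto simp: coeff_eq_0)
  qed
  then show ?thesis unfolding pbr_def by (subst coeff_Abs_poly) auto
qed

lemma pbr_add_left: "pbr (P + P') Q = pbr P Q + pbr P' Q"
  by (rule poly_eqI) (simp add: coeff_pbr br_add_left sum.distrib)

lemma pbr_add_right: "pbr P (Q + Q') = pbr P Q + pbr P Q'"
  by (rule poly_eqI) (simp add: coeff_pbr br_add_right sum.distrib)

lemma pbr_zero [simp]: "pbr 0 P = 0" "pbr P 0 = 0"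
  by (rule poly_eqI; simp add: coeff_pbr)+

lemma pbr_monom_monom:
  "pbr (monom a i) (monom b j) = monom (br a b) (i + j)"
proof (rule poly_eqI)
  fix n
  have "(\<Sum>l\<le>n. br (if i = l then a else 0) (if j = n - l then b else 0)) =
      (\<Sum>l\<le>n. if l = i then (if i + j = n then br a b else 0) else 0)"
    by (intro sum.cong) auto
  then show "coeff (pbr (monom a i) (monom b j)) n =
      coeff (monom (br a b) (i + j)) n"
    by (auto simp: coeff_pbr)
qed

lemma pbr_mult_left: "pbr (U * V) Z = U * pbr V Z + pbr U Z * V"
proof (induction U rule: poly_monom_induct)
  case (1 a i)
  show ?case
  proof (induction V rule: poly_monom_induct)
    case (1 b j)
    show ?case
      by (induction Z rule: poly_monom_induct)
        (simp_all add: pbr_monom_monom mult_monom br_mult_left add_monom pbr_add_right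
          algebra_simps flip: add_monom)
  qed (simp add: pbr_add_left algebra_simps)
qed (simp add: pbr_add_left algebra_simps)

lemma pbr_mult_right: "pbr Z (U * V) = U * pbr Z V + pbr Z U * V"
proof (induction U rule: poly_monom_induct)
  case (1 a i)
  show ?case
  proof (induction V rule: poly_monom_induct)
    case (1 b j)
    show ?case
      by (induction Z rule: poly_monom_induct)
        (simp_all add: pbr_monom_monom mult_monom br_mult_right add_monom pbr_add_left
          algebra_simps flip: add_monom)
  qed (simp add: pbr_add_right algebra_simps)
qed (simp add: pbr_add_right algebra_simps)

lemma pbr_const_const: "pbr [:a:] [:b:] = [:br a b:]"
  using pbr_monom_monom[of a 0 b 0] by (simp add: monom_0)

lemma pbr_const_right: "coeff (pbr U [:q:]) n = br (coeff U n) q"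
proof -
  have "(\<Sum>i\<le>n. br (coeff U i) (coeff [:q:] (n - i))) =
      (\<Sum>i\<le>n. if i = n then br (coeff U n) q else 0)"
    by (intro sum.cong refl) (auto simp: coeff_pCons split: nat.splits)
  then show ?thesis by (simp add: coeff_pbr)
qed

lemma pbr_closed: "U \<in> veronese_poly d \<Longrightarrow> V \<in> veronese_poly d \<Longrightarrow> pbr U V \<in> veronese_poly d"
  by (auto simp: veronese_poly_def coeff_pbr intro!: veronese_set_sum br_veronese)

definition pcentral :: "(3, 'k) mpoly poly \<Rightarrow> bool"
  where "pcentral P \<longleftrightarrow> (\<forall>i. central (coeff P i))"

lemma pcentralD: "pcentral P \<Longrightarrow> pbr P U = 0" "pcentral P \<Longrightarrow> pbr U P = 0"
  by (rule poly_eqI; simp add: coeff_pbr pcentral_def centralD)+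

lemma pcentral_mult_left: "pcentral w \<Longrightarrow> pbr (w * U) V = w * pbr U V"
  by (simp add: pbr_mult_left pcentralD)

lemma pcentral_mult_right: "pcentral w \<Longrightarrow> pbr U (w * V) = w * pbr U V"
  by (simp add: pbr_mult_right pcentralD)

lemma central_zero: "central 0"
  by (simp add: central_def)

lemma central_sum: "(\<And>i. i \<in> I \<Longrightarrow> central (f i)) \<Longrightarrow> central (sum f I)"
  by (induction I rule: infinite_finite_induct) (auto intro: central_zero central_add)

lemma pcentral_add: "pcentral U \<Longrightarrow> pcentral V \<Longrightarrow> pcentral (U + V)"
  by (simp add: pcentral_def central_add)

lemma pcentral_mult: "pcentral U \<Longrightarrow> pcentral V \<Longrightarrow> pcentral (U * V)"
  by (auto simp: pcentral_def coeff_mult intro!: central_sum central_mult)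

lemma pcentral_const: "pcentral [:a:] \<longleftrightarrow> central a"
  using central_zero by (auto simp: pcentral_def coeff_pCons split: nat.splits)

lemma pcentral_tvar: "pcentral tvar"
  using central_zero central_const[of 1] by (auto simp: pcentral_def coeff_pCons split: nat.splits)

lemma pbr_skew: "pbr P Q = - pbr Q P"
proof (induction P rule: poly_monom_induct)
  case (1 a i)
  show ?case
  proof (induction Q rule: poly_monom_induct)
    case (1 b j)
    show ?case
      using br_skew[of a b] by (simp add: pbr_monom_monom add.commute minus_monom)
  qed (simp add: pbr_add_left pbr_add_right)
qed (simp add: pbr_add_left pbr_add_right)

lemma pbr_pcompose:
  assumes u: "pcentral u"
  shows "pbr (pcompose P u) (pcompose Q u) = pcompose (pbr P Q) u"
proof (induction P rule: poly_monom_induct)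
  case (1 a i)
  have pw: "pcentral (u ^ n)" for n
    using u central_const[of 1] pcentral_const[of 1]
    by (induction n) (auto simp: one_pCons intro: pcentral_mult)
  show ?case
  proof (induction Q rule: poly_monom_induct)
    case (1 b j)
    have "pbr ([:a:] * u ^ i) ([:b:] * u ^ j) = u ^ i * (u ^ j * pbr [:a:] [:b:])"
      using pcentral_mult_left[OF pw] pcentral_mult_right[OF pw]
      by (simp only: mult.commute[of "[:_:]"] mult.left_commute[of "u ^ j"])
    then show ?case
      by (simp add: pcompose_monom pbr_monom_monom pbr_const_const power_add mult_ac)
  qed (simp add: pcompose_add pbr_add_right)
qed (simp add: pcompose_add pbr_add_left)

lemma pderiv_pbr: "pderiv (pbr P Q) = pbr (pderiv P) Q + pbr P (pderiv Q)"
proof (induction P rule: poly_monom_induct)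
  case (1 a i)
  show ?case
  proof (induction Q rule: poly_monom_induct)
    case (1 b j)
    have l: "br (of_nat n * x) y = of_nat n * br x y" for n x y
      using br_mult_left[of "const (of_nat n)" x y] by (simp add: br_const_left[of "of_nat n", unfolded single_of_nat])
    have r: "br x (of_nat n * y) = of_nat n * br x y" for n x y
      using br_mult_right[of x "const (of_nat n)" y] by (simp add: br_const_right[of x "of_nat n", unfolded single_of_nat])
    have e: "monom (of_nat i * c) (i - 1 + j) = monom (of_nat i * c) (i + j - 1)"
      "monom (of_nat j * c) (i + (j - 1)) = monom (of_nat j * c) (i + j - 1)" for c :: "(3, 'k) mpoly"
      by (cases i; cases j; simp)+
    show ?case
      by (simp only: pbr_monom_monom pderiv_monom l r e of_nat_add distrib_right add_monom)
  qed (simp add: pbr_add_right pderiv_add algebra_simps)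
qed (simp add: pbr_add_left pderiv_add algebra_simps)

text \<open>
  It suffices to test against constants in the Veronese subalgebra.
\<close>

lemma pcentralI:
  assumes "d \<ge> 1" "\<And>V. V \<in> veronese_poly d \<Longrightarrow> pbr U V = 0"
  shows "pcentral U"
  unfolding pcentral_def
proof
  fix n
  show "central (coeff U n)"
  proof (rule central_if_central_in_veronese[OF assms(1)])
    fix q :: "(3, 'k) mpoly" assume "q \<in> veronese_set d"
    then have "pbr U [:q:] = 0" using assms(2) by (simp add: veronese_poly_const)
    then show "br (coeff U n) q = 0"
      using pbr_const_right[of U q n] by simp
  qed
qed

end

text \<open>
  What an isomorphism \<open>R[t] \<cong> B[s]\<close> puts on \<open>M = R[t]\<close>, where \<open>R\<close> is the Veronese subalgebra: \<open>D\<close> is the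
  derivative in \<open>s\<close>, and \<open>\<pi>\<close> is the evaluation at \<open>s = 0\<close>. The kernel of \<open>D\<close> is the copy of \<open>B\<close>.
\<close>

locale split_extension = quadratic_bracket br +
  K_lnd: locally_nilpotent_derivation "pconst :: 'k \<Rightarrow> (3, 'k) mpoly poly" "veronese_poly d" D
  for br :: "(3, 'k::field_char_0) mpoly \<Rightarrow> (3, 'k) mpoly \<Rightarrow> (3, 'k) mpoly" and d D +
  fixes s :: "(3, 'k) mpoly poly" and \<pi> :: "(3, 'k) mpoly poly \<Rightarrow> (3, 'k) mpoly poly"
  assumes d_pos: "d \<ge> 1"
    and D_pbr: "\<lbrakk>U \<in> veronese_poly d; V \<in> veronese_poly d\<rbrakk> \<Longrightarrow> D (pbr U V) = pbr (D U) V + pbr U (D V)"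
    and s_closed: "s \<in> veronese_poly d"
    and D_s: "D s = 1"
    and s_central: "U \<in> veronese_poly d \<Longrightarrow> pbr s U = 0"
    and \<pi>_closed: "U \<in> veronese_poly d \<Longrightarrow> \<pi> U \<in> veronese_poly d"
    and D_\<pi>: "U \<in> veronese_poly d \<Longrightarrow> D (\<pi> U) = 0"
    and \<pi>_add: "\<lbrakk>U \<in> veronese_poly d; V \<in> veronese_poly d\<rbrakk> \<Longrightarrow> \<pi> (U + V) = \<pi> U + \<pi> V"
    and \<pi>_mult: "\<lbrakk>U \<in> veronese_poly d; V \<in> veronese_poly d\<rbrakk> \<Longrightarrow> \<pi> (U * V) = \<pi> U * \<pi> V"
    and \<pi>_kernel: "\<lbrakk>U \<in> veronese_poly d; D U = 0\<rbrakk> \<Longrightarrow> \<pi> U = U"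
    and \<pi>_s: "\<pi> s = 0"
    and \<pi>_pbr: "\<lbrakk>U \<in> veronese_poly d; V \<in> veronese_poly d\<rbrakk> \<Longrightarrow> \<pi> (pbr U V) = pbr (\<pi> U) (\<pi> V)"
    and \<pi>_decomp: "U \<in> veronese_poly d \<Longrightarrow> \<exists>V\<in>veronese_poly d. U = \<pi> U + s * V"
begin

abbreviation "M \<equiv> veronese_poly d :: (3, 'k) mpoly poly set"

text \<open>
  A Poisson isomorphism from the Veronese subalgebra to the kernel of \<open>D\<close>. The values on \<open>A\<close> outside the Veronese
  subalgebra are arbitrary.
\<close>

definition kernel_iso :: "((3, 'k) mpoly \<Rightarrow> (3, 'k) mpoly poly) \<Rightarrow> bool"
  where "kernel_iso h \<longleftrightarrow> bij_betw h (veronese_set d) {U \<in> M. D U = 0} \<and>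
    (\<forall>x\<in>veronese_set d. \<forall>y\<in>veronese_set d. h (x + y) = h x + h y \<and> h (x * y) = h x * h y \<and>
        h (br x y) = pbr (h x) (h y)) \<and>
    (\<forall>c. h (const c) = pconst c)"

lemma tvar_closed: "tvar \<in> M"
  by (rule veronese_poly_tvar)

lemma const_closed: "a \<in> veronese_set d \<Longrightarrow> [:a:] \<in> M"
  by (simp add: veronese_poly_const)

lemma coeff_closed: "P \<in> M \<Longrightarrow> [:coeff P i:] \<in> M"
  by (simp add: veronese_poly_const) (simp add: veronese_poly_def)

lemma \<pi>_const: "\<pi> (pconst c) = pconst c"
  by (rule \<pi>_kernel) (simp_all add: K_lnd.K_closed K_lnd.D_K)

lemma \<pi>_sum: "(\<And>i. i \<in> I \<Longrightarrow> f i \<in> M) \<Longrightarrow> \<pi> (sum f I) = (\<Sum>i\<in>I. \<pi> (f i))"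
  using \<pi>_const[of 0]
  by (induction I rule: infinite_finite_induct) (simp_all add: \<pi>_add K_lnd.sum_closed)

lemma \<pi>_power: "U \<in> M \<Longrightarrow> \<pi> (U ^ n) = \<pi> U ^ n"
  using \<pi>_const[of 1]
  by (induction n) (simp_all add: \<pi>_mult K_lnd.power_closed one_pCons)

lemma D_expansion:
  assumes "P \<in> M"
  shows "D P = (\<Sum>i\<le>degree P. D [:coeff P i:] * tvar ^ i) + pderiv P * D tvar"
proof -
  let ?n = "degree P" and ?c = "\<lambda>i. [:coeff P i:]"
  note cl = K_lnd.mult_closed K_lnd.power_closed coeff_closed[OF assms] tvar_closed
  have "pderiv P = (\<Sum>i\<le>?n. ?c i * (of_nat i * tvar ^ (i - 1)))"
  proof -
    have "pderiv (?c i * tvar ^ i) = ?c i * (of_nat i * tvar ^ (i - 1))" for i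
    proof (cases i)
      case (Suc j)
      then show ?thesis
        by (simp only: pderiv_mult pderiv_power_Suc) (simp add: pderiv_pCons of_nat_poly)
    qed (simp add: pderiv_mult)
    then have "pderiv (\<Sum>i\<le>?n. ?c i * tvar ^ i) = (\<Sum>i\<le>?n. ?c i * (of_nat i * tvar ^ (i - 1)))"
      using higher_pderiv_sum[of 1 "\<lambda>i. ?c i * tvar ^ i" "{..?n}"] by simp
    then show ?thesis using poly_expansion[of P] by metis
  qed
  then have "pderiv P * D tvar = (\<Sum>i\<le>?n. ?c i * (of_nat i * tvar ^ (i - 1)) * D tvar)"
    by (simp add: sum_distrib_right)
  moreover have "D P = (\<Sum>i\<le>?n. D (?c i * tvar ^ i))"
  proof -
    have "D (\<Sum>i\<le>?n. ?c i * tvar ^ i) = (\<Sum>i\<le>?n. D (?c i * tvar ^ i))"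
      by (intro K_lnd.D_sum cl)
    then show ?thesis using poly_expansion[of P] by metis
  qed
  moreover have "D (?c i * tvar ^ i) = D (?c i) * tvar ^ i + ?c i * (of_nat i * tvar ^ (i - 1)) * D tvar" for i
    by (simp only: K_lnd.D_mult K_lnd.D_power cl mult.assoc)
  ultimately show ?thesis by (simp only: sum.distrib)
qed

text \<open>
  This makes statements about derivations of \<open>R\<close> into itself applicable to \<open>D\<close>.
\<close>

lemma D_coeff_derivation: "derivation_on const (veronese_set d) (\<lambda>p. coeff (D [:p:]) i)"
proof unfold_locales
  fix x y :: "(3, 'k) mpoly"
  assume xy: "x \<in> veronese_set d" "y \<in> veronese_set d"
  show "coeff (D [:x + y:]) i = coeff (D [:x:]) i + coeff (D [:y:]) i"
    using K_lnd.D_add[OF const_closed[OF xy(1)] const_closed[OF xy(2)]] by simp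
  have "D [:x * y:] = D [:x:] * [:y:] + [:x:] * D [:y:]"
  proof -
    have "[:x * y:] = [:x:] * [:y:]" by simp
    then show ?thesis
      by (simp only: K_lnd.D_mult[OF const_closed[OF xy(1)] const_closed[OF xy(2)]])
  qed
  then show "coeff (D [:x * y:]) i = coeff (D [:x:]) i * y + x * coeff (D [:y:]) i"
    by (simp add: mult.commute)
next
  fix x :: "(3, 'k) mpoly"
  assume "x \<in> veronese_set d"
  then show "coeff (D [:x:]) i \<in> veronese_set d"
    using K_lnd.D_closed[OF const_closed] by (simp add: veronese_poly_def)
qed (simp_all add: const_add const_mult veronese_set_const veronese_set_add veronese_set_mult K_lnd.D_K)

text \<open>
  The Poisson centre of \<open>M\<close>. Centrality of the coefficients in all of \<open>A\<close> amounts to centrality in \<open>M\<close>, by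
  \<open>pcentralI\<close>.
\<close>

definition PZ :: "(3, 'k) mpoly poly set"
  where "PZ = {P \<in> M. pcentral P}"

lemma PZ_D: "P \<in> PZ \<Longrightarrow> D P \<in> PZ"
proof -
  assume P: "P \<in> PZ"
  then have PM: "P \<in> M" "pcentral P" by (auto simp: PZ_def)
  have "pbr (D P) V = 0" if "V \<in> M" for V
    using D_pbr[OF PM(1) that] PM(2) that by (simp add: pcentralD K_lnd.D_zero)
  then have "pcentral (D P)" by (rule pcentralI[OF d_pos])
  then show ?thesis using PM by (simp add: PZ_def K_lnd.D_closed)
qed

lemma PZ_s: "s \<in> PZ"
  using pcentralI[OF d_pos s_central] s_closed by (simp add: PZ_def)

lemma PZ_tvar: "tvar \<in> PZ"
  using tvar_closed pcentral_tvar by (simp add: PZ_def)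

lemma PZ_const: "[:z:] \<in> PZ \<longleftrightarrow> z \<in> veronese_set d \<and> central z"
  by (simp add: PZ_def veronese_poly_const pcentral_const)

lemma PZ_add: "U \<in> PZ \<Longrightarrow> V \<in> PZ \<Longrightarrow> U + V \<in> PZ"
  by (simp add: PZ_def pcentral_add veronese_poly_add)

lemma PZ_mult: "U \<in> PZ \<Longrightarrow> V \<in> PZ \<Longrightarrow> U * V \<in> PZ"
  by (simp add: PZ_def pcentral_mult veronese_poly_mult)

lemma PZ_pconst: "pconst c \<in> PZ"
  by (simp add: PZ_const veronese_set_const central_const)

end

section \<open>Derivations that kill the Poisson centre\<close>

context split_extension
begin

definition const_free :: "(3, 'k) mpoly poly set"
  where "const_free = {P. \<forall>i. lookup (coeff P i) 0 = 0}"

lemma const_free_add: "P \<in> const_free \<Longrightarrow> Q \<in> const_free \<Longrightarrow> P + Q \<in> const_free"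
  by (simp add: const_free_def lookup_add)

lemma const_free_sum: "(\<And>i. i \<in> I \<Longrightarrow> f i \<in> const_free) \<Longrightarrow> sum f I \<in> const_free"
  by (induction I rule: infinite_finite_induct) (auto simp: const_free_add, auto simp: const_free_def)

lemma const_free_mult: "P \<in> const_free \<Longrightarrow> P * Q \<in> const_free"
  by (simp add: const_free_def coeff_mult lookup_sum lookup_mult_zero)

lemma const_free_const: "[:a:] \<in> const_free \<longleftrightarrow> lookup a 0 = 0"
  by (auto simp: const_free_def coeff_pCons split: nat.splits)

text \<open>
  The radical of the principal ideal of \<open>M\<close> generated by \<open>f\<close>.
\<close>

definition radical_of :: "(3, 'k) mpoly \<Rightarrow> (3, 'k) mpoly poly set"
  where "radical_of f = {U \<in> M. \<exists>L. \<exists>G\<in>M. U ^ L = [:f:] * G}"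

lemma radical_of_add:
  assumes "U \<in> radical_of f" "V \<in> radical_of f"
  shows "U + V \<in> radical_of f"
proof -
  obtain a G b H where U: "U \<in> M" "G \<in> M" "U ^ a = [:f:] * G" and V: "V \<in> M" "H \<in> M" "V ^ b = [:f:] * H"
    using assms by (auto simp: radical_of_def)
  note cl = K_lnd.mult_closed K_lnd.power_closed K_lnd.sum_closed U V
  have of_nat_cl: "of_nat n \<in> M" for n
    using K_lnd.K_closed[of "of_nat n"] by (simp only: K_lnd.K_of_nat)
  define T where "T k = (if a \<le> k then G * U ^ (k - a) * V ^ (a + b - k)
      else U ^ k * H * V ^ (a - k))" for k
  have "(of_nat ((a + b) choose k) * U ^ k * V ^ (a + b - k)) = [:f:] * (of_nat ((a + b) choose k) * T k)"
    if "k \<le> a + b" for k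
  proof (cases "a \<le> k")
    case True
    then have "U ^ k = U ^ a * U ^ (k - a)" by (simp flip: power_add)
    then show ?thesis using True by (simp only: T_def U(3) if_True mult_ac)
  next
    case False
    then have "V ^ (a + b - k) = V ^ b * V ^ (a - k)" by (simp add: add.commute flip: power_add)
    then show ?thesis using False by (simp only: T_def V(3) if_False mult_ac)
  qed
  then have "(U + V) ^ (a + b) = [:f:] * (\<Sum>k\<le>a+b. of_nat ((a + b) choose k) * T k)"
    by (simp only: binomial_ring sum_distrib_left) (intro sum.cong refl, simp)
  moreover have "(\<Sum>k\<le>a+b. of_nat ((a + b) choose k) * T k) \<in> M"
    by (intro cl of_nat_cl) (simp add: T_def cl)
  ultimately show ?thesis
    using K_lnd.add_closed[OF U(1) V(1)] by (auto simp: radical_of_def)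
qed

lemma radical_of_mult:
  assumes "U \<in> radical_of f" "V \<in> M"
  shows "U * V \<in> radical_of f"
proof -
  obtain a G where U: "U \<in> M" "G \<in> M" "U ^ a = [:f:] * G"
    using assms by (auto simp: radical_of_def)
  have "(U * V) ^ a = [:f:] * (G * V ^ a)" by (simp only: power_mult_distrib U(3) mult.assoc)
  then show ?thesis using U assms(2)
    by (auto simp: radical_of_def intro: K_lnd.mult_closed K_lnd.power_closed)
qed

lemma radical_of_sum: "(\<And>i. i \<in> I \<Longrightarrow> g i \<in> radical_of f) \<Longrightarrow> finite I \<Longrightarrow> sum g I \<in> radical_of f"
proof (induction I rule: infinite_finite_induct)
  case empty
  have "(0 :: (3, 'k) mpoly poly) ^ 1 = [:f:] * 0" by simp
  then have "(0 :: (3, 'k) mpoly poly) \<in> radical_of f"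
    unfolding radical_of_def using K_lnd.zero_closed by blast
  then show ?case by simp
qed (auto intro: radical_of_add)

text \<open>
  A homogeneous central \<open>z\<close> of positive degree has a power that is a multiple of a power of \<open>f\<close>, hence lies in the
  radical. The element \<open>q\<close> is a combination of such \<open>z\<close>.
\<close>

lemma center_in_radical_of:
  assumes f: "central f" "f \<in> homogeneous n" "f \<noteq> 0" "f \<in> veronese_set d" and q: "q \<in> PZ" "q \<in> const_free"
  shows "q \<in> radical_of f"
proof -
  have "[:hpart m (coeff q i):] \<in> radical_of f" for m i
  proof -
    let ?z = "hpart m (coeff q i)"
    have z: "?z \<in> veronese_set d" "central ?z" "?z \<in> homogeneous m"
      using q(1) by (auto simp: PZ_def veronese_poly_def pcentral_def hpart_homogeneous
          intro: veronese_set_hpart central_hpart)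
    show ?thesis
    proof (cases m)
      case 0
      then have "?z = 0" using q(2) by (simp add: hpart_zero_eq const_free_def)
      then show ?thesis using radical_of_sum[of "{}" "\<lambda>_. 0"] by simp
    next
      case (Suc m')
      obtain c where "?z ^ n = const c * f ^ m"
        using central_powers_proportional[OF z(2) f(1) z(3) f(2,3)] by blast
      then have "?z ^ n = f * (const c * f ^ m')" using Suc by (simp add: mult_ac)
      then have "[:?z:] ^ n = [:f:] * [:const c * f ^ m':]"
        by (simp add: poly_const_pow)
      moreover have "const c * f ^ m' \<in> veronese_set d"
      proof -
        have "f ^ m' \<in> veronese_set d"
          using f(4) veronese_set_const[of 1 d] by (induction m') (auto intro: veronese_set_mult)
        then show ?thesis by (intro veronese_set_mult veronese_set_const)
      qed
      ultimately show ?thesis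
        using z(1) unfolding radical_of_def by (blast intro: const_closed)
    qed
  qed
  moreover have "[:coeff q i:] = (\<Sum>m\<le>N. [:hpart m (coeff q i):])"
    if "\<forall>e\<in>keys (coeff q i). tdeg e \<le> N" for i N
  proof -
    show ?thesis using sum_hpart[OF that] const_poly_sum by metis
  qed
  ultimately have "[:coeff q i:] \<in> radical_of f" for i
    using tdeg_bound[of "coeff q i"] radical_of_sum by (metis finite_atMost)
  then have "(\<Sum>i\<le>degree q. [:coeff q i:] * tvar ^ i) \<in> radical_of f"
    by (intro radical_of_sum radical_of_mult K_lnd.power_closed tvar_closed) auto
  then show ?thesis using poly_expansion[of q] by metis
qed

text \<open>
  By hypothesis \<open>D\<close> preserves the central elements whose coefficients have no constant term. For homogeneous \<open>f\<close> of
  positive degree the last nonzero iterate of \<open>D\<close> on \<open>f\<close> therefore lies in the radical of \<open>f\<close>. It also lies in the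
  kernel of \<open>D\<close>, which then contains the divisor \<open>f\<close> of one of its powers.
\<close>

lemma D_center_zero:
  assumes pt: "\<And>z i. \<lbrakk>central z; z \<in> veronese_set d\<rbrakk> \<Longrightarrow> lookup (coeff (D [:z:]) i) 0 = 0"
    and z: "central z" "z \<in> veronese_set d"
  shows "D [:z:] = 0"
proof -
  have stable: "D P \<in> const_free" if "P \<in> PZ" "P \<in> const_free" for P
  proof -
    have "D [:coeff P i:] \<in> const_free" for i
      using that by (simp add: const_free_def PZ_def pt pcentral_def veronese_poly_def)
    moreover have "pderiv P \<in> const_free"
      using that(2) by (simp add: const_free_def coeff_pderiv lookup_mult_zero del: of_nat_Suc)
    ultimately show ?thesis
      using that(1) by (subst D_expansion) (auto simp: PZ_def intro!: const_free_add const_free_sum intro: const_free_mult)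
  qed
  have hom: "D [:f:] = 0" if f: "central f" "f \<in> veronese_set d" "f \<in> homogeneous n" "n > 0" for f n
  proof (rule ccontr)
    assume nz: "D [:f:] \<noteq> 0"
    then have "f \<noteq> 0" using K_lnd.D_zero by auto
    have fM: "[:f:] \<in> M" using f by (simp add: const_closed)
    have "lookup f 0 = 0"
      using f(4) hpart_of_homogeneous[OF f(3), of 0] lookup_hpart[of 0 f 0] by (simp add: tdeg_zero)
    then have f0: "[:f:] \<in> PZ" "[:f:] \<in> const_free"
      using f by (simp_all add: PZ_const const_free_const)
    obtain k where k: "(D ^^ k) [:f:] \<noteq> 0" "(D ^^ Suc k) [:f:] = 0"
      using K_lnd.last_nonzero[OF fM] \<open>f \<noteq> 0\<close> by auto
    define q where "q = (D ^^ k) [:f:]"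
    have "(D ^^ j) [:f:] \<in> PZ \<and> (D ^^ j) [:f:] \<in> const_free" for j
      using f0 by (induction j) (auto intro: PZ_D stable)
    then have "q \<in> radical_of f"
      unfolding q_def using center_in_radical_of[OF f(1,3) \<open>f \<noteq> 0\<close> f(2)] by blast
    then obtain L G where LG: "q \<in> M" "G \<in> M" "q ^ L = [:f:] * G"
      by (auto simp: radical_of_def)
    have "D q = 0" "q \<noteq> 0" using k by (simp_all add: q_def)
    then have "D (q ^ L) = 0" "q ^ L \<noteq> 0" using LG(1) by (simp_all add: K_lnd.D_power)
    then show False
      using K_lnd.kernel_factorially_closed[OF fM LG(2)] LG(3) nz by simp
  qed
  have hp: "D [:hpart m z:] = 0" for m
  proof (cases "m = 0")
    case True
    then show ?thesis by (simp add: hpart_zero_eq K_lnd.D_K)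
  next
    case False
    then show ?thesis
      using hom[of "hpart m z" m] z by (simp add: central_hpart veronese_set_hpart hpart_homogeneous)
  qed
  obtain N where N: "\<forall>e\<in>keys z. tdeg e \<le> N" by (rule tdeg_bound)
  have "[:z:] = (\<Sum>m\<le>N. [:hpart m z:])" using sum_hpart[OF N] const_poly_sum by metis
  also have "D \<dots> = (\<Sum>m\<le>N. D [:hpart m z:])"
    by (intro K_lnd.D_sum const_closed veronese_set_hpart z)
  finally show ?thesis by (simp add: hp)
qed

text \<open>
  On the centre \<open>D\<close> is now a multiple of \<open>d/dt\<close>, and \<open>D s = 1\<close> makes both \<open>D t\<close> and \<open>ds/dt\<close> units,
  that is, constants. So \<open>s\<close> has degree one in \<open>t\<close>; this gives injectivity, since no nonzero element of \<open>R\<close> is a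
  multiple of \<open>s\<close>. For surjectivity, \<open>\<pi>\<close> sends \<open>t\<close> to a central element \<open>w\<close> of \<open>R\<close> that it fixes, so
  \<open>t\<close> may be replaced by \<open>w\<close> in any argument of \<open>\<pi>\<close>.
\<close>

lemma kernel_iso_if_D_center_zero:
  assumes Dz: "\<And>z. \<lbrakk>central z; z \<in> veronese_set d\<rbrakk> \<Longrightarrow> D [:z:] = 0"
  shows "kernel_iso (\<lambda>r. \<pi> [:r:])"
proof -
  have "D s = pderiv s * D tvar"
    using PZ_s by (subst D_expansion) (auto simp: PZ_def pcentral_def veronese_poly_def intro!: sum.neutral Dz)
  then have ps: "pderiv s * D tvar = 1" by (simp add: D_s)
  then have "pderiv s dvd 1" "D tvar dvd 1" by (metis dvdI, metis dvdI mult.commute)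
  then obtain v u where vu: "pderiv s = [:v:]" "D tvar = [:u:]"
    using is_unit_iff_degree degree_eq_zeroE
    by (metis degree_0 is_unit_poly_iff)
  then have "v * u = 1" using ps by (simp add: one_pCons mult.commute)
  then obtain \<kappa> where \<kappa>: "u = const \<kappa>" "\<kappa> \<noteq> 0"
    using mpoly_unit_const[of u v] by (metis mult.commute)
  have "v \<noteq> 0" using \<open>v * u = 1\<close> by auto
  define z where "z = coeff s 0"
  have s_eq: "s = [:z, v:]"
  proof (rule poly_eqI)
    fix n
    have 1: "of_nat (Suc k) * coeff s (Suc k) = coeff [:v:] k" for k
      using vu(1) by (simp add: coeff_pderiv flip: vu(1) del: of_nat_Suc)
    show "coeff s n = coeff [:z, v:] n"
    proof (cases n)
      case (Suc k)
      show ?thesis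
        using 1[of k] Suc by (cases k) (simp_all del: of_nat_Suc add: K_lnd.of_nat_eq_zero_iff, simp)
    qed (simp add: z_def)
  qed
  have zZ: "central z" "z \<in> veronese_set d"
    using PZ_s by (auto simp: z_def PZ_def pcentral_def veronese_poly_def)
  \<comment> \<open>The value of \<open>\<pi>\<close> at \<open>t = w + \<kappa> s\<close>, as \<open>\<pi> s = 0\<close>.\<close>
  define w where "w = - (const \<kappa> * z)"
  have wZ: "central w" "w \<in> veronese_set d"
  proof -
    have w': "w = const (- \<kappa>) * z" by (simp add: w_def single_uminus)
    show "central w" "w \<in> veronese_set d"
      unfolding w' using zZ by (auto intro!: central_mult central_const veronese_set_mult veronese_set_const)
  qed
  have \<pi>w: "\<pi> [:w:] = [:w:]" using wZ Dz by (intro \<pi>_kernel const_closed) auto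
  have \<pi>t: "\<pi> tvar = [:w:]"
  proof -
    have "tvar = [:w:] + pconst \<kappa> * s"
      using \<open>v * u = 1\<close> \<kappa> by (simp add: s_eq w_def mult.commute)
    moreover have "\<pi> ([:w:] + pconst \<kappa> * s) = [:w:]"
      using wZ s_closed by (subst \<pi>_add)
        (auto simp: \<pi>_mult \<pi>w \<pi>_s const_closed K_lnd.K_closed K_lnd.mult_closed simp del: mult_pCons_left)
    ultimately show ?thesis by simp
  qed
  let ?h = "\<lambda>r. \<pi> [:r:]"
  have inj: "r = 0" if r: "r \<in> veronese_set d" "\<pi> [:r:] = 0" for r
  proof (rule ccontr)
    assume "r \<noteq> 0"
    have "\<exists>V\<in>M. [:r:] = \<pi> [:r:] + s * V" by (intro \<pi>_decomp const_closed r(1))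
    then obtain V where V: "[:r:] = s * V" using r(2) by auto
    then have "V \<noteq> 0" "s \<noteq> 0" using \<open>r \<noteq> 0\<close> by auto
    then have "degree [:r:] = degree s + degree V"
      using degree_mult_eq[of s V] unfolding V by blast
    then show False using \<open>v \<noteq> 0\<close> by (simp add: s_eq)
  qed
  have surj: "\<exists>r\<in>veronese_set d. b = \<pi> [:r:]" if b: "b \<in> M" "D b = 0" for b
  proof
    let ?n = "degree b"
    have wp: "w ^ i \<in> veronese_set d" for i
      using wZ veronese_set_const[of 1 d] by (induction i) (auto intro: veronese_set_mult)
    show r: "poly b w \<in> veronese_set d"
      using b wp by (auto simp: poly_altdef veronese_poly_def intro!: veronese_set_sum veronese_set_mult)
    have "b = \<pi> (\<Sum>i\<le>?n. [:coeff b i:] * tvar ^ i)"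
      using \<pi>_kernel[OF b] poly_expansion[of b] by metis
    also have "\<dots> = (\<Sum>i\<le>?n. \<pi> [:coeff b i:] * [:w:] ^ i)"
      using b by (simp only: \<pi>_sum \<pi>_mult \<pi>_power \<pi>t coeff_closed tvar_closed K_lnd.power_closed K_lnd.mult_closed)
    also have "\<dots> = \<pi> (\<Sum>i\<le>?n. [:coeff b i:] * [:w:] ^ i)"
      using b const_closed[OF wZ(2)] by (simp only: \<pi>_sum \<pi>_mult \<pi>_power \<pi>w coeff_closed K_lnd.power_closed K_lnd.mult_closed)
    also have "(\<Sum>i\<le>?n. [:coeff b i:] * [:w:] ^ i) = [:poly b w:]"
      by (simp add: poly_altdef poly_const_pow const_poly_sum mult.commute)
    finally show "b = \<pi> [:poly b w:]" .
  qed
  have add: "?h (x + y) = ?h x + ?h y" if "x \<in> veronese_set d" "y \<in> veronese_set d" for x y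
    using \<pi>_add[of "[:x:]" "[:y:]"] that by (simp add: const_closed)
  have mult: "?h (x * y) = ?h x * ?h y" if "x \<in> veronese_set d" "y \<in> veronese_set d" for x y
    using \<pi>_mult[of "[:x:]" "[:y:]"] that by (simp add: const_closed mult.commute)
  have brk: "?h (br x y) = pbr (?h x) (?h y)" if "x \<in> veronese_set d" "y \<in> veronese_set d" for x y
    using \<pi>_pbr[of "[:x:]" "[:y:]"] that by (simp add: const_closed pbr_const_const)
  have minus: "x - y \<in> veronese_set d" if "x \<in> veronese_set d" "y \<in> veronese_set d" for x y
  proof -
    have "x - y = x + const (-1) * y" by (simp add: single_uminus)
    then show ?thesis using that by (metis veronese_set_add veronese_set_mult veronese_set_const)
  qed
  have "inj_on ?h (veronese_set d)"
  proof (rule inj_onI)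
    fix x y assume xy: "x \<in> veronese_set d" "y \<in> veronese_set d" "?h x = ?h y"
    have "?h ((x - y) + y) = ?h (x - y) + ?h y" using xy minus by (intro add) auto
    then have "?h (x - y) = 0" using xy by simp
    then show "x = y" using inj[OF minus[OF xy(1,2)]] by simp
  qed
  moreover have "?h ` veronese_set d = {U \<in> M. D U = 0}"
    using surj by (auto simp: const_closed \<pi>_closed D_\<pi>)
  ultimately show ?thesis
    using add mult brk by (auto simp: kernel_iso_def bij_betw_def \<pi>_const)
qed

end

section \<open>A linear element in the Poisson centre\<close>

context split_extension
begin

text \<open>
  By \<open>point_derivation_linear_part\<close> the linear part of \<open>z0\<close> is not zero, so \<open>d = 1\<close>. The constant terms of a
  coefficient \<open>\<Delta>\<close> of \<open>D\<close> on the variables define the component \<open>\<delta>0\<close> of degree \<open>-1\<close> of \<open>\<Delta>\<close>. It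
  annihilates the brackets of the variables: on homogeneous parts of degree one, \<open>\<Delta>{x\<^sub>i, x\<^sub>j}\<close> is
  \<open>\<delta>0{x\<^sub>i, x\<^sub>j}\<close>, whereas \<open>{\<Delta>x\<^sub>i, x\<^sub>j} + {x\<^sub>i, \<Delta>x\<^sub>j}\<close> has no such part because
  the bracket is quadratic.
\<close>

lemma central_linear_slice:
  assumes z0: "central z0" "z0 \<in> veronese_set d" and nz: "lookup (coeff (D [:z0:]) i0) 0 \<noteq> 0"
  obtains \<delta> f where "d = 1" "locally_nilpotent_derivation const UNIV \<delta>" "\<delta> f = 1" "central f"
    "\<And>p q. \<delta> (br p q) = br (\<delta> p) q + br p (\<delta> q)"
proof -
  define \<Delta> where "\<Delta> p = coeff (D [:p:]) i0" for p
  have \<Delta>: "derivation_on const (veronese_set d) \<Delta>"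
    unfolding \<Delta>_def by (rule D_coeff_derivation)
  have "hpart 1 z0 \<noteq> 0"
    using point_derivation_linear_part[OF \<Delta> z0(2)] nz by (auto simp: \<Delta>_def)
  then have d1: "d = 1"
    using veronese_set_hpart_zero[OF z0(2), of 1] by auto
  have M: "M = UNIV" by (simp add: veronese_poly_def d1 veronese_set_1[unfolded One_nat_def])
  interpret \<Delta>: derivation_on const UNIV \<Delta>
    using \<Delta> by (simp add: d1 veronese_set_1[unfolded One_nat_def])
  have \<Delta>_chain: "\<Delta> p = (\<Sum>i\<in>UNIV. pd i p * \<Delta> (indet i))" for p
    by (rule derivation_chain_rule) (auto simp: \<Delta>.D_add \<Delta>.D_mult \<Delta>.D_K)
  define lam where "lam j = lookup (\<Delta> (indet j)) 0" for j
  define \<delta>0 where "\<delta>0 p = (\<Sum>j\<in>UNIV. pd j p * const (lam j))" for p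
  have \<delta>0_add: "\<delta>0 (p + q) = \<delta>0 p + \<delta>0 q" for p q
    by (simp add: \<delta>0_def pd_add distrib_right sum.distrib)
  have \<delta>0_mult: "\<delta>0 (p * q) = \<delta>0 p * q + p * \<delta>0 q" for p q
    by (simp add: \<delta>0_def pd_mult distrib_right distrib_left sum.distrib sum_distrib_left sum_distrib_right mult_ac)
  have \<delta>0_const: "\<delta>0 (const c) = 0" for c
    by (simp add: \<delta>0_def)
  have \<delta>0_zero: "\<delta>0 0 = 0" using \<delta>0_const[of 0] by simp
  have \<delta>0_hom: "\<delta>0 p \<in> homogeneous (m - 1)" if "p \<in> homogeneous m" for p m
    unfolding \<delta>0_def using that homogeneous_mult[OF pd_homogeneous[OF that] homogeneous_const]
    by (auto intro!: homogeneous_sum)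
  have lnd: "locally_nilpotent_derivation const UNIV \<delta>0"
    by unfold_locales
      (auto simp: const_add const_mult \<delta>0_add \<delta>0_mult \<delta>0_const intro!: degree_lowering_nilpotent \<delta>0_hom)
  have hpart_\<Delta>: "hpart (m - 1) (\<Delta> p) = \<delta>0 p" if "p \<in> homogeneous m" for p m
    by (subst \<Delta>_chain) (simp add: hpart_sum hpart_mult_homogeneous[OF pd_homogeneous[OF that]]
        hpart_zero_eq \<delta>0_def lam_def)
  define z1 where "z1 = hpart 1 z0"
  have "lookup (\<Delta> z0) 0 = lookup (\<Delta> z1) 0"
  proof -
    have "hpart 1 (z0 - z1) = hpart 1 z0 - hpart 1 z1"
      by (rule hpart_diff)
    also have "\<dots> = 0" by (simp add: z1_def hpart_of_homogeneous[OF hpart_homogeneous])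
    finally have "lookup (\<Delta> (z0 - z1)) 0 = 0"
      by (intro point_derivation_linear_part[OF \<Delta>]) (simp_all add: d1 veronese_set_1[unfolded One_nat_def])
    then show ?thesis by (simp add: \<Delta>.D_diff lookup_minus)
  qed
  then have e: "lookup (\<Delta> z1) 0 \<noteq> 0" (is "?e \<noteq> 0") using nz by (simp add: \<Delta>_def)
  have \<delta>0_z1: "\<delta>0 z1 = const ?e"
    using hpart_\<Delta>[of z1 1] by (simp add: z1_def hpart_homogeneous hpart_zero_eq)
  define f where "f = const (1 / ?e) * z1"
  have "\<delta>0 f = 1"
    using e by (simp add: f_def \<delta>0_mult \<delta>0_const \<delta>0_z1 mult_single)
  moreover have "central f"
    unfolding f_def z1_def by (intro central_mult central_const central_hpart z0)
  moreover have "\<delta>0 (br p q) = br (\<delta>0 p) q + br p (\<delta>0 q)" for p q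
  proof -
    define E where "E p q = \<delta>0 (br p q) - br (\<delta>0 p) q - br p (\<delta>0 q)" for p q
    have \<delta>0_indet: "\<delta>0 (indet i) = const (lam i)" for i
      by (simp add: \<delta>0_def pd_indet if_distrib if_distribR cong: if_cong)
    have E_indet: "E (indet i) (indet j) = 0" for i j
    proof -
      have "D [:br (indet i) (indet j):] = pbr (D [:indet i:]) [:indet j:] + pbr [:indet i:] (D [:indet j:])"
        using D_pbr[of "[:indet i:]" "[:indet j:]"] by (simp add: M pbr_const_const)
      moreover have "pbr [:indet i:] (D [:indet j:]) = - pbr (D [:indet j:]) [:indet i:]"
        by (rule pbr_skew)
      ultimately have "\<Delta> (br (indet i) (indet j)) = br (\<Delta> (indet i)) (indet j) - br (\<Delta> (indet j)) (indet i)"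
        by (simp add: \<Delta>_def pbr_const_right)
      moreover have "hpart 1 (br p (indet j)) = 0" for p j
        by (subst br_chain_left) (simp add: hpart_sum mult.commute[of "pd _ _"]
            hpart_mult_homogeneous[OF br_indet])
      ultimately have "hpart (2 - 1) (\<Delta> (br (indet i) (indet j))) = 0"
        by (simp add: hpart_diff)
      then have "\<delta>0 (br (indet i) (indet j)) = 0"
        using hpart_\<Delta>[OF br_indet] by simp
      then show ?thesis
        by (simp add: E_def \<delta>0_indet br_const_left br_const_right)
    qed
    have E_left: "E p q = (\<Sum>i\<in>UNIV. pd i p * E (indet i) q)" for p q
      by (rule derivation_chain_rule[of "\<lambda>p. E p q"])
        (simp_all add: E_def br_add_left br_mult_left br_const_left \<delta>0_add \<delta>0_mult \<delta>0_const \<delta>0_zero algebra_simps)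
    have E_right: "E (indet i) q = (\<Sum>j\<in>UNIV. pd j q * E (indet i) (indet j))" for i q
      by (rule derivation_chain_rule)
        (simp_all add: E_def br_add_right br_mult_right br_const_right \<delta>0_add \<delta>0_mult \<delta>0_const \<delta>0_zero algebra_simps)
    have "E (indet i) q = 0" for i q by (subst E_right) (simp add: E_indet)
    then have "E p q = 0" for p q by (subst E_left) simp
    then show ?thesis by (simp add: E_def algebra_simps)
  qed
  ultimately show thesis using that[OF d1 lnd] by blast
qed

end

section \<open>The derivation on the plane of central elements\<close>

text \<open>
  The situation of a central linear form \<open>f\<close> with \<open>\<delta> f = 1\<close>. Here \<open>A\<close> is a polynomial ring in \<open>f\<close> over the
  kernel of \<open>\<delta>\<close>, and \<open>\<delta>\<close> and \<open>d/dt\<close> act as the partial derivatives on the plane \<open>k[f, t]\<close>, the centre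
  of \<open>A[t]\<close>.
\<close>

locale central_slice = split_extension br d D s \<pi> +
  dl: locally_nilpotent_derivation "const :: 'k \<Rightarrow> (3, 'k) mpoly" UNIV \<delta>
  for br :: "(3, 'k::field_char_0) mpoly \<Rightarrow> (3, 'k) mpoly \<Rightarrow> (3, 'k) mpoly" and d D s \<pi> \<delta> +
  fixes f
  assumes d_eq: "d = 1" and \<delta>_f: "\<delta> f = 1" and f_central: "central f"
    and \<delta>_br: "\<delta> (br p q) = br (\<delta> p) q + br p (\<delta> q)"
begin

lemma veronese_UNIV: "veronese_set d = UNIV"
  unfolding d_eq by (rule veronese_set_1)

lemma M_UNIV: "M = UNIV"
  by (simp add: veronese_poly_def veronese_UNIV)

definition \<delta>t :: "(3, 'k) mpoly poly \<Rightarrow> (3, 'k) mpoly poly"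
  where "\<delta>t = map_poly \<delta>"

lemma coeff_\<delta>t: "coeff (\<delta>t P) i = \<delta> (coeff P i)"
  by (simp add: \<delta>t_def coeff_map_poly dl.D_zero)

lemma \<delta>t_const: "\<delta>t [:a:] = [:\<delta> a:]"
  by (rule poly_eqI) (simp add: coeff_\<delta>t coeff_pCons dl.D_zero split: nat.splits)

lemma \<delta>t_tvar: "\<delta>t tvar = 0"
  by (rule poly_eqI) (simp add: coeff_\<delta>t coeff_pCons dl.D_zero dl.D_one split: nat.splits)

lemma coeff_funpow_\<delta>t: "coeff ((\<delta>t ^^ n) P) i = (\<delta> ^^ n) (coeff P i)"
  by (induction n) (simp_all add: coeff_\<delta>t)

sublocale dt: locally_nilpotent_derivation "pconst :: 'k \<Rightarrow> (3, 'k) mpoly poly" UNIV \<delta>t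
proof unfold_locales
  fix P Q :: "(3, 'k) mpoly poly"
  show "\<delta>t (P + Q) = \<delta>t P + \<delta>t Q"
    by (rule poly_eqI) (simp add: coeff_\<delta>t dl.D_add)
  show "\<delta>t (P * Q) = \<delta>t P * Q + P * \<delta>t Q"
    by (rule poly_eqI) (simp add: coeff_\<delta>t coeff_mult dl.D_sum dl.D_mult sum.distrib)
  show "\<exists>n. (\<delta>t ^^ n) P = 0"
  proof -
    have "\<forall>i. \<exists>n. (\<delta> ^^ n) (coeff P i) = 0"
      using dl.nilpotent by blast
    then obtain n where n: "\<And>i. (\<delta> ^^ n i) (coeff P i) = 0" by metis
    define N where "N = Max (n ` {..degree P})"
    have "(\<delta>t ^^ N) P = 0"
    proof (rule poly_eqI)
      fix i
      show "coeff ((\<delta>t ^^ N) P) i = coeff 0 i"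
      proof (cases "i \<le> degree P")
        case True
        then have "n i \<le> N" by (simp add: N_def)
        then show ?thesis using dl.funpow_zero_mono[OF n] by (simp add: coeff_funpow_\<delta>t)
      qed (simp add: coeff_funpow_\<delta>t coeff_eq_0 dl.funpow_zero)
    qed
    then show ?thesis by blast
  qed
qed (simp_all add: K_lnd.K_add K_lnd.K_mult K_lnd.K_one \<delta>t_const dl.D_K)

sublocale pt: locally_nilpotent_derivation "pconst :: 'k \<Rightarrow> (3, 'k) mpoly poly" UNIV pderiv
proof unfold_locales
  fix P :: "(3, 'k) mpoly poly"
  have "\<exists>n. (pderiv ^^ n) P = 0" if "degree P \<le> k" for k
    using that
  proof (induction k arbitrary: P)
    case 0
    then have "pderiv P = 0" by (simp add: pderiv_eq_0_iff)
    then have "(pderiv ^^ 1) P = 0" by simp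
    then show ?case by blast
  next
    case (Suc k)
    then have "degree (pderiv P) \<le> k" by (simp add: degree_pderiv)
    then obtain n where "(pderiv ^^ n) (pderiv P) = 0" using Suc.IH by blast
    then have "(pderiv ^^ Suc n) P = 0" by (simp add: funpow_swap1)
    then show ?case by blast
  qed
  then show "\<exists>n. (pderiv ^^ n) P = 0" by blast
qed (simp_all add: K_lnd.K_add K_lnd.K_mult K_lnd.K_one pderiv_add pderiv_mult)

lemma \<delta>t_pderiv: "\<delta>t (pderiv P) = pderiv (\<delta>t P)"
proof (rule poly_eqI)
  fix n
  have "\<delta> (of_nat (Suc n) * coeff P (Suc n)) = of_nat (Suc n) * \<delta> (coeff P (Suc n))"
    using dl.D_smult[of "coeff P (Suc n)" "of_nat (Suc n)"] by (simp only: dl.K_of_nat UNIV_I)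
  then show "coeff (\<delta>t (pderiv P)) n = coeff (pderiv (\<delta>t P)) n"
    by (simp add: coeff_\<delta>t coeff_pderiv del: of_nat_Suc)
qed

lemma central_\<delta>: "central z \<Longrightarrow> central (\<delta> z)"
  using \<delta>_br[of z] by (simp add: central_def dl.D_zero)

lemma central_of_nat_mult: "central z \<Longrightarrow> central (of_nat n * z)"
  using central_mult[OF central_const[of "of_nat n"], of z] by simp

lemma PZ_\<delta>t: "P \<in> PZ \<Longrightarrow> \<delta>t P \<in> PZ"
  by (simp add: PZ_def M_UNIV pcentral_def coeff_\<delta>t central_\<delta>)

lemma PZ_pderiv: "P \<in> PZ \<Longrightarrow> pderiv P \<in> PZ"
  by (simp add: PZ_def M_UNIV pcentral_def coeff_pderiv central_of_nat_mult del: of_nat_Suc)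

lemma PZ_f: "[:f:] \<in> PZ"
  by (simp add: PZ_const f_central veronese_UNIV)

text \<open>
  By \<open>derivation_parallel\<close> with \<open>f\<close>, every partial derivative of \<open>z\<close> vanishes.
\<close>

lemma central_kernel_const:
  assumes "central z" "\<delta> z = 0"
  shows "\<exists>c. z = const c"
proof -
  have "pd i z = 0" for i
    using derivation_parallel[OF locally_nilpotent_derivation.axioms(1)[OF pd_locally_nilpotent]
        dl.derivation_on_axioms assms(1) f_central, of i] assms(2)
    by (simp add: \<delta>_f)
  then show ?thesis using pd_eq_zero_imp_const by blast
qed

lemma D_center:
  assumes "central z" shows "D [:z:] = [:\<delta> z:] * D [:f:]"
proof (rule poly_eqI)
  fix i
  have "derivation_on const UNIV (\<lambda>p. coeff (D [:p:]) i)"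
    using D_coeff_derivation[of i] by (simp add: veronese_UNIV)
  from derivation_parallel[OF this dl.derivation_on_axioms assms f_central]
  show "coeff (D [:z:]) i = coeff ([:\<delta> z:] * D [:f:]) i"
    by (simp add: \<delta>_f)
qed

text \<open>
  The chain rule in the coordinates \<open>f\<close> and \<open>t\<close> of the plane.
\<close>

lemma D_PZ:
  assumes "P \<in> PZ"
  shows "D P = \<delta>t P * D [:f:] + pderiv P * D tvar"
proof -
  have "(\<Sum>i\<le>degree P. [:\<delta> (coeff P i):] * tvar ^ i) = \<delta>t P"
  proof -
    have "degree (\<delta>t P) \<le> degree P"
      by (intro degree_le) (simp add: coeff_\<delta>t coeff_eq_0 dl.D_zero)
    from poly_as_sum_of_monoms'[OF this] show ?thesis
      by (simp only: monom_eq_const_mult_power coeff_\<delta>t)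
  qed
  moreover have Dc: "D [:coeff P i:] = [:\<delta> (coeff P i):] * D [:f:]" for i
    using assms by (intro D_center) (simp add: PZ_def pcentral_def)
  moreover have "(\<Sum>i\<le>degree P. D [:coeff P i:] * tvar ^ i) =
      (\<Sum>i\<le>degree P. [:\<delta> (coeff P i):] * tvar ^ i) * D [:f:]"
    unfolding sum_distrib_right
    by (intro sum.cong refl) (simp only: Dc mult.assoc mult.commute[of "D [:f:]"])
  ultimately show ?thesis
    using D_expansion[of P] by (simp only: M_UNIV UNIV_I simp_thms)
qed

lemma PZ_closed: "locally_nilpotent_derivation pconst PZ D"
  by (rule K_lnd.restrict) (auto simp: PZ_def[THEN equalityD1] intro: PZ_pconst PZ_add PZ_mult PZ_D, simp add: PZ_def)

sublocale Z: locally_nilpotent_derivation "pconst :: 'k \<Rightarrow> (3, 'k) mpoly poly" PZ D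
  by (rule PZ_closed)

sublocale Zdt: locally_nilpotent_derivation "pconst :: 'k \<Rightarrow> (3, 'k) mpoly poly" PZ \<delta>t
  by (rule dt.restrict) (auto intro: PZ_pconst PZ_add PZ_mult PZ_\<delta>t)

text \<open>
  The Jacobian determinant in the coordinates \<open>f\<close> and \<open>t\<close>.
\<close>

definition Jac :: "(3, 'k) mpoly poly \<Rightarrow> (3, 'k) mpoly poly \<Rightarrow> (3, 'k) mpoly poly"
  where "Jac P Q = \<delta>t P * pderiv Q - pderiv P * \<delta>t Q"

definition divergence :: "(3, 'k) mpoly poly"
  where "divergence = \<delta>t (D [:f:]) + pderiv (D tvar)"

lemma Jac_add: "Jac (P + Q) R = Jac P R + Jac Q R"
  by (simp add: Jac_def dt.D_add pderiv_add algebra_simps)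

lemma Jac_mult: "Jac (P * Q) R = Jac P R * Q + P * Jac Q R"
  by (simp add: Jac_def dt.D_mult pderiv_mult algebra_simps)

lemma Jac_const: "Jac (pconst c) R = 0"
  by (simp add: Jac_def dt.D_K)

text \<open>
  The infinitesimal change of an area form under a vector field is its divergence: in general
  \<open>D (Jac c s) = Jac (D c) s + Jac c (D s) - divergence * Jac c s\<close>, and here \<open>D c\<close> and \<open>D s\<close> are constants.
\<close>

lemma D_Jac:
  assumes c: "c \<in> PZ" "D c = 0"
  shows "D (Jac c s) = - divergence * Jac c s"
proof -
  let ?\<alpha> = "D [:f:]" and ?\<beta> = "D tvar"
  have D\<delta>: "D (\<delta>t w) = \<delta>t (D w) - (\<delta>t w * \<delta>t ?\<alpha> + pderiv w * \<delta>t ?\<beta>)" if "w \<in> PZ" for w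
    using D_PZ[OF that] D_PZ[OF PZ_\<delta>t[OF that]]
    by (simp add: dt.D_add dt.D_mult \<delta>t_pderiv)
  have Dp: "D (pderiv w) = pderiv (D w) - (\<delta>t w * pderiv ?\<alpha> + pderiv w * pderiv ?\<beta>)" if "w \<in> PZ" for w
    using D_PZ[OF that] D_PZ[OF PZ_pderiv[OF that]]
    by (simp add: pderiv_add pderiv_mult \<delta>t_pderiv)
  have "D (Jac c s) = (D (\<delta>t c) * pderiv s + \<delta>t c * D (pderiv s)) -
      (D (pderiv c) * \<delta>t s + pderiv c * D (\<delta>t s))"
    unfolding Jac_def
    by (simp only: Z.D_diff Z.D_mult Z.mult_closed PZ_\<delta>t PZ_pderiv c(1) PZ_s)
  also have "\<dots> = - divergence * Jac c s"
    unfolding D\<delta>[OF c(1)] D\<delta>[OF PZ_s] Dp[OF c(1)] Dp[OF PZ_s] c(2) D_s Jac_def divergence_def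
    by (simp add: dt.D_zero dt.D_one algebra_simps)
  finally show ?thesis .
qed

text \<open>
  If the divergence were not zero, then every \<open>Jac c s\<close> with \<open>c\<close> in the kernel would divide its own derivative and hence
  vanish. As the plane is generated by \<open>s\<close> over the kernel, \<open>Jac w s\<close> would vanish for all \<open>w\<close>, in particular for
  \<open>f\<close> and \<open>t\<close>, and \<open>s\<close> would be constant.
\<close>

lemma divergence_zero: "divergence = 0"
proof (rule ccontr)
  assume nz: "divergence \<noteq> 0"
  have J0: "Jac c s = 0" if "c \<in> PZ" "D c = 0" for c
  proof -
    have J: "Jac c s \<in> PZ" "- divergence \<in> PZ"
      using that unfolding Jac_def divergence_def
      by (auto intro!: Z.diff_closed Z.uminus_closed Z.mult_closed Z.add_closed PZ_\<delta>t PZ_pderiv PZ_s PZ_D PZ_f PZ_tvar)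
    have "D (Jac c s) = 0"
      using D_Jac[OF that] by (intro Z.derivative_multiple_imp_zero[OF J]) (simp add: mult.commute)
    then show ?thesis using D_Jac[OF that] nz by simp
  qed
  have "Jac w s = 0" if "w \<in> PZ" for w
    using PZ_s D_s J0 _ _ that
  proof (rule Z.slice_induct)
    fix x y assume "Jac x s = 0" "Jac y s = 0"
    then show "Jac (x + y) s = 0" by (simp add: Jac_add)
  next
    fix c x assume "Jac x s = 0"
    moreover have "Jac s s = 0" by (simp add: Jac_def mult.commute)
    ultimately show "Jac (pconst c * (s * x)) s = 0"
      by (simp only: Jac_mult Jac_const) simp
  qed
  from this[OF PZ_f] this[OF PZ_tvar] have "pderiv s = 0" "\<delta>t s = 0"
    by (simp_all add: Jac_def \<delta>t_const \<delta>t_tvar \<delta>_f pderiv_pCons)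
  then show False using D_PZ[OF PZ_s] D_s by simp
qed

text \<open>
  A vector field on the plane with zero divergence is Hamiltonian: integrate in the direction of \<open>f\<close>, then correct by an
  antiderivative in \<open>t\<close> of the remaining function of \<open>t\<close> alone.
\<close>

lemma D_hamiltonian:
  obtains p where "p \<in> PZ" "\<delta>t p = D tvar" "pderiv p = - D [:f:]"
proof -
  obtain p0 where p0: "p0 \<in> PZ" "\<delta>t p0 = D tvar"
    using Zdt.surjective_if_slice[OF PZ_f _ PZ_D[OF PZ_tvar]] by (auto simp: \<delta>t_const \<delta>_f one_pCons)
  define g where "g = pderiv p0 + D [:f:]"
  let ?W = "{w \<in> PZ. \<delta>t w = 0}"
  have W: "locally_nilpotent_derivation pconst ?W pderiv"
    by (rule pt.restrict)
      (auto intro: PZ_pconst PZ_add PZ_mult PZ_pderiv simp: dt.D_K dt.D_add dt.D_mult \<delta>t_pderiv)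
  have g: "g \<in> ?W"
    using p0 divergence_zero PZ_D[OF PZ_f] PZ_pderiv[OF p0(1)]
    by (simp add: g_def dt.D_add \<delta>t_pderiv divergence_def PZ_add add.commute)
  have "tvar \<in> ?W" "pderiv tvar = (1 :: (3, 'k) mpoly poly)"
    by (simp_all add: PZ_tvar \<delta>t_tvar pderiv_pCons)
  then obtain g1 where g1: "g1 \<in> ?W" "pderiv g1 = g"
    using locally_nilpotent_derivation.surjective_if_slice[OF W _ _ g] by blast
  show thesis
  proof (rule that[of "p0 - g1"])
    show "p0 - g1 \<in> PZ" using p0 g1 Z.diff_closed by auto
    show "\<delta>t (p0 - g1) = D tvar" using p0 g1 by (simp add: dt.D_diff)
    show "pderiv (p0 - g1) = - D [:f:]" using g1 by (simp add: pderiv_diff g_def)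
  qed
qed

end

text \<open>
  On the plane \<open>D\<close> is now \<open>Jac p\<close>. Together with \<open>nabla = Jac _ s\<close> it plays the role of the pair of partial
  derivatives in the coordinates \<open>s\<close> and \<open>p\<close>.
\<close>

locale hamiltonian_slice = central_slice br d D s \<pi> \<delta> f
  for br :: "(3, 'k::field_char_0) mpoly \<Rightarrow> (3, 'k) mpoly \<Rightarrow> (3, 'k) mpoly" and d D s \<pi> \<delta> f +
  fixes p
  assumes p_PZ: "p \<in> PZ" and \<delta>t_p: "\<delta>t p = D tvar" and pderiv_p: "pderiv p = - D [:f:]"
begin

lemma D_p: "D p = 0"
  using D_PZ[OF p_PZ] by (simp add: \<delta>t_p pderiv_p mult.commute)

lemma pM: "p \<in> M" by (simp add: M_UNIV)

abbreviation nabla :: "(3, 'k) mpoly poly \<Rightarrow> (3, 'k) mpoly poly"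
  where "nabla c \<equiv> Jac c s"

lemma nabla_p: "nabla p = 1"
  using D_PZ[OF PZ_s] D_s by (simp add: Jac_def \<delta>t_p pderiv_p mult.commute add.commute)

text \<open>
  The kernel of \<open>D\<close> on the plane. It turns out to be \<open>k[p]\<close>.
\<close>

definition C :: "(3, 'k) mpoly poly set"
  where "C = {c \<in> PZ. D c = 0}"

text \<open>
  On the kernel of \<open>D\<close> every differential is a multiple of the differential of \<open>p\<close>, by Cramer's rule with
  \<open>Jac p s = 1\<close>; the factor is \<open>nabla c\<close>.
\<close>

lemma nabla_C:
  assumes "c \<in> C"
  shows "nabla c * pderiv p = pderiv c" "nabla c * \<delta>t p = \<delta>t c"
proof -
  have c: "c \<in> PZ" "D c = 0" using assms by (auto simp: C_def)
  have E: "\<delta>t c * pderiv p = pderiv c * \<delta>t p"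
    using D_PZ[OF c(1)] c(2) by (simp add: \<delta>t_p pderiv_p eq_neg_iff_add_eq_0 add.commute flip: minus_mult_right)
      (simp add: add_eq_0_iff)
  have N: "\<delta>t p * pderiv s - pderiv p * \<delta>t s = 1"
    using nabla_p by (simp add: Jac_def)
  have "nabla c * pderiv p = (\<delta>t c * pderiv p) * pderiv s - pderiv c * (pderiv p * \<delta>t s)"
    by (simp add: Jac_def algebra_simps)
  also have "\<dots> = pderiv c * (\<delta>t p * pderiv s - pderiv p * \<delta>t s)"
    unfolding E by (simp add: algebra_simps)
  finally show "nabla c * pderiv p = pderiv c" by (simp add: N)
  have "nabla c * \<delta>t p = \<delta>t c * (\<delta>t p * pderiv s) - (pderiv c * \<delta>t p) * \<delta>t s"
    by (simp add: Jac_def algebra_simps)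
  also have "\<dots> = \<delta>t c * (\<delta>t p * pderiv s - pderiv p * \<delta>t s)"
    unfolding E[symmetric] by (simp add: algebra_simps)
  finally show "nabla c * \<delta>t p = \<delta>t c" by (simp add: N)
qed

lemma C_closed: "c \<in> C \<Longrightarrow> nabla c \<in> C"
  using D_Jac[of c] PZ_s unfolding C_def
  by (auto simp: divergence_zero Jac_def intro!: Z.diff_closed Z.mult_closed PZ_\<delta>t PZ_pderiv)

text \<open>
  If \<open>p\<close> involves \<open>t\<close>, then \<open>nabla c\<close> divides the derivative of \<open>c\<close> in \<open>t\<close>, so that \<open>nabla\<close> lowers the
  degree in \<open>t\<close>. Otherwise \<open>Jac p s = 1\<close> makes \<open>\<delta> p\<close> a constant, and \<open>nabla\<close> is a multiple of \<open>\<delta>\<close>.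
\<close>

lemma nabla_nilpotent:
  assumes "c \<in> C"
  shows "\<exists>n. (nabla ^^ n) c = 0"
proof (cases "pderiv p = 0")
  case True
  have "\<delta>t p * pderiv s = 1" using nabla_p True by (simp add: Jac_def)
  then obtain \<kappa> where \<kappa>: "\<delta>t p = pconst \<kappa>" "\<kappa> \<noteq> 0" by (rule mpoly_poly_unit_const)
  have step: "nabla c = pconst (1 / \<kappa>) * \<delta>t c" if "c \<in> C" for c
  proof -
    have "pconst (1 / \<kappa>) * \<delta>t c = (pconst \<kappa> * pconst (1 / \<kappa>)) * nabla c"
      unfolding nabla_C(2)[OF that, symmetric] \<kappa> by (simp only: mult_ac)
    also have "pconst \<kappa> * pconst (1 / \<kappa>) = 1"
      using \<kappa>(2) by (simp add: mult_single one_pCons)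
    finally show ?thesis by simp
  qed
  have "(nabla ^^ n) c = pconst ((1 / \<kappa>) ^ n) * (\<delta>t ^^ n) c \<and> (nabla ^^ n) c \<in> C" for n
  proof (induction n)
    case 0
    then show ?case using assms K_lnd.K_one by simp
  next
    case (Suc n)
    have "(nabla ^^ Suc n) c = pconst (1 / \<kappa>) * \<delta>t ((nabla ^^ n) c)"
      by (simp only: funpow.simps comp_apply step[OF conjunct2[OF Suc.IH]])
    also have "\<dots> = pconst (1 / \<kappa>) * (pconst ((1 / \<kappa>) ^ n) * \<delta>t ((\<delta>t ^^ n) c))"
      using Suc by (metis UNIV_I dt.D_smult)
    also have "\<dots> = pconst ((1 / \<kappa>) ^ Suc n) * (\<delta>t ^^ Suc n) c"
      using K_lnd.K_mult[of "1 / \<kappa>" "(1 / \<kappa>) ^ n"] by (simp only: power_Suc mult.assoc funpow.simps comp_apply)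
    finally show ?case using C_closed[OF conjunct2[OF Suc.IH]] by (simp only: funpow.simps comp_apply simp_thms)
  qed
  moreover obtain n where "(\<delta>t ^^ n) c = 0" using dt.nilpotent by blast
  ultimately have "(nabla ^^ n) c = 0" by simp
  then show ?thesis by blast
next
  case False
  show ?thesis
    using assms
  proof (induction "degree c" arbitrary: c rule: less_induct)
    case less
    show ?case
    proof (cases "nabla c = 0")
      case True
      then have "(nabla ^^ 1) c = 0" by simp
      then show ?thesis by blast
    next
      case nz: False
      have eq: "pderiv c = nabla c * pderiv p" using nabla_C(1)[OF less.prems] by simp
      then have "pderiv c \<noteq> 0" using nz False by simp
      then have "degree c > 0" by (simp add: pderiv_eq_0_iff)
      moreover have "degree (nabla c) \<le> degree (pderiv c)"
        unfolding eq using nz False by (simp add: degree_mult_eq)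
      ultimately have "degree (nabla c) < degree c"
        by (simp add: degree_pderiv)
      then obtain n where "(nabla ^^ n) (nabla c) = 0"
        using less.hyps C_closed[OF less.prems] by blast
      then have "(nabla ^^ Suc n) c = 0" by (simp only: funpow_Suc_right comp_apply)
      then show ?thesis by blast
    qed
  qed
qed

lemma C_lnd: "locally_nilpotent_derivation pconst C nabla"
proof unfold_locales
  show "x \<in> C \<Longrightarrow> \<exists>n. (nabla ^^ n) x = 0" for x by (rule nabla_nilpotent)
  show "nabla (x * y) = nabla x * y + x * nabla y" for x y by (rule Jac_mult)
  show "x \<in> C \<Longrightarrow> nabla x \<in> C" for x by (rule C_closed)
qed (auto simp: C_def K_lnd.K_add K_lnd.K_mult K_lnd.K_one Jac_add Jac_const PZ_pconst Z.D_K
    Z.add_closed Z.mult_closed Z.D_add Z.D_mult)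

sublocale C: locally_nilpotent_derivation pconst C nabla
  by (rule C_lnd)

lemma nabla_kernel:
  assumes c: "c \<in> C" "nabla c = 0"
  shows "\<exists>k. c = pconst k"
proof -
  have "pderiv c = 0" "\<delta>t c = 0" using nabla_C[OF c(1)] c(2) by simp_all
  then obtain z where z: "c = [:z:]" using pderiv_iszero by blast
  then have "\<delta> z = 0" using \<open>\<delta>t c = 0\<close> by (simp add: \<delta>t_const)
  moreover have "central z" using c(1) by (simp add: C_def z PZ_const)
  ultimately show ?thesis using central_kernel_const z by blast
qed

text \<open>
  The Taylor expansion \<open>exp (t \<delta>)\<close>.
\<close>

definition exp_t :: "(3, 'k) mpoly \<Rightarrow> (3, 'k) mpoly poly"
  where "exp_t a = Abs_poly (\<lambda>j. const (1 / fact j) * (\<delta> ^^ j) a)"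

lemma coeff_exp_t: "coeff (exp_t a) j = const (1 / fact j) * (\<delta> ^^ j) a"
proof -
  obtain n where n: "(\<delta> ^^ n) a = 0" using dl.nilpotent by blast
  show ?thesis unfolding exp_t_def
    by (subst coeff_Abs_poly[of n]) (auto simp: dl.funpow_zero_mono[OF n])
qed

lemma pderiv_exp_t: "pderiv (exp_t a) = \<delta>t (exp_t a)"
proof (rule poly_eqI)
  fix n
  have "of_nat (Suc n) * const (1 / fact (Suc n)) = (const (1 / fact n) :: (3, 'k) mpoly)"
  proof -
    have "of_nat (Suc n) * const (1 / fact (Suc n)) =
        (const (of_nat (Suc n) * (1 / fact (Suc n))) :: (3, 'k) mpoly)"
      by (simp only: const_mult single_of_nat)
    moreover have "of_nat (Suc n) * (1 / fact (Suc n)) = (1 / fact n :: 'k)"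
      by (simp add: divide_simps del: of_nat_Suc)
    ultimately show ?thesis by simp
  qed
  then show "coeff (pderiv (exp_t a)) n = coeff (\<delta>t (exp_t a)) n"
    by (simp add: coeff_pderiv coeff_\<delta>t coeff_exp_t dl.D_smult del: of_nat_Suc flip: mult.assoc)
qed

text \<open>
  \<open>exp_t a\<close> solves the linear differential equation \<open>dP/dt = \<delta> P\<close> with initial value \<open>a\<close>. Uniqueness of the
  solution yields all algebraic properties of \<open>exp_t\<close> from the product rules for \<open>\<delta>\<close> and \<open>d/dt\<close>.
\<close>

lemma exp_t_unique:
  assumes "pderiv P = \<delta>t P" "coeff P 0 = a"
  shows "P = exp_t a"
proof (rule poly_eqI)
  fix n
  show "coeff P n = coeff (exp_t a) n"
  proof (induction n)
    case 0
    then show ?case using assms(2) by (simp add: coeff_exp_t)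
  next
    case (Suc n)
    have "of_nat (Suc n) * coeff P (Suc n) = \<delta> (coeff P n)"
      using assms(1) by (metis coeff_\<delta>t coeff_pderiv)
    moreover have "of_nat (Suc n) * coeff (exp_t a) (Suc n) = \<delta> (coeff (exp_t a) n)"
      using pderiv_exp_t by (metis coeff_\<delta>t coeff_pderiv)
    ultimately have "of_nat (Suc n) * coeff P (Suc n) = of_nat (Suc n) * coeff (exp_t a) (Suc n)"
      using Suc by simp
    then show ?case using dl.of_nat_eq_zero_iff[of "Suc n"] by (simp del: of_nat_Suc)
  qed
qed

lemma \<delta>t_pbr: "\<delta>t (pbr P Q) = pbr (\<delta>t P) Q + pbr P (\<delta>t Q)"
  by (rule poly_eqI) (simp add: coeff_\<delta>t coeff_pbr dl.D_sum \<delta>_br sum.distrib)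

lemma coeff_exp_t_0: "coeff (exp_t a) 0 = a"
  by (simp add: coeff_exp_t)

lemma exp_t_add: "exp_t (a + b) = exp_t a + exp_t b"
  by (rule exp_t_unique[symmetric]) (simp_all add: pderiv_add dt.D_add pderiv_exp_t coeff_exp_t_0)

lemma exp_t_mult: "exp_t (a * b) = exp_t a * exp_t b"
  by (rule exp_t_unique[symmetric])
    (simp_all add: pderiv_mult dt.D_mult pderiv_exp_t coeff_exp_t_0 coeff_mult mult.commute)

lemma exp_t_br: "exp_t (br a b) = pbr (exp_t a) (exp_t b)"
  by (rule exp_t_unique[symmetric])
    (simp_all add: pderiv_pbr \<delta>t_pbr pderiv_exp_t coeff_exp_t_0 coeff_pbr)

lemma exp_t_kernel: "\<delta> a = 0 \<Longrightarrow> exp_t a = [:a:]"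
  by (rule exp_t_unique[symmetric]) (simp_all add: \<delta>t_const)

lemma exp_t_f: "exp_t f = [:f, 1:]"
proof (rule exp_t_unique[symmetric])
  have "[:f, 1:] = [:f:] + tvar" by simp
  then have "\<delta>t [:f, 1:] = \<delta>t [:f:] + \<delta>t tvar" by (simp only: dt.D_add UNIV_I)
  then show "pderiv [:f, 1:] = \<delta>t [:f, 1:]" by (simp add: \<delta>t_const \<delta>t_tvar \<delta>_f pderiv_pCons)
qed simp

lemma \<delta>t_exp_t: "\<delta>t (exp_t a) = exp_t (\<delta> a)"
proof (rule exp_t_unique)
  show "pderiv (\<delta>t (exp_t a)) = \<delta>t (\<delta>t (exp_t a))"
    by (simp add: pderiv_exp_t flip: \<delta>t_pderiv)
qed (simp add: coeff_\<delta>t coeff_exp_t_0)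

text \<open>
  The substitution \<open>exp ((p - f) \<delta>)\<close>. It fixes the kernel of \<open>\<delta>\<close> and sends \<open>f\<close> to \<open>p\<close>.
\<close>

definition \<theta> :: "(3, 'k) mpoly \<Rightarrow> (3, 'k) mpoly poly"
  where "\<theta> a = pcompose (exp_t a) (p - [:f:])"

lemma u_PZ: "p - [:f:] \<in> PZ"
  by (intro Z.diff_closed p_PZ PZ_f)

lemma \<theta>_add: "\<theta> (a + b) = \<theta> a + \<theta> b"
  by (simp add: \<theta>_def exp_t_add pcompose_add)

lemma \<theta>_mult: "\<theta> (a * b) = \<theta> a * \<theta> b"
  by (simp add: \<theta>_def exp_t_mult pcompose_mult)

lemma \<theta>_br: "\<theta> (br a b) = pbr (\<theta> a) (\<theta> b)"
  using u_PZ by (simp add: \<theta>_def exp_t_br pbr_pcompose PZ_def)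

lemma \<theta>_kernel: "\<delta> a = 0 \<Longrightarrow> \<theta> a = [:a:]"
  by (simp add: \<theta>_def exp_t_kernel pcompose_pCons)

lemma \<theta>_f: "\<theta> f = p"
  by (simp add: \<theta>_def exp_t_f pcompose_pCons)

lemma nabla_pcompose:
  "nabla (pcompose P u) = pcompose (\<delta>t P) u * pderiv s + pcompose (pderiv P) u * nabla u"
proof (induction P rule: poly_monom_induct)
  case (1 a i)
  have pw: "nabla (u ^ i) = of_nat i * u ^ (i - 1) * nabla u"
  proof (induction i)
    case 0
    then show ?case using Jac_const[of 1] by (simp flip: one_pCons)
  next
    case (Suc i)
    then show ?case by (cases i) (simp_all add: Jac_mult algebra_simps)
  qed
  have \<delta>m: "\<delta>t (monom a i) = monom (\<delta> a) i"
    by (rule poly_eqI) (simp add: coeff_\<delta>t dl.D_zero)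
  have na: "nabla [:a:] = [:\<delta> a:] * pderiv s"
    by (simp add: Jac_def \<delta>t_const)
  have on: "[:of_nat i * a:] = of_nat i * [:a:]"
    by (simp add: of_nat_poly)
  show ?case
    unfolding pcompose_monom pderiv_monom \<delta>m Jac_mult pw na on by (simp only: mult_ac)
next
  case (2 P Q)
  then show ?case
    by (simp add: pcompose_add Jac_add dt.D_add pderiv_add algebra_simps)
qed

text \<open>
  Through \<open>\<theta>\<close> the derivation \<open>\<delta> = d/df\<close> corresponds to \<open>nabla = d/dp\<close>.
\<close>

lemma nabla_\<theta>: "nabla (\<theta> a) = \<theta> (\<delta> a)"
proof -
  have "nabla (p - [:f:]) = nabla p - nabla [:f:]"
    using Jac_add[of "p - [:f:]" "[:f:]"] by (simp add: algebra_simps)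
  also have "\<dots> = 1 - pderiv s"
    using nabla_p by (simp add: Jac_def[of "[:f:]"] \<delta>t_const \<delta>_f)
  finally have nu: "nabla (p - [:f:]) = 1 - pderiv s" .
  show ?thesis
    unfolding \<theta>_def nabla_pcompose pderiv_exp_t \<delta>t_exp_t nu by (simp add: algebra_simps)
qed

lemma \<theta>_const: "\<theta> (const c) = pconst c"
  by (rule \<theta>_kernel) (simp add: dl.D_K)

lemma \<pi>_PZ:
  assumes "w \<in> PZ"
  shows "\<pi> w \<in> PZ"
  using PZ_s D_s _ _ _ assms
proof (rule Z.slice_induct)
  fix x assume "x \<in> PZ" "D x = 0"
  then show "\<pi> x \<in> PZ" using \<pi>_kernel[of x] by (simp add: M_UNIV)
next
  fix x y assume "\<pi> x \<in> PZ" "\<pi> y \<in> PZ"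
  then show "\<pi> (x + y) \<in> PZ" using \<pi>_add[of x y] by (simp add: M_UNIV PZ_add)
next
  fix c x
  show "\<pi> (pconst c * (s * x)) \<in> PZ"
    using Z.zero_closed by (simp only: \<pi>_mult M_UNIV UNIV_I \<pi>_s) simp
qed

lemma \<pi>_C: "w \<in> PZ \<Longrightarrow> \<pi> w \<in> C"
  using \<pi>_PZ D_\<pi> by (simp add: C_def M_UNIV)

text \<open>
  The image is a subring that contains \<open>p\<close>, hence \<open>C = k[p]\<close>, hence the images \<open>\<pi> f\<close> and \<open>\<pi> t\<close> of the two
  coordinates. With the kernel of \<open>\<delta>\<close>, on which \<open>\<theta>\<close> is the identity, these generate \<open>\<pi> M\<close>, the kernel of
  \<open>D\<close>.
\<close>

lemma \<pi>\<theta>_surjective: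
  assumes b: "D b = 0"
  shows "b \<in> range (\<lambda>a. \<pi> (\<theta> a))"
proof -
  let ?R = "range (\<lambda>a. \<pi> (\<theta> a))"
  have R_add: "x + y \<in> ?R" if "x \<in> ?R" "y \<in> ?R" for x y
    using that \<theta>_add \<pi>_add by (auto simp: M_UNIV simp flip: \<theta>_add \<pi>_add)
  have R_mult: "x * y \<in> ?R" if "x \<in> ?R" "y \<in> ?R" for x y
    using that \<theta>_mult \<pi>_mult by (auto simp: M_UNIV simp flip: \<theta>_mult \<pi>_mult)
  have R_const: "pconst c \<in> ?R" for c
    using \<theta>_const \<pi>_const by (metis rangeI)
  have R_p: "p \<in> ?R"
    using \<theta>_f \<pi>_kernel[OF pM D_p] by (metis rangeI)
  have R_C: "c \<in> ?R" if "c \<in> C" for c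
    using _ nabla_p _ _ _ that
  proof (rule C.slice_induct[where Q = "\<lambda>c. c \<in> ?R"])
    show "p \<in> C" using p_PZ D_p by (simp add: C_def)
    show "x \<in> ?R" if "x \<in> C" "nabla x = 0" for x
      using nabla_kernel[OF that] R_const by auto
  qed (intro R_add R_mult R_const R_p; assumption)+
  have R_const': "\<pi> [:a:] \<in> ?R" for a
    using UNIV_I \<delta>_f _ _ _ UNIV_I
  proof (rule dl.slice_induct[where Q = "\<lambda>a. \<pi> [:a:] \<in> ?R"])
    show "\<pi> [:x:] \<in> ?R" if "\<delta> x = 0" for x
      using \<theta>_kernel[OF that] by (metis rangeI)
    show "\<pi> [:x + y:] \<in> ?R" if "\<pi> [:x:] \<in> ?R" "\<pi> [:y:] \<in> ?R" for x y
      using R_add[OF that] \<pi>_add[of "[:x:]" "[:y:]"] by (simp add: M_UNIV)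
    show "\<pi> [:const c * (f * x):] \<in> ?R" if "\<pi> [:x:] \<in> ?R" for c x
    proof -
      have "[:const c * (f * x):] = pconst c * ([:f:] * [:x:])" by simp
      then have "\<pi> [:const c * (f * x):] = pconst c * (\<pi> [:f:] * \<pi> [:x:])"
        by (simp only: \<pi>_mult \<pi>_const M_UNIV UNIV_I)
      then show ?thesis
        using R_mult[OF R_const R_mult[OF R_C[OF \<pi>_C[OF PZ_f]] that]] by simp
    qed
  qed
  have R_pow: "x ^ n \<in> ?R" if "x \<in> ?R" for x n
  proof (induction n)
    case 0
    then show ?case using R_const[of 1] K_lnd.K_one by (simp only: power_0)
  next
    case (Suc n)
    then show ?case using R_mult[OF that] by (simp only: power_Suc)
  qed
  have R_sum: "sum g {..n} \<in> ?R" if "\<And>i. g i \<in> ?R" for g and n :: nat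
    using that by (induction n) (auto simp del: image_iff intro!: R_add)
  have "b = \<pi> (\<Sum>i\<le>degree b. [:coeff b i:] * tvar ^ i)"
    using \<pi>_kernel[of b] b poly_expansion[of b] by (simp add: M_UNIV)
  also have "\<dots> = (\<Sum>i\<le>degree b. \<pi> [:coeff b i:] * \<pi> tvar ^ i)"
    by (simp only: \<pi>_sum \<pi>_mult \<pi>_power M_UNIV UNIV_I)
  finally show ?thesis
    using R_sum R_mult R_pow R_const' R_C[OF \<pi>_C[OF PZ_tvar]] by (metis (no_types, lifting))
qed

text \<open>
  If \<open>s\<close> divides \<open>\<theta> a\<close>, then, as \<open>nabla s = 0\<close>, it divides all \<open>\<theta> (\<delta>\<^sup>n a)\<close>. The last of these
  that is not zero is an element of \<open>A\<close> in the kernel of \<open>\<delta>\<close> and of \<open>d/dt\<close>. Both kernels contain its divisor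
  \<open>s\<close>, which contradicts \<open>D s = 1\<close>.
\<close>

lemma \<pi>\<theta>_injective:
  assumes "\<pi> (\<theta> a) = 0"
  shows "a = 0"
proof (rule ccontr)
  assume "a \<noteq> 0"
  obtain n where n: "(\<delta> ^^ n) a \<noteq> 0" "(\<delta> ^^ Suc n) a = 0"
    using dl.last_nonzero[OF _ \<open>a \<noteq> 0\<close>] by auto
  let ?a = "(\<delta> ^^ n) a"
  obtain V where V: "\<theta> a = s * V"
    using \<pi>_decomp[of "\<theta> a"] assms by (auto simp: M_UNIV)
  have "nabla s = 0" by (simp add: Jac_def mult.commute)
  then have "(nabla ^^ k) (s * V) = s * (nabla ^^ k) V" for k
    by (induction k) (simp_all add: Jac_mult)
  moreover have "(nabla ^^ k) (\<theta> a) = \<theta> ((\<delta> ^^ k) a)" for k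
    by (induction k) (simp_all add: nabla_\<theta>)
  ultimately have eq: "s * (nabla ^^ n) V = [:?a:]"
    using V \<theta>_kernel[of ?a] n(2) by (metis comp_apply funpow.simps(2))
  have nz: "[:?a:] \<noteq> 0" using n by simp
  have "pderiv s = 0"
    by (rule pt.kernel_factorially_closed[of s "(nabla ^^ n) V"]) (use eq nz in simp_all)
  moreover have "\<delta>t s = 0"
    by (rule dt.kernel_factorially_closed[of s "(nabla ^^ n) V"])
      (use eq nz n(2) in \<open>simp_all add: \<delta>t_const\<close>)
  ultimately show False using D_PZ[OF PZ_s] D_s by simp
qed

lemma kernel_iso_\<pi>\<theta>: "kernel_iso (\<lambda>a. \<pi> (\<theta> a))"
proof -
  have "inj (\<lambda>a. \<pi> (\<theta> a))"
  proof (rule injI)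
    fix x y assume xy: "\<pi> (\<theta> x) = \<pi> (\<theta> y)"
    have "\<pi> (\<theta> ((x - y) + y)) = \<pi> (\<theta> (x - y)) + \<pi> (\<theta> y)"
      by (simp only: \<theta>_add \<pi>_add M_UNIV UNIV_I)
    then show "x = y" using xy \<pi>\<theta>_injective[of "x - y"] by simp
  qed
  moreover have "range (\<lambda>a. \<pi> (\<theta> a)) = {U. D U = 0}"
    using \<pi>\<theta>_surjective D_\<pi> by (auto simp: M_UNIV)
  ultimately have "bij_betw (\<lambda>a. \<pi> (\<theta> a)) UNIV {U. D U = 0}"
    by (simp add: bij_betw_def)
  then show ?thesis
    unfolding kernel_iso_def veronese_UNIV
    by (auto simp: M_UNIV \<theta>_add \<theta>_mult \<theta>_br \<pi>_add \<pi>_mult \<pi>_pbr \<theta>_const \<pi>_const)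
qed

end

context split_extension
begin

theorem exists_kernel_iso: "\<exists>h. kernel_iso h"
proof (cases "\<exists>z i. central z \<and> z \<in> veronese_set d \<and> lookup (coeff (D [:z:]) i) 0 \<noteq> 0")
  case True
  then obtain z i where z: "central z" "z \<in> veronese_set d" "lookup (coeff (D [:z:]) i) 0 \<noteq> 0"
    by blast
  obtain \<delta> f where *: "d = 1" "locally_nilpotent_derivation const UNIV \<delta>" "\<delta> f = 1" "central f"
    "\<And>p q. \<delta> (br p q) = br (\<delta> p) q + br p (\<delta> q)"
    by (rule central_linear_slice[OF z]) blast
  interpret central_slice br d D s \<pi> \<delta> f
    using * by (intro central_slice.intro central_slice_axioms.intro split_extension_axioms)
  obtain p where "p \<in> PZ" "\<delta>t p = D tvar" "pderiv p = - D [:f:]"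
    by (rule D_hamiltonian)
  then interpret hamiltonian_slice br d D s \<pi> \<delta> f p
    by unfold_locales
  show ?thesis using kernel_iso_\<pi>\<theta> by blast
next
  case False
  then show ?thesis
    using kernel_iso_if_D_center_zero[OF D_center_zero] by blast
qed

end

section \<open>Free extensions by a central variable\<close>

text \<open>
  \<open>M\<close> is a polynomial ring in the central element \<open>s\<close> over the Poisson subalgebra \<open>S\<close>: every element has an
  expansion by \<open>generates\<close>, and only one by \<open>free\<close>. A polynomial in \<open>s\<close> is represented by an element of
  \<open>M\<close> as the value \<open>poly P s\<close> of a polynomial \<open>P\<close> with coefficients in \<open>S\<close>.
\<close>

locale free_extension = quadratic_bracket br
  for br :: "(3, 'k::field_char_0) mpoly \<Rightarrow> (3, 'k) mpoly \<Rightarrow> (3, 'k) mpoly" +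
  fixes d :: nat and S :: "(3, 'k) mpoly poly set" and s :: "(3, 'k) mpoly poly"
  assumes d_pos: "d \<ge> 1"
    and S_subset: "S \<subseteq> veronese_poly d"
    and S_const: "pconst c \<in> S"
    and S_add: "\<lbrakk>U \<in> S; V \<in> S\<rbrakk> \<Longrightarrow> U + V \<in> S"
    and S_mult: "\<lbrakk>U \<in> S; V \<in> S\<rbrakk> \<Longrightarrow> U * V \<in> S"
    and S_pbr: "\<lbrakk>U \<in> S; V \<in> S\<rbrakk> \<Longrightarrow> pbr U V \<in> S"
    and s_closed: "s \<in> veronese_poly d"
    and s_central: "U \<in> veronese_poly d \<Longrightarrow> pbr s U = 0"
    and generates: "U \<in> veronese_poly d \<Longrightarrow> \<exists>P. (\<forall>i. coeff P i \<in> S) \<and> U = poly P s"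
    and free: "\<lbrakk>\<forall>i. coeff P i \<in> S; poly P s = 0\<rbrakk> \<Longrightarrow> P = 0"
begin

abbreviation "M \<equiv> veronese_poly d :: (3, 'k) mpoly poly set"

definition SP :: "(3, 'k) mpoly poly poly set"
  where "SP = {P. \<forall>i. coeff P i \<in> S}"

lemma S_zero: "0 \<in> S" using S_const[of 0] by simp

lemma S_one: "1 \<in> S" using S_const[of 1] by (simp add: one_pCons)

lemma S_smult: "U \<in> S \<Longrightarrow> pconst c * U \<in> S"
  by (intro S_mult S_const)

lemma S_of_nat_mult: "U \<in> S \<Longrightarrow> of_nat n * U \<in> S"
  using S_smult[of U "of_nat n"] by (simp add: of_nat_poly)

lemma S_sum: "(\<And>i. i \<in> I \<Longrightarrow> f i \<in> S) \<Longrightarrow> sum f I \<in> S"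
  by (induction I rule: infinite_finite_induct) (auto intro: S_zero S_add)

lemma SP_add: "P \<in> SP \<Longrightarrow> Q \<in> SP \<Longrightarrow> P + Q \<in> SP"
  by (simp add: SP_def S_add)

lemma SP_mult: "P \<in> SP \<Longrightarrow> Q \<in> SP \<Longrightarrow> P * Q \<in> SP"
  by (auto simp: SP_def coeff_mult intro!: S_sum S_mult)

lemma SP_pderiv: "P \<in> SP \<Longrightarrow> pderiv P \<in> SP"
  by (simp add: SP_def coeff_pderiv S_of_nat_mult del: of_nat_Suc)

lemma SP_const: "[:b:] \<in> SP \<longleftrightarrow> b \<in> S"
  using S_zero by (auto simp: SP_def coeff_pCons split: nat.splits)

lemma SP_minus: "P \<in> SP \<Longrightarrow> Q \<in> SP \<Longrightarrow> P - Q \<in> SP"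
proof -
  assume PQ: "P \<in> SP" "Q \<in> SP"
  have "pconst (-1) = (-1 :: (3, 'k) mpoly poly)"
    by (simp add: single_uminus one_pCons)
  then have "P - Q = P + [:pconst (-1):] * Q" by simp
  then show ?thesis using PQ by (metis SP_add SP_mult SP_const S_const)
qed

definition expansion :: "(3, 'k) mpoly poly \<Rightarrow> (3, 'k) mpoly poly poly"
  where "expansion U = (SOME P. P \<in> SP \<and> U = poly P s)"

lemma expansion:
  assumes "U \<in> M" shows "expansion U \<in> SP" "poly (expansion U) s = U"
proof -
  have "expansion U \<in> SP \<and> U = poly (expansion U) s"
    unfolding expansion_def
  proof (rule someI_ex)
    show "\<exists>P. P \<in> SP \<and> U = poly P s"
      using generates[OF assms] unfolding SP_def by blast
  qed
  then show "expansion U \<in> SP" "poly (expansion U) s = U" by simp_all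
qed

lemma poly_SP: "P \<in> SP \<Longrightarrow> poly P s \<in> M"
proof -
  assume P: "P \<in> SP"
  have pow: "s ^ i \<in> M" for i
    using s_closed S_subset S_one by (induction i) (auto intro: veronese_poly_mult)
  have t: "coeff P i * s ^ i \<in> M" for i
    using P S_subset pow by (intro veronese_poly_mult) (auto simp: SP_def)
  have "(\<Sum>i\<le>n. coeff P i * s ^ i) \<in> M" for n
    using t[of 0] by (induction n) (simp_all add: t veronese_poly_add del: power_Suc)
  then show ?thesis by (simp add: poly_altdef)
qed

lemma expansion_poly: "P \<in> SP \<Longrightarrow> expansion (poly P s) = P"
  using free[of "expansion (poly P s) - P"] expansion[OF poly_SP[of P]] SP_minus[of "expansion (poly P s)" P]
  by (simp add: SP_def)

definition ds :: "(3, 'k) mpoly poly \<Rightarrow> (3, 'k) mpoly poly"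
  where "ds U = poly (pderiv (expansion U)) s"

definition at0 :: "(3, 'k) mpoly poly \<Rightarrow> (3, 'k) mpoly poly"
  where "at0 U = coeff (expansion U) 0"

lemma ds_poly: "P \<in> SP \<Longrightarrow> ds (poly P s) = poly (pderiv P) s"
  by (simp add: ds_def expansion_poly)

lemma at0_poly: "P \<in> SP \<Longrightarrow> at0 (poly P s) = coeff P 0"
  by (simp add: at0_def expansion_poly)

lemma M_cases:
  assumes "U \<in> M" obtains P where "P \<in> SP" "U = poly P s"
  using expansion[OF assms] by metis

lemma ds_lnd: "locally_nilpotent_derivation pconst M ds"
proof unfold_locales
  fix U V assume U: "U \<in> M" and V: "V \<in> M"
  obtain P Q where P: "P \<in> SP" "U = poly P s" and Q: "Q \<in> SP" "V = poly Q s"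
    using M_cases U V by metis
  have *: "U + V = poly (P + Q) s" "U * V = poly (P * Q) s" using P Q by simp_all
  show "ds (U + V) = ds U + ds V"
    unfolding * ds_poly[OF SP_add[OF P(1) Q(1)]] by (simp add: P Q ds_poly pderiv_add)
  show "ds (U * V) = ds U * V + U * ds V"
    unfolding * ds_poly[OF SP_mult[OF P(1) Q(1)]] by (simp add: P Q ds_poly pderiv_mult)
next
  fix U assume "U \<in> M"
  then obtain P where P: "P \<in> SP" "U = poly P s" by (rule M_cases)
  show "ds U \<in> M" using P by (simp add: ds_poly poly_SP SP_pderiv)
  have "(ds ^^ n) U = poly ((pderiv ^^ n) P) s \<and> (pderiv ^^ n) P \<in> SP" for n
    using P by (induction n) (auto simp: ds_poly SP_pderiv)
  moreover have "\<exists>n. (pderiv ^^ n) P = 0"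
  proof -
    have "degree ((pderiv ^^ n) P) \<le> degree P - n" for n
      by (induction n) (auto simp: degree_pderiv)
    then have "pderiv ((pderiv ^^ degree P) P) = 0"
      by (metis diff_self_eq_0 le_zero_eq pderiv_eq_0_iff)
    then have "(pderiv ^^ Suc (degree P)) P = 0" by simp
    then show ?thesis by blast
  qed
  ultimately show "\<exists>n. (ds ^^ n) U = 0" by (metis poly_0)
next
  fix a
  have "ds (poly [:pconst a:] s) = 0"
    by (subst ds_poly) (simp_all add: SP_const S_const)
  then show "ds (pconst a) = 0" by simp
  show "pconst a \<in> M" using S_const S_subset by blast
qed (simp_all add: const_add const_mult veronese_poly_add veronese_poly_mult one_pCons)

lemma at0_add: "U \<in> M \<Longrightarrow> V \<in> M \<Longrightarrow> at0 (U + V) = at0 U + at0 V"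
  by (elim M_cases) (simp add: at0_poly SP_add flip: poly_add)

lemma at0_mult: "U \<in> M \<Longrightarrow> V \<in> M \<Longrightarrow> at0 (U * V) = at0 U * at0 V"
  by (elim M_cases) (simp add: at0_poly SP_mult coeff_mult flip: poly_mult)

lemma at0_S: "b \<in> S \<Longrightarrow> at0 b = b"
  using at0_poly[of "[:b:]"] by (simp add: SP_const)

lemma ds_S: "b \<in> S \<Longrightarrow> ds b = 0"
  using ds_poly[of "[:b:]"] by (simp add: SP_const)

lemma s_SP: "[:0, 1:] \<in> SP"
  using S_zero S_one by (auto simp: SP_def coeff_pCons split: nat.splits)

lemma ds_s: "ds s = 1"
  using ds_poly[OF s_SP] by (simp add: pderiv_pCons)

lemma at0_s: "at0 s = 0"
  using at0_poly[OF s_SP] by simp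

lemma kernel_ds: "{U \<in> M. ds U = 0} = S"
proof (intro equalityI subsetI)
  fix U assume "U \<in> {U \<in> M. ds U = 0}"
  then obtain P where P: "P \<in> SP" "U = poly P s" "ds U = 0" using M_cases by blast
  then have "pderiv P = 0"
    using free[of "pderiv P"] SP_pderiv[OF P(1)] by (simp add: ds_poly SP_def)
  then obtain b where "P = [:b:]" using pderiv_iszero by blast
  then show "U \<in> S" using P by (simp add: SP_const)
qed (use S_subset ds_S in auto)

lemma M_induct:
  assumes "U \<in> M" "\<And>b i. b \<in> S \<Longrightarrow> Q (b * s ^ i)"
    "\<And>U V. \<lbrakk>U \<in> M; V \<in> M; Q U; Q V\<rbrakk> \<Longrightarrow> Q (U + V)"
  shows "Q U"
proof -
  obtain P where P: "P \<in> SP" "U = poly P s" using assms(1) by (rule M_cases)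
  have pow: "s ^ i \<in> M" for i
    using s_closed S_subset S_one by (induction i) (auto intro: veronese_poly_mult)
  have t: "coeff P i * s ^ i \<in> M" "Q (coeff P i * s ^ i)" for i
    using P S_subset pow by (auto simp: SP_def intro!: veronese_poly_mult assms(2))
  have "Q (\<Sum>i\<le>n. coeff P i * s ^ i) \<and> (\<Sum>i\<le>n. coeff P i * s ^ i) \<in> M" for n
    using t[of 0] by (induction n) (simp_all add: t veronese_poly_add assms(3) del: power_Suc)
  then show ?thesis by (simp add: P poly_altdef)
qed

text \<open>
  Both compatibilities with the bracket are checked on products \<open>b s\<^sup>i\<close> with \<open>b\<close> in \<open>S\<close>, where
  \<open>{a s\<^sup>i, b s\<^sup>j} = {a, b} s\<^sup>i\<^sup>+\<^sup>j\<close> because \<open>s\<close> is central.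
\<close>

lemma is_split_extension: "split_extension br d ds s at0"
proof -
  interpret ds: locally_nilpotent_derivation pconst M ds by (rule ds_lnd)
  have s_pc: "pcentral s" using pcentralI[OF d_pos s_central] .
  have spow: "pcentral (s ^ i)" for i
    using s_pc central_const[of 1] pcentral_const[of 1]
    by (induction i) (auto simp: one_pCons intro: pcentral_mult)
  have SM: "b \<in> M" if "b \<in> S" for b using S_subset that by blast
  have pb: "pbr (a * s ^ i) (b * s ^ j) = pbr a b * s ^ (i + j)" for a b i j
  proof -
    have "pbr (s ^ i * a) (s ^ j * b) = s ^ i * (s ^ j * pbr a b)"
      by (simp only: pcentral_mult_left[OF spow] pcentral_mult_right[OF spow] mult.left_commute[of "s ^ j"])
    then show ?thesis by (simp add: power_add mult_ac)
  qed
  have dm: "ds (b * s ^ i) = b * (of_nat i * s ^ (i - 1))" if "b \<in> S" for b i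
    using that by (simp add: ds.D_mult ds.D_power SM s_closed ds.power_closed ds_S ds_s)
  have pbc: "pbr U V \<in> M" if "U \<in> M" "V \<in> M" for U V using that by (rule pbr_closed)
  have D_pbr: "ds (pbr U V) = pbr (ds U) V + pbr U (ds V)" if "U \<in> M" "V \<in> M" for U V
    using \<open>U \<in> M\<close>
  proof (rule M_induct)
    fix a i assume a: "a \<in> S"
    show "ds (pbr (a * s ^ i) V) = pbr (ds (a * s ^ i)) V + pbr (a * s ^ i) (ds V)"
      using \<open>V \<in> M\<close>
    proof (rule M_induct)
      fix b j assume b: "b \<in> S"
      have ri: "pbr (a * (of_nat i * s ^ (i - 1))) (b * s ^ j) = pbr a b * (of_nat i * s ^ (i + j - 1))"
      proof -
        have "a * (of_nat i * s ^ (i - 1)) = (of_nat i * a) * s ^ (i - 1)" by (simp only: mult_ac)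
        then have "pbr (a * (of_nat i * s ^ (i - 1))) (b * s ^ j) = pbr (of_nat i * a) b * s ^ (i - 1 + j)"
          by (simp only: pb)
        moreover have "pbr (of_nat i * a) b = of_nat i * pbr a b"
          using pcentral_mult_left[of "pconst (of_nat i)" a b] central_const[of "of_nat i"]
          by (simp add: pcentral_const of_nat_poly)
        ultimately show ?thesis by (cases i) (simp_all add: mult_ac)
      qed
      have rj: "pbr (a * s ^ i) (b * (of_nat j * s ^ (j - 1))) = pbr a b * (of_nat j * s ^ (i + j - 1))"
      proof -
        have "b * (of_nat j * s ^ (j - 1)) = (of_nat j * b) * s ^ (j - 1)" by (simp only: mult_ac)
        then have "pbr (a * s ^ i) (b * (of_nat j * s ^ (j - 1))) = pbr a (of_nat j * b) * s ^ (i + (j - 1))"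
          by (simp only: pb)
        moreover have "pbr a (of_nat j * b) = of_nat j * pbr a b"
          using pcentral_mult_right[of "pconst (of_nat j)" a b] central_const[of "of_nat j"]
          by (simp add: pcentral_const of_nat_poly)
        ultimately show ?thesis by (cases j) (simp_all add: mult_ac)
      qed
      show "ds (pbr (a * s ^ i) (b * s ^ j)) =
          pbr (ds (a * s ^ i)) (b * s ^ j) + pbr (a * s ^ i) (ds (b * s ^ j))"
        unfolding dm[OF a] dm[OF b] ri rj unfolding pb dm[OF S_pbr[OF a b]]
        by (simp add: algebra_simps)
    next
      fix U V assume "U \<in> M" "V \<in> M"
        "ds (pbr (a * s ^ i) U) = pbr (ds (a * s ^ i)) U + pbr (a * s ^ i) (ds U)"
        "ds (pbr (a * s ^ i) V) = pbr (ds (a * s ^ i)) V + pbr (a * s ^ i) (ds V)"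
      moreover have "a * s ^ i \<in> M" using a by (intro ds.mult_closed ds.power_closed SM s_closed)
      ultimately show "ds (pbr (a * s ^ i) (U + V)) =
          pbr (ds (a * s ^ i)) (U + V) + pbr (a * s ^ i) (ds (U + V))"
        by (simp add: pbr_add_right ds.D_add pbc algebra_simps)
    qed
  next
    fix U U' assume "U \<in> M" "U' \<in> M" "ds (pbr U V) = pbr (ds U) V + pbr U (ds V)"
      "ds (pbr U' V) = pbr (ds U') V + pbr U' (ds V)"
    then show "ds (pbr (U + U') V) = pbr (ds (U + U')) V + pbr (U + U') (ds V)"
      using \<open>V \<in> M\<close> by (simp add: pbr_add_left ds.D_add pbc algebra_simps)
  qed
  have at0_power: "at0 (s ^ i) = 0 ^ i" for i
    by (induction i) (simp_all add: at0_mult at0_s at0_S S_one s_closed ds.power_closed)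
  have am: "at0 (b * s ^ i) = b * 0 ^ i" if "b \<in> S" for b i
    using that by (simp add: at0_mult SM s_closed ds.power_closed at0_S at0_power)
  have at0_pbr: "at0 (pbr U V) = pbr (at0 U) (at0 V)" if "U \<in> M" "V \<in> M" for U V
    using \<open>U \<in> M\<close>
  proof (rule M_induct)
    fix a i assume a: "a \<in> S"
    show "at0 (pbr (a * s ^ i) V) = pbr (at0 (a * s ^ i)) (at0 V)"
      using \<open>V \<in> M\<close>
    proof (rule M_induct)
      fix b j assume b: "b \<in> S"
      show "at0 (pbr (a * s ^ i) (b * s ^ j)) = pbr (at0 (a * s ^ i)) (at0 (b * s ^ j))"
        unfolding am[OF a] am[OF b] unfolding pb am[OF S_pbr[OF a b]]
        by (cases i; cases j) simp_all
    next
      fix U V assume "U \<in> M" "V \<in> M"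
        "at0 (pbr (a * s ^ i) U) = pbr (at0 (a * s ^ i)) (at0 U)"
        "at0 (pbr (a * s ^ i) V) = pbr (at0 (a * s ^ i)) (at0 V)"
      moreover have "a * s ^ i \<in> M" using a by (intro ds.mult_closed ds.power_closed SM s_closed)
      ultimately show "at0 (pbr (a * s ^ i) (U + V)) = pbr (at0 (a * s ^ i)) (at0 (U + V))"
        by (simp add: pbr_add_right at0_add pbc)
    qed
  next
    fix U U' assume "U \<in> M" "U' \<in> M" "at0 (pbr U V) = pbr (at0 U) (at0 V)"
      "at0 (pbr U' V) = pbr (at0 U') (at0 V)"
    then show "at0 (pbr (U + U') V) = pbr (at0 (U + U')) (at0 V)"
      using \<open>V \<in> M\<close> by (simp add: pbr_add_left at0_add pbc)
  qed
  have at0_in_S: "at0 U \<in> S" if "U \<in> M" for U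
    using that by (elim M_cases) (simp add: at0_poly, simp add: SP_def)
  show ?thesis
  proof (intro split_extension.intro quadratic_bracket_axioms ds_lnd split_extension_axioms.intro)
    fix U assume U: "U \<in> M"
    then obtain P where P: "P \<in> SP" "U = poly P s" by (rule M_cases)
    obtain c Q where Q: "P = pCons c Q" by (cases P)
    have "Q \<in> SP" using P(1) unfolding SP_def Q by (auto simp: coeff_pCons split: nat.splits dest: spec[of _ "Suc _"])
    then show "\<exists>V\<in>M. U = at0 U + s * V"
      using P Q poly_SP[of Q] at0_poly[OF P(1)] by auto
  next
    fix U assume "U \<in> M" "ds U = 0"
    then have "U \<in> S" using kernel_ds by blast
    then show "at0 U = U" by (rule at0_S)
  qed (use d_pos D_pbr s_closed ds_s s_central at0_in_S SM ds_S at0_add at0_mult at0_s at0_pbr in auto)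
qed

theorem exists_iso:
  obtains h where "bij_betw h (veronese_set d) S"
    "\<And>x y. \<lbrakk>x \<in> veronese_set d; y \<in> veronese_set d\<rbrakk> \<Longrightarrow> h (x + y) = h x + h y"
    "\<And>x y. \<lbrakk>x \<in> veronese_set d; y \<in> veronese_set d\<rbrakk> \<Longrightarrow> h (x * y) = h x * h y"
    "\<And>x y. \<lbrakk>x \<in> veronese_set d; y \<in> veronese_set d\<rbrakk> \<Longrightarrow> h (br x y) = pbr (h x) (h y)"
    "\<And>c. h (const c) = pconst c"
proof -
  interpret E: split_extension br d ds s at0 by (rule is_split_extension)
  obtain h where "E.kernel_iso h" using E.exists_kernel_iso by blast
  then show thesis using that[of h] unfolding E.kernel_iso_def kernel_ds by blast
qed

end

section \<open>Isomorphisms of polynomial extensions\<close>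

lemma quadratic_bracket_if_poisson_algebra:
  fixes br :: "(3, 'k::field_char_0) mpoly \<Rightarrow> (3, 'k) mpoly \<Rightarrow> (3, 'k) mpoly"
  assumes "poisson_algebra (ring_of_type_algebra :: 'k ring) (polynomial_poisson br)"
    and "quadratic br" and "\<exists>p q. br p q \<noteq> 0"
  shows "quadratic_bracket br"
proof -
  interpret P: poisson_algebra "ring_of_type_algebra :: 'k ring" "polynomial_poisson br" by fact
  note defs = polynomial_poisson_def ring_of_type_algebra_def
  have add_left: "br (x + y) z = br x z + br y z" for x y z
    using P.bracket_add_left[of x y z] by (simp add: defs)
  have add_right: "br x (y + z) = br x y + br x z" for x y z
    using P.bracket_add_right[of x y z] by (simp add: defs)
  have mult_left: "br (x * y) z = x * br y z + br x z * y" for x y z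
    using P.bracket_mult_left[of x y z] by (simp add: defs)
  have mult_right: "br x (y * z) = y * br x z + br x y * z" for x y z
    using P.bracket_mult_right[of x y z] by (simp add: defs)
  have "br 1 z = 0" "br z 1 = 0" for z
    using mult_left[of 1 1 z] mult_right[of z 1 1] by simp_all
  moreover have "br (const c * x) z = const c * br x z" "br z (const c * x) = const c * br z x" for c x z
    using P.bracket_smult_left[of c x z] P.bracket_smult_right[of c z x] by (simp_all add: defs)
  ultimately have "br (const c) z = 0" "br z (const c) = 0" for c z
    by (metis mult.right_neutral mult_zero_right)+
  moreover have "br x x = 0" for x
    using P.bracket_alternating[of x] by (simp add: defs)
  ultimately show ?thesis
    using add_left add_right mult_left mult_right assms(2,3)
    by (intro quadratic_bracket.intro) (auto simp: quadratic_def)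
qed

lemma carrier_veronese:
  assumes "d \<ge> 1"
  shows "carrier (veronese d (polynomial_poisson br)) = (veronese_set d :: ('v::finite, 'k::field) mpoly set)"
proof -
  have "(\<Sum>m\<le>N. f m) \<in> veronese_set d" if "\<forall>m. f m \<in> homogeneous (d * m)"
    for N and f :: "nat \<Rightarrow> ('v, 'k) mpoly"
    using that by (intro veronese_set_sum veronese_set_homogeneous[of _ "d * _"]) auto
  moreover have "\<exists>N f. p = (\<Sum>m\<le>N. f m) \<and> (\<forall>m. f m \<in> homogeneous (d * m))"
    if p: "p \<in> veronese_set d" for p :: "('v, 'k) mpoly"
  proof -
    obtain N where N: "\<forall>e\<in>keys p. tdeg e \<le> N" by (rule tdeg_bound)
    have "p = (\<Sum>m\<le>N. hpart (d * m) p)"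
    proof (rule poly_mapping_eqI)
      fix e
      show "lookup p e = lookup (\<Sum>m\<le>N. hpart (d * m) p) e"
      proof (cases "e \<in> keys p")
        case True
        then obtain m where m: "tdeg e = d * m" using p by (auto simp: veronese_set_def)
        have "m \<le> d * m" using assms by simp
        then have "m \<le> N" using N True m by (metis le_trans)
        have "(\<Sum>k\<le>N. lookup (hpart (d * k) p) e) = (\<Sum>k\<le>N. if k = m then lookup p e else 0)"
          using assms by (intro sum.cong) (auto simp: lookup_hpart m)
        then show ?thesis using \<open>m \<le> N\<close> by (simp add: lookup_sum)
      qed (simp add: lookup_sum lookup_hpart in_keys_iff cong: if_cong)
    qed
    then show ?thesis using hpart_homogeneous by blast
  qed
  ultimately show ?thesis
    by (auto simp: veronese_def polynomial_poisson_def)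
qed

lemma veronese_simps [simp]:
  "monoid.mult (veronese d (polynomial_poisson br)) = (*)"
  "one (veronese d (polynomial_poisson br)) = 1"
  "ring.zero (veronese d (polynomial_poisson br)) = 0"
  "add (veronese d (polynomial_poisson br)) = (+)"
  "module.smult (veronese d (polynomial_poisson br)) c x = const c * x"
  "bracket (veronese d (polynomial_poisson br)) = br"
  by (simp_all add: veronese_def polynomial_poisson_def)

lemma finsum_veronese:
  assumes "d \<ge> 1" "finite I" "\<And>i. i \<in> I \<Longrightarrow> f i \<in> veronese_set d"
  shows "finsum (veronese d (polynomial_poisson br)) f I = sum f I"
proof -
  let ?V = "veronese d (polynomial_poisson br)"
  interpret V: abelian_monoid ?V
    using assms(1) veronese_set_const[of 0 d]
    by (intro abelian_monoidI) (auto simp: carrier_veronese veronese_set_add add_ac)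
  show ?thesis using assms(2,3)
  proof (induction I rule: finite_induct)
    case empty
    then show ?case using V.finsum_empty by simp
  next
    case (insert i I)
    then show ?case
      using V.finsum_insert[of I i f] assms(1) by (auto simp: carrier_veronese Pi_iff)
  qed
qed

text \<open>
  An isomorphism \<open>R[t] \<cong> B[s]\<close>. Both sides consist of coefficient sequences; \<open>\<Phi>\<close> below reads it on the type of
  polynomials over \<open>A\<close>, where \<open>R[t]\<close> is the set \<open>M\<close>.
\<close>

locale veronese_extension_iso = quadratic_bracket br
  for br :: "(3, 'k::field_char_0) mpoly \<Rightarrow> (3, 'k) mpoly \<Rightarrow> (3, 'k) mpoly" +
  fixes d :: nat and B :: "('k, 'b) poisson" and \<phi> :: "(nat \<Rightarrow> (3, 'k) mpoly) \<Rightarrow> nat \<Rightarrow> 'b"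
  assumes d_pos: "d \<ge> 1"
    and B: "poisson_algebra (ring_of_type_algebra :: 'k ring) B"
    and \<phi>: "\<phi> \<in> poisson_iso (ring_of_type_algebra :: 'k ring)
      (poly_extension (veronese d (polynomial_poisson br))) (poly_extension B)"
begin

abbreviation "V \<equiv> veronese d (polynomial_poisson br)"
abbreviation "M \<equiv> veronese_poly d :: (3, 'k) mpoly poly set"

sublocale B: poisson_algebra "ring_of_type_algebra :: 'k ring" B
  by (rule B)

sublocale U: UP_cring B "UP B"
  by unfold_locales simp

definition \<Phi> :: "(3, 'k) mpoly poly \<Rightarrow> nat \<Rightarrow> 'b"
  where "\<Phi> P = \<phi> (coeff P)"

lemma coeff_in_up: "P \<in> M \<Longrightarrow> coeff P \<in> up V"
  by (intro mem_upI)
    (auto simp: carrier_veronese[OF d_pos] veronese_poly_def bound_def intro!: exI[of _ "degree P"]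
      intro: coeff_eq_0)

lemma up_is_coeff:
  assumes "p \<in> up V" shows "\<exists>P\<in>M. p = coeff P"
proof -
  obtain n where n: "bound 0 n p" using assms by (auto simp: up_def)
  then have "coeff (Abs_poly p) = p"
    by (intro coeff_Abs_poly[of n]) (auto simp: bound_def)
  then show ?thesis
    using mem_upD[OF assms] by (intro bexI[of _ "Abs_poly p"]) (auto simp: veronese_poly_def carrier_veronese[OF d_pos])
qed

lemma \<Phi>_add:
  assumes "P \<in> M" "Q \<in> M" shows "\<Phi> (P + Q) = (\<lambda>n. \<Phi> P n \<oplus>\<^bsub>B\<^esub> \<Phi> Q n)"
    and "\<Phi> P \<in> up B"
proof -
  have r: "\<phi> \<in> ring_hom (poly_extension V) (poly_extension B)"
    using \<phi> by (simp add: poisson_iso_def ring_iso_def)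
  have cl: "\<Phi> P \<in> up B" if "P \<in> M" for P
    using ring_hom_closed[OF r, of "coeff P"] coeff_in_up[OF that]
    by (simp add: \<Phi>_def poly_extension_def UP_def)
  then show "\<Phi> P \<in> up B" using assms by simp
  have "(\<lambda>i. coeff P i + coeff Q i) = coeff (P + Q)"
    by (simp add: fun_eq_iff)
  then show "\<Phi> (P + Q) = (\<lambda>n. \<Phi> P n \<oplus>\<^bsub>B\<^esub> \<Phi> Q n)"
    using ring_hom_add[OF r, of "coeff P" "coeff Q"] coeff_in_up assms cl
    by (simp add: \<Phi>_def poly_extension_def UP_def)
qed

lemma \<Phi>_mult:
  assumes "P \<in> M" "Q \<in> M" shows "\<Phi> (P * Q) = \<Phi> P \<otimes>\<^bsub>UP B\<^esub> \<Phi> Q"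
proof -
  have r: "\<phi> \<in> ring_hom (poly_extension V) (poly_extension B)"
    using \<phi> by (simp add: poisson_iso_def ring_iso_def)
  have "(\<lambda>n. finsum V (\<lambda>i. coeff P i * coeff Q (n - i)) {..n}) = coeff (P * Q)"
  proof
    fix n
    show "finsum V (\<lambda>i. coeff P i * coeff Q (n - i)) {..n} = coeff (P * Q) n"
      using assms by (subst finsum_veronese[OF d_pos]) (auto simp: coeff_mult veronese_poly_def veronese_set_mult)
  qed
  then show ?thesis
    using ring_hom_mult[OF r, of "coeff P" "coeff Q"] coeff_in_up[OF assms(1)] coeff_in_up[OF assms(2)]
    by (simp add: \<Phi>_def poly_extension_def UP_def)
qed

lemma \<Phi>_one: "\<Phi> 1 = (\<lambda>n. if n = 0 then \<one>\<^bsub>B\<^esub> else \<zero>\<^bsub>B\<^esub>)"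
proof -
  have r: "\<phi> \<in> ring_hom (poly_extension V) (poly_extension B)"
    using \<phi> by (simp add: poisson_iso_def ring_iso_def)
  have "(\<lambda>n. if n = 0 then 1 else 0) = coeff (1 :: (3, 'k) mpoly poly)"
    by (auto simp: fun_eq_iff)
  then show ?thesis
    using ring_hom_one[OF r] by (simp add: \<Phi>_def poly_extension_def UP_def cong: if_cong)
qed

lemma \<Phi>_smult:
  assumes "P \<in> M" shows "\<Phi> (pconst c * P) = (\<lambda>n. c \<odot>\<^bsub>B\<^esub> \<Phi> P n)"
proof -
  have "\<phi> (c \<odot>\<^bsub>poly_extension V\<^esub> coeff P) = c \<odot>\<^bsub>poly_extension B\<^esub> \<phi> (coeff P)"
    using \<phi> coeff_in_up[OF assms] by (simp add: poisson_iso_def poly_extension_def UP_def ring_of_type_algebra_def)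
  moreover have "c \<odot>\<^bsub>poly_extension V\<^esub> coeff P = coeff (pconst c * P)"
    by (simp add: poly_extension_def fun_eq_iff)
  ultimately show ?thesis by (simp add: \<Phi>_def poly_extension_def)
qed

lemma \<Phi>_pbr:
  assumes "P \<in> M" "Q \<in> M"
  shows "\<Phi> (pbr P Q) = (\<lambda>n. \<Oplus>\<^bsub>B\<^esub>i\<in>{..n}. bracket B (\<Phi> P i) (\<Phi> Q (n - i)))"
proof -
  have "\<phi> (bracket (poly_extension V) (coeff P) (coeff Q)) =
      bracket (poly_extension B) (\<phi> (coeff P)) (\<phi> (coeff Q))"
    using \<phi> coeff_in_up[OF assms(1)] coeff_in_up[OF assms(2)]
    by (simp add: poisson_iso_def poly_extension_def UP_def)
  moreover have "bracket (poly_extension V) (coeff P) (coeff Q) = coeff (pbr P Q)"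
  proof
    fix n
    show "bracket (poly_extension V) (coeff P) (coeff Q) n = coeff (pbr P Q) n"
      using assms by (simp add: poly_extension_def coeff_pbr, subst finsum_veronese[OF d_pos])
        (auto simp: veronese_poly_def br_veronese)
  qed
  ultimately show ?thesis by (simp add: \<Phi>_def poly_extension_def)
qed

lemma \<Phi>_bij: "bij_betw \<Phi> M (up B)"
proof -
  have b: "bij_betw \<phi> (up V) (up B)"
    using \<phi> by (simp add: poisson_iso_def ring_iso_def poly_extension_def UP_def)
  have "bij_betw coeff M (up V)"
    unfolding bij_betw_def
  proof
    show "inj_on coeff M" by (rule inj_onI) (simp add: poly_eq_iff)
    show "coeff ` M = up V" using coeff_in_up up_is_coeff by blast
  qed
  from bij_betw_trans[OF this b] show ?thesis
    by (simp add: \<Phi>_def comp_def cong: bij_betw_cong)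
qed

lemma \<Phi>_inj: "\<lbrakk>P \<in> M; Q \<in> M; \<Phi> P = \<Phi> Q\<rbrakk> \<Longrightarrow> P = Q"
  using \<Phi>_bij by (metis bij_betw_imp_inj_on inj_onD)

abbreviation mon :: "'b \<Rightarrow> nat \<Rightarrow> nat \<Rightarrow> 'b"
  where "mon b i \<equiv> (\<lambda>n. if n = i then b else \<zero>\<^bsub>B\<^esub>)"

lemma mon_eq_monom: "b \<in> carrier B \<Longrightarrow> mon b i = up_ring.monom (UP B) b i"
  by (auto simp: UP_def fun_eq_iff)

lemma mon_up: "b \<in> carrier B \<Longrightarrow> mon b i \<in> up B"
proof -
  assume "b \<in> carrier B"
  moreover have "carrier (UP B) = up B" by (simp add: UP_def)
  ultimately show "mon b i \<in> up B"
    using U.monom_closed[of b i] by (simp only: mon_eq_monom)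
qed

lemma mon_mult: "\<lbrakk>a \<in> carrier B; b \<in> carrier B\<rbrakk> \<Longrightarrow> mon a i \<otimes>\<^bsub>UP B\<^esub> mon b j = mon (a \<otimes>\<^bsub>B\<^esub> b) (i + j)"
  using U.monom_mult[of a b i j] by (simp only: mon_eq_monom B.m_closed)

text \<open>
  The preimage of the constants, a copy of \<open>B\<close> in \<open>M\<close>.
\<close>

definition S :: "(3, 'k) mpoly poly set"
  where "S = {P \<in> M. \<exists>b\<in>carrier B. \<Phi> P = mon b 0}"

definition s :: "(3, 'k) mpoly poly"
  where "s = (SOME P. P \<in> M \<and> \<Phi> P = mon \<one>\<^bsub>B\<^esub> 1)"

lemma preimage: "b \<in> carrier B \<Longrightarrow> \<exists>P\<in>M. \<Phi> P = mon b i"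
proof -
  assume "b \<in> carrier B"
  then have "mon b i \<in> \<Phi> ` M"
    using bij_betw_imp_surj_on[OF \<Phi>_bij] mon_up by blast
  then show ?thesis by (elim imageE) (intro bexI, rule sym)
qed

lemma s: "s \<in> M" "\<Phi> s = mon \<one>\<^bsub>B\<^esub> 1"
proof -
  have "\<exists>P. P \<in> M \<and> \<Phi> P = mon \<one>\<^bsub>B\<^esub> 1" using preimage[of "\<one>\<^bsub>B\<^esub>" 1] by blast
  then have "s \<in> M \<and> \<Phi> s = mon \<one>\<^bsub>B\<^esub> 1" unfolding s_def by (rule someI_ex)
  then show "s \<in> M" "\<Phi> s = mon \<one>\<^bsub>B\<^esub> 1" by simp_all
qed

lemma \<Phi>_carrier: "P \<in> M \<Longrightarrow> \<Phi> P n \<in> carrier B"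
  using \<Phi>_add(2)[of P P] mem_upD by blast

lemma idempotent_imp_zero: "\<lbrakk>b \<in> carrier B; b \<oplus>\<^bsub>B\<^esub> b = b\<rbrakk> \<Longrightarrow> b = \<zero>\<^bsub>B\<^esub>"
  using B.M.add.l_cancel_one[of b b] by blast

lemma bracket_zero:
  assumes a: "a \<in> carrier B"
  shows "bracket B \<zero>\<^bsub>B\<^esub> a = \<zero>\<^bsub>B\<^esub>" and "bracket B a \<zero>\<^bsub>B\<^esub> = \<zero>\<^bsub>B\<^esub>"
proof -
  have z: "\<zero>\<^bsub>B\<^esub> \<in> carrier B" "\<zero>\<^bsub>B\<^esub> \<oplus>\<^bsub>B\<^esub> \<zero>\<^bsub>B\<^esub> = \<zero>\<^bsub>B\<^esub>" by simp_all
  show "bracket B \<zero>\<^bsub>B\<^esub> a = \<zero>\<^bsub>B\<^esub>"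
    using B.bracket_add_left[OF z(1) z(1) a] unfolding z(2)
    by (intro idempotent_imp_zero B.bracket_closed z(1) a) (rule sym)
  show "bracket B a \<zero>\<^bsub>B\<^esub> = \<zero>\<^bsub>B\<^esub>"
    using B.bracket_add_right[OF a z(1) z(1)] unfolding z(2)
    by (intro idempotent_imp_zero B.bracket_closed z(1) a) (rule sym)
qed

lemma bracket_one:
  assumes a: "a \<in> carrier B"
  shows "bracket B \<one>\<^bsub>B\<^esub> a = \<zero>\<^bsub>B\<^esub>"
proof -
  let ?b = "bracket B \<one>\<^bsub>B\<^esub> a"
  have o: "\<one>\<^bsub>B\<^esub> \<in> carrier B" "\<one>\<^bsub>B\<^esub> \<otimes>\<^bsub>B\<^esub> \<one>\<^bsub>B\<^esub> = \<one>\<^bsub>B\<^esub>" by simp_all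
  have b: "?b \<in> carrier B" by (rule B.bracket_closed[OF o(1) a])
  then have "\<one>\<^bsub>B\<^esub> \<otimes>\<^bsub>B\<^esub> ?b = ?b" "?b \<otimes>\<^bsub>B\<^esub> \<one>\<^bsub>B\<^esub> = ?b" by simp_all
  then have "?b = ?b \<oplus>\<^bsub>B\<^esub> ?b"
    using B.bracket_mult_left[OF o(1) o(1) a] unfolding o(2) by metis
  then show ?thesis using idempotent_imp_zero[OF b] by metis
qed

lemma zero_M: "0 \<in> M"
  by (simp add: veronese_poly_def veronese_set_def)

lemma \<Phi>_zero: "\<Phi> 0 = (\<lambda>n. \<zero>\<^bsub>B\<^esub>)"
proof
  fix n
  show "\<Phi> 0 n = \<zero>\<^bsub>B\<^esub>"
    using fun_cong[OF \<Phi>_add(1)[OF zero_M zero_M], of n]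
    by (intro idempotent_imp_zero \<Phi>_carrier zero_M) simp
qed

lemma s_central:
  assumes "P \<in> M" shows "pbr s P = 0"
proof -
  have "\<Phi> (pbr s P) = (\<lambda>n. \<zero>\<^bsub>B\<^esub>)"
  proof
    fix n
    have "\<Phi> (pbr s P) n = (\<Oplus>\<^bsub>B\<^esub>i\<in>{..n}. \<zero>\<^bsub>B\<^esub>)"
      unfolding \<Phi>_pbr[OF s(1) assms] s(2)
      using \<Phi>_carrier[OF assms] bracket_zero bracket_one by (intro B.M.finsum_cong') auto
    then show "\<Phi> (pbr s P) n = \<zero>\<^bsub>B\<^esub>" by simp
  qed
  then show ?thesis using \<Phi>_inj[OF pbr_closed[OF s(1) assms] zero_M] \<Phi>_zero by simp
qed

lemma K_carrier: "c \<in> carrier (ring_of_type_algebra :: 'k ring)"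
  by (simp add: ring_of_type_algebra_def)

lemma one_M: "1 \<in> M"
  using veronese_poly_const[of "1 :: (3, 'k) mpoly" d] veronese_set_const[of 1 d] by (simp add: one_pCons)

lemma S_const: "pconst c \<in> S"
proof -
  have "\<Phi> (pconst c) = (\<lambda>n. c \<odot>\<^bsub>B\<^esub> \<Phi> 1 n)"
    using \<Phi>_smult[OF one_M, of c] by simp
  also have "\<dots> = mon (c \<odot>\<^bsub>B\<^esub> \<one>\<^bsub>B\<^esub>) 0"
    by (rule ext) (simp add: \<Phi>_one B.smult_r_null K_carrier)
  finally have "\<Phi> (pconst c) = mon (c \<odot>\<^bsub>B\<^esub> \<one>\<^bsub>B\<^esub>) 0" .
  moreover have "c \<odot>\<^bsub>B\<^esub> \<one>\<^bsub>B\<^esub> \<in> carrier B"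
    by (intro B.smult_closed K_carrier) simp
  moreover have "pconst c \<in> M" by (simp add: veronese_poly_const veronese_set_const)
  ultimately show ?thesis unfolding S_def by blast
qed

lemma S_D: "P \<in> S \<Longrightarrow> P \<in> M \<and> \<Phi> P 0 \<in> carrier B \<and> \<Phi> P = mon (\<Phi> P 0) 0"
  unfolding S_def by (auto simp: \<Phi>_carrier fun_eq_iff)

lemma S_I: "P \<in> M \<Longrightarrow> b \<in> carrier B \<Longrightarrow> \<Phi> P = mon b 0 \<Longrightarrow> P \<in> S"
  unfolding S_def by blast

lemma S_add:
  assumes "P \<in> S" "Q \<in> S" shows "P + Q \<in> S"
proof (rule S_I)
  note P = S_D[OF assms(1)] and Q = S_D[OF assms(2)]
  show "P + Q \<in> M" using P Q by (simp add: veronese_poly_add)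
  show "\<Phi> P 0 \<oplus>\<^bsub>B\<^esub> \<Phi> Q 0 \<in> carrier B" using P Q by simp
  have "\<Phi> P k = \<zero>\<^bsub>B\<^esub>" "\<Phi> Q k = \<zero>\<^bsub>B\<^esub>" if "k \<noteq> 0" for k
    using P Q that by (metis (full_types))+
  then show "\<Phi> (P + Q) = mon (\<Phi> P 0 \<oplus>\<^bsub>B\<^esub> \<Phi> Q 0) 0"
    using P Q by (intro ext) (simp add: \<Phi>_add)
qed

lemma S_mult_value:
  assumes "P \<in> S" "Q \<in> S" shows "\<Phi> (P * Q) = mon (\<Phi> P 0 \<otimes>\<^bsub>B\<^esub> \<Phi> Q 0) 0"
proof -
  note P = S_D[OF assms(1)] and Q = S_D[OF assms(2)]
  have "\<Phi> (P * Q) = mon (\<Phi> P 0) 0 \<otimes>\<^bsub>UP B\<^esub> mon (\<Phi> Q 0) 0"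
    using \<Phi>_mult[of P Q] P Q by metis
  also have "\<dots> = mon (\<Phi> P 0 \<otimes>\<^bsub>B\<^esub> \<Phi> Q 0) (0 + 0)"
    using P Q by (intro mon_mult) auto
  finally show ?thesis by simp
qed

lemma S_mult: "P \<in> S \<Longrightarrow> Q \<in> S \<Longrightarrow> P * Q \<in> S"
  using S_D[of P] S_D[of Q] S_mult_value[of P Q]
  by (intro S_I[of _ "\<Phi> P 0 \<otimes>\<^bsub>B\<^esub> \<Phi> Q 0"]) (auto intro: veronese_poly_mult)

lemma S_pbr_value:
  assumes "P \<in> S" "Q \<in> S" shows "\<Phi> (pbr P Q) = mon (bracket B (\<Phi> P 0) (\<Phi> Q 0)) 0"
proof
  note P = S_D[OF assms(1)] and Q = S_D[OF assms(2)]
  have nz: "\<Phi> P k = \<zero>\<^bsub>B\<^esub>" "\<Phi> Q k = \<zero>\<^bsub>B\<^esub>" if "k \<noteq> 0" for k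
    using P Q that by (metis (full_types))+
  fix n
  show "\<Phi> (pbr P Q) n = mon (bracket B (\<Phi> P 0) (\<Phi> Q 0)) 0 n"
  proof (cases "n = 0")
    case True
    have "bracket B (\<Phi> P 0) (\<Phi> Q 0) \<in> carrier B" using P Q by (intro B.bracket_closed) auto
    then show ?thesis using P Q True by (simp add: \<Phi>_pbr)
  next
    case False
    have "\<Phi> (pbr P Q) n = (\<Oplus>\<^bsub>B\<^esub>i\<in>{..n}. \<zero>\<^bsub>B\<^esub>)"
      unfolding \<Phi>_pbr[OF conjunct1[OF P] conjunct1[OF Q]]
    proof (intro B.M.finsum_cong')
      fix i assume "i \<in> {..n}"
      then have "i \<noteq> 0 \<or> n - i \<noteq> 0" using False by auto
      then show "bracket B (\<Phi> P i) (\<Phi> Q (n - i)) = \<zero>\<^bsub>B\<^esub>"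
        using nz bracket_zero \<Phi>_carrier P Q by metis
    qed auto
    then show ?thesis using False by simp
  qed
qed

lemma S_pbr: "P \<in> S \<Longrightarrow> Q \<in> S \<Longrightarrow> pbr P Q \<in> S"
  using S_D[of P] S_D[of Q] S_pbr_value[of P Q]
  by (intro S_I[of _ "bracket B (\<Phi> P 0) (\<Phi> Q 0)"]) (auto intro: pbr_closed B.bracket_closed)

lemma s_power: "s ^ i \<in> M \<and> \<Phi> (s ^ i) = mon \<one>\<^bsub>B\<^esub> i"
proof (induction i)
  case 0
  then show ?case using one_M by (simp add: \<Phi>_one)
next
  case (Suc i)
  have "\<Phi> (s * s ^ i) = mon \<one>\<^bsub>B\<^esub> 1 \<otimes>\<^bsub>UP B\<^esub> mon \<one>\<^bsub>B\<^esub> i"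
    using \<Phi>_mult[of s "s ^ i"] s Suc by simp
  also have "\<dots> = mon (\<one>\<^bsub>B\<^esub> \<otimes>\<^bsub>B\<^esub> \<one>\<^bsub>B\<^esub>) (1 + i)" by (rule mon_mult) simp_all
  finally show ?case using s Suc by (simp add: veronese_poly_mult cong: if_cong)
qed

lemma S_term:
  assumes "P \<in> S" shows "P * s ^ i \<in> M \<and> \<Phi> (P * s ^ i) = mon (\<Phi> P 0) i"
proof -
  note P = S_D[OF assms]
  have "\<Phi> (P * s ^ i) = mon (\<Phi> P 0) 0 \<otimes>\<^bsub>UP B\<^esub> mon \<one>\<^bsub>B\<^esub> i"
    using \<Phi>_mult[of P "s ^ i"] P s_power[of i] by metis
  also have "\<dots> = mon (\<Phi> P 0 \<otimes>\<^bsub>B\<^esub> \<one>\<^bsub>B\<^esub>) (0 + i)" using P by (intro mon_mult) auto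
  finally show ?thesis using P s_power[of i] by (simp add: veronese_poly_mult cong: if_cong)
qed

text \<open>
  The isomorphism turns an expansion in powers of \<open>s\<close> over \<open>S\<close> into a coefficient sequence over \<open>B\<close>. Existence and
  uniqueness of expansions both follow.
\<close>

lemma S_sum_value:
  assumes "\<And>i. ps i \<in> S" "\<And>i. \<Phi> (ps i) 0 = \<beta> i"
  shows "(\<Sum>i\<le>n. ps i * s ^ i) \<in> M \<and>
    \<Phi> (\<Sum>i\<le>n. ps i * s ^ i) = (\<lambda>k. if k \<le> n then \<beta> k else \<zero>\<^bsub>B\<^esub>)"
proof -
  have t: "ps i * s ^ i \<in> M" "\<Phi> (ps i * s ^ i) = mon (\<beta> i) i" for i
    using S_term[OF assms(1), of i i] unfolding assms(2) by blast+
  have c: "\<beta> k \<in> carrier B" for k using S_D[OF assms(1), of k] unfolding assms(2) by blast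
  show ?thesis
  proof (induction n)
    case 0
    show ?case using t[of 0] by (simp add: fun_eq_iff)
  next
    case (Suc n)
    then show ?case
      using t[of "Suc n"] c by (simp add: \<Phi>_add veronese_poly_add fun_eq_iff le_Suc_eq del: power_Suc)
  qed
qed

lemma generates:
  assumes "P \<in> M" shows "\<exists>Q. (\<forall>i. coeff Q i \<in> S) \<and> P = poly Q s"
proof -
  have "\<exists>R\<in>M. \<Phi> R = mon (\<Phi> P i) 0" for i
    by (rule preimage[OF \<Phi>_carrier[OF assms]])
  then obtain ps where ps: "\<And>i. ps i \<in> M" "\<And>i. \<Phi> (ps i) = mon (\<Phi> P i) 0" by metis
  have psS: "ps i \<in> S" for i by (rule S_I[OF ps(1) _ ps(2)]) (rule \<Phi>_carrier[OF assms])
  obtain N where N: "bound \<zero>\<^bsub>B\<^esub> N (\<Phi> P)" using \<Phi>_add(2)[OF assms assms] by (auto simp: up_def)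
  have "\<Phi> (ps i) 0 = \<Phi> P i" for i by (simp add: ps(2))
  note sum = S_sum_value[of ps "\<Phi> P" N, OF psS this]
  have "(if k \<le> N then \<Phi> P k else \<zero>\<^bsub>B\<^esub>) = \<Phi> P k" for k
    using N by (auto simp: bound_def)
  then have "\<Phi> P = \<Phi> (\<Sum>i\<le>N. ps i * s ^ i)"
    unfolding conjunct2[OF sum] by simp
  then have "P = (\<Sum>i\<le>N. ps i * s ^ i)"
    by (rule \<Phi>_inj[OF assms conjunct1[OF sum]])
  moreover define Q where "Q = (\<Sum>i\<le>N. monom (ps i) i)"
  have "poly Q s = (\<Sum>i\<le>N. ps i * s ^ i)"
    by (simp add: Q_def poly_sum poly_monom)
  moreover have "coeff Q i \<in> S" for i
    using psS[of i] S_const[of 0] by (simp add: Q_def coeff_sum)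
  ultimately show ?thesis by metis
qed

lemma free:
  assumes Q: "\<forall>i. coeff Q i \<in> S" and z: "poly Q s = 0"
  shows "Q = 0"
proof (rule poly_eqI)
  fix k
  let ?n = "max k (degree Q)"
  have "poly Q s = (\<Sum>i\<le>?n. coeff Q i * s ^ i)"
    unfolding poly_altdef by (rule sum.mono_neutral_left) (auto simp: coeff_eq_0)
  then have "\<Phi> 0 = (\<lambda>k. if k \<le> ?n then \<Phi> (coeff Q k) 0 else \<zero>\<^bsub>B\<^esub>)"
    using S_sum_value[of "coeff Q" "\<lambda>k. \<Phi> (coeff Q k) 0" ?n] Q z by simp
  from fun_cong[OF this, of k] have "\<Phi> (coeff Q k) 0 = \<zero>\<^bsub>B\<^esub>"
    by (simp add: \<Phi>_zero)
  then have "\<Phi> (coeff Q k) = \<Phi> 0"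
    using S_D[of "coeff Q k"] Q unfolding \<Phi>_zero by metis
  then show "coeff Q k = coeff 0 k"
    using \<Phi>_inj[OF _ zero_M] S_D[of "coeff Q k"] Q by (metis coeff_0)
qed

lemma is_free_extension: "free_extension br d S s"
  by (intro free_extension.intro free_extension_axioms.intro quadratic_bracket_axioms d_pos
      S_const S_add S_mult S_pbr s s_central generates free; (use S_D in blast)?)

theorem isomorphic: "poisson_isomorphic (ring_of_type_algebra :: 'k ring) V B"
proof -
  obtain h where h: "bij_betw h (veronese_set d) S"
    "\<And>x y. \<lbrakk>x \<in> veronese_set d; y \<in> veronese_set d\<rbrakk> \<Longrightarrow> h (x + y) = h x + h y"
    "\<And>x y. \<lbrakk>x \<in> veronese_set d; y \<in> veronese_set d\<rbrakk> \<Longrightarrow> h (x * y) = h x * h y"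
    "\<And>x y. \<lbrakk>x \<in> veronese_set d; y \<in> veronese_set d\<rbrakk> \<Longrightarrow> h (br x y) = pbr (h x) (h y)"
    "\<And>c. h (const c) = pconst c"
    by (rule free_extension.exists_iso[OF is_free_extension]) blast
  define g where "g r = \<Phi> (h r) 0" for r
  have hS: "h r \<in> S" if "r \<in> veronese_set d" for r
    using h(1) that by (auto simp: bij_betw_def)
  note carr = carrier_veronese[OF d_pos, of br]
  have "bij_betw (\<lambda>P. \<Phi> P 0) S (carrier B)"
    unfolding bij_betw_def
  proof
    show "inj_on (\<lambda>P. \<Phi> P 0) S"
    proof (rule inj_onI)
      fix P Q assume PQ: "P \<in> S" "Q \<in> S" and eq: "\<Phi> P 0 = \<Phi> Q 0"
      note P = S_D[OF PQ(1)] and Q = S_D[OF PQ(2)]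
      have "\<Phi> P = mon (\<Phi> Q 0) 0" using P unfolding eq by blast
      also have "\<dots> = \<Phi> Q" using Q by (intro sym[of "\<Phi> Q"]) blast
      finally show "P = Q" using \<Phi>_inj P Q by blast
    qed
    show "(\<lambda>P. \<Phi> P 0) ` S = carrier B"
    proof (intro equalityI subsetI)
      fix b assume b: "b \<in> carrier B"
      obtain P where P: "P \<in> M" "\<Phi> P = mon b 0" using preimage[OF b, of 0] by blast
      then have "P \<in> S" "\<Phi> P 0 = b" using S_I[OF P(1) b P(2)] by simp_all
      then show "b \<in> (\<lambda>P. \<Phi> P 0) ` S" by blast
    qed (use S_D in auto)
  qed
  from bij_betw_trans[OF h(1) this] have bij: "bij_betw g (carrier V) (carrier B)"
    unfolding carr g_def comp_def .
  have g_add: "g (x + y) = g x \<oplus>\<^bsub>B\<^esub> g y" if "x \<in> veronese_set d" "y \<in> veronese_set d" for x y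
    using that hS S_D by (simp add: g_def h \<Phi>_add)
  have g_mult: "g (x * y) = g x \<otimes>\<^bsub>B\<^esub> g y" if "x \<in> veronese_set d" "y \<in> veronese_set d" for x y
    using that hS by (simp add: g_def h S_mult_value)
  have g_br: "g (br x y) = bracket B (g x) (g y)" if "x \<in> veronese_set d" "y \<in> veronese_set d" for x y
    using that hS by (simp add: g_def h S_pbr_value)
  have g_one: "g 1 = \<one>\<^bsub>B\<^esub>"
    using h(5)[of 1] by (simp add: g_def \<Phi>_one flip: one_pCons)
  have g_smult: "g (const c * x) = c \<odot>\<^bsub>B\<^esub> g x" if "x \<in> veronese_set d" for c x
  proof -
    have "h (const c * x) = pconst c * h x"
      using h(3)[OF veronese_set_const that] h(5) by simp
    then show ?thesis using S_D[OF hS[OF that]] by (simp only: g_def \<Phi>_smult)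
  qed
  have "g \<in> ring_iso V B"
    unfolding ring_iso_def
  proof (intro CollectI conjI bij ring_hom_memI)
    show "g x \<in> carrier B" if "x \<in> carrier V" for x
      using bij that by (auto simp: bij_betw_def)
  qed (simp_all add: carr g_add g_mult g_one)
  then have "g \<in> poisson_iso (ring_of_type_algebra :: 'k ring) V B"
    by (simp add: poisson_iso_def carr g_smult g_br)
  then show ?thesis unfolding poisson_isomorphic_def by blast
qed

end

theorem corollary3p14:
  fixes br :: "(3, 'k::field_char_0) mpoly \<Rightarrow> (3, 'k) mpoly \<Rightarrow> (3, 'k) mpoly"
    and d :: nat
  assumes "poisson_algebra (ring_of_type_algebra :: 'k ring) (polynomial_poisson br)"
    and "quadratic br"
    and "\<exists>p q. br p q \<noteq> 0"
    and "d \<ge> 1"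
  shows "poisson_cancellative TYPE('b) (ring_of_type_algebra :: 'k ring)
           (veronese d (polynomial_poisson br))"
  unfolding poisson_cancellative_def
proof (intro allI impI)
  fix B :: "('k, 'b) poisson"
  assume B: "poisson_algebra (ring_of_type_algebra :: 'k ring) B"
    and "poisson_isomorphic (ring_of_type_algebra :: 'k ring)
      (poly_extension (veronese d (polynomial_poisson br))) (poly_extension B)"
  then obtain \<phi> where "\<phi> \<in> poisson_iso (ring_of_type_algebra :: 'k ring)
      (poly_extension (veronese d (polynomial_poisson br))) (poly_extension B)"
    unfolding poisson_isomorphic_def by blast
  with B quadratic_bracket_if_poisson_algebra[OF assms(1-3)] assms(4)
  have "veronese_extension_iso br d B \<phi>"
    by (intro veronese_extension_iso.intro veronese_extension_iso_axioms.intro)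
  then show "poisson_isomorphic (ring_of_type_algebra :: 'k ring) (veronese d (polynomial_poisson br)) B"
    by (rule veronese_extension_iso.isomorphic)
qed

end
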